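(* Let $L\subset\mathbb{R}^n$ be a non-Cartesian crystallographic root lattice, let $T_0$ be the tessellation of $\mathbb{R}^n$ by the Voronoi cells of $L$, and let $\{T_j\}_{j=0,\dots,J}$, $J\ge1$, be an efficient family of distinct tessellations $T_j=T_0+v_j$ ($v_0=0$, $v_j\in\mathbb{R}^n$). Then the overcomplete family of splines obtained by convolution of the Voronoi cell is not refinable: for every order $k\ge1$ there are no $0<\lambda<1$ and $v\in\mathbb{R}^n$ such that every Voronoi spline of order $k$ on any of the $T_j$ is a linear combination of Voronoi splines of order $k$ on the scaled-down tessellations $T_0^1,\dots,T_J^1$, where $T_i^1=\lambda T_i+v$.
   Context: The (symmetric crystallographic) root lattices considered are, up to similarity, $\mathcal{A}_n,\mathcal{A}_n^*,\mathcal{B}_n,\mathcal{D}_n,\mathcal{D}_n^*$ and $\mathcal{E}_6,\mathcal{E}_7,\mathcal{E}_8$ in the standard (Conway–Sloane) notation: $\mathcal{A}_n=\{x\in\mathbb{Z}^{n+1}:\sum x_i=0\}$ viewed as a lattice in its $n$-dimensional span ($n\ge2$), $\mathcal{D}_n=\{x\in\mathbb{Z}^n:\sum x_i \text{ even}\}$ ($n\ge3$), $^*$ denotes the dual lattice, $\mathcal{E}_j$ is the lattice generated by the root system $E_j$, and $\mathcal{B}_n=\mathbb{Z}^n$ is the Cartesian lattice. The non-Cartesian ones are $\mathcal{A}_n,\mathcal{A}_n^*$ ($n\ge2$), $\mathcal{D}_n,\mathcal{D}_n^*$ ($n\ge3$), $\mathcal{E}_6,\mathcal{E}_7,\mathcal{E}_8$.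 The Voronoi (nearest-neighbor) cell of $p\in L$ is the set of points of $\mathbb{R}^n$ at least as close to $p$ as to any other point of $L$; these cells form the tessellation $T_0$ by translates of the Voronoi cell $V$ of the origin. A family $\{T_j\}$ of tessellations is efficient if the intersection of more than two cell facets ($(n-1)$-dimensional faces of cells from any of the $T_j$, facets belonging to different cells being counted separately) is of co-dimension greater than $1$. Let $\chi_V$ be the indicator function of $V$ and $\chi_V^{*k}$ its $k$-fold convolution ($\chi_V^{*1}=\chi_V$). The Voronoi splines of order $k$ on $T_j$ are the functions $x\mapsto\chi_V^{*k}(x-p)$, $p\in L+v_j$; those on $T_i^1=\lambda T_i+v$ are the functions $x\mapsto\chi_{\lambda V}^{*k}(x-p)$, $p\in\lambda(L+v_i)+v$. Linear combinations may be infinite (the sums are locally finite); equality for $k=1$ is meant up to values on cell boundaries. *)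

theory Defs
  imports "HOL-Analysis.Analysis"
begin

text \<open>
  The standard lattices may live in a proper subspace of their ambient space; \<open>dual_lattice\<close>
  and \<open>similar_lattice\<close> therefore refer to the linear span of the lattice.
\<close>

definition dual_lattice :: "'a::euclidean_space set \<Rightarrow> 'a set" where
  "dual_lattice L = {y \<in> span L. \<forall>x\<in>L. x \<bullet> y \<in> \<int>}"

definition similar_lattice :: "'a::euclidean_space set \<Rightarrow> 'b::euclidean_space set \<Rightarrow> bool" where
  "similar_lattice L M \<longleftrightarrow>
     (\<exists>f c. linear f \<and> c > 0 \<and> (\<forall>x. norm (f x) = c * norm x) \<and> range f = span M \<and> f ` L = M)"

definition generated_lattice :: "'a::euclidean_space set \<Rightarrow> 'a set" where
  "generated_lattice R = (\<lambda>S. 0 \<in> S \<and> (\<forall>x\<in>S. \<forall>y\<in>S. x - y \<in> S)) hull R"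

text \<open>
  \<open>lattice_A\<close> is \<open>A\<^sub>n\<close> for \<open>n = CARD('n)\<close>: the index type \<open>'n option\<close> has \<open>n + 1\<close> elements.
\<close>

definition lattice_A :: "(real ^ ('n::finite option)) set" where
  "lattice_A = {x. (\<forall>i. x $ i \<in> \<int>) \<and> (\<Sum>i\<in>UNIV. x $ i) = 0}"

definition lattice_D :: "(real ^ 'n) set" where
  "lattice_D = {x. (\<forall>i. x $ i \<in> \<int>) \<and> (\<Sum>i\<in>UNIV. x $ i) / 2 \<in> \<int>}"

text \<open>
  The root systems \<open>E\<^sub>8\<close>, \<open>E\<^sub>7\<close>, \<open>E\<^sub>6\<close> in Conway--Sloane coordinates (240, 126 and 72 roots).
  The elements of the index type \<open>8\<close> are \<open>1, \<dots>, 8\<close>, with \<open>8 = 0\<close>.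
\<close>

definition roots_E8 :: "(real ^ 8) set" where
  "roots_E8 =
     {a *\<^sub>R axis i 1 + b *\<^sub>R axis j 1 | a b i j. a \<in> {-1, 1} \<and> b \<in> {-1, 1} \<and> i \<noteq> j}
     \<union> {x. (\<forall>i. x $ i \<in> {-1/2, 1/2}) \<and> even (card {i. x $ i = -1/2})}"

definition roots_E7 :: "(real ^ 8) set" where
  "roots_E7 = {x \<in> roots_E8. (\<Sum>i\<in>UNIV. x $ i) = 0}"

definition roots_E6 :: "(real ^ 8) set" where
  "roots_E6 = {x \<in> roots_E8. x $ 1 + x $ 8 = 0 \<and> (\<Sum>i\<in>UNIV - {1, 8}. x $ i) = 0}"

definition non_cartesian_root_lattice :: "(real ^ 'n) set \<Rightarrow> bool" where
  "non_cartesian_root_lattice L \<longleftrightarrow>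
     CARD('n) \<ge> 2 \<and> (similar_lattice L (lattice_A :: (real ^ ('n option)) set) \<or>
                       similar_lattice L (dual_lattice (lattice_A :: (real ^ ('n option)) set))) \<or>
     CARD('n) \<ge> 3 \<and> (similar_lattice L (lattice_D :: (real ^ 'n) set) \<or>
                       similar_lattice L (dual_lattice (lattice_D :: (real ^ 'n) set))) \<or>
     CARD('n) = 6 \<and> similar_lattice L (generated_lattice roots_E6) \<or>
     CARD('n) = 7 \<and> similar_lattice L (generated_lattice roots_E7) \<or>
     CARD('n) = 8 \<and> similar_lattice L (generated_lattice roots_E8)"

definition voronoi_cell :: "'a::metric_space set \<Rightarrow> 'a \<Rightarrow> 'a set" where
  "voronoi_cell L p = {x. \<forall>q\<in>L. dist x p \<le> dist x q}"

definition voronoi_tessellation :: "'a::metric_space set \<Rightarrow> 'a set set" where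
  "voronoi_tessellation L = voronoi_cell L ` L"

definition affine_tessellation ::
    "real \<Rightarrow> 'a::real_vector \<Rightarrow> 'a set set \<Rightarrow> 'a set set" where
  "affine_tessellation s w T = (\<lambda>C. (\<lambda>x. s *\<^sub>R x + w) ` C) ` T"

text \<open>
  A facet is counted together with the cell it belongs to, so the common facet of two adjacent
  cells of one tessellation already accounts for two.
\<close>

definition cell_facets :: "'a::euclidean_space set set \<Rightarrow> ('a set \<times> 'a set) set" where
  "cell_facets \<C> = {(C, F). C \<in> \<C> \<and> F facet_of C}"

definition efficient :: "'a::euclidean_space set set set \<Rightarrow> bool" where
  "efficient \<T> \<longleftrightarrow>
     (\<forall>S \<subseteq> cell_facets (\<Union>\<T>). \<not> (finite S \<and> card S \<le> 2) \<longrightarrow>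
        int DIM('a) - aff_dim (\<Inter>(snd ` S)) > 1)"

definition convolution ::
    "('a::euclidean_space \<Rightarrow> real) \<Rightarrow> ('a \<Rightarrow> real) \<Rightarrow> 'a \<Rightarrow> real" where
  "convolution f g x = (LINT y|lborel. f y * g (x - y))"

text \<open>The \<open>k\<close>-fold convolution of \<open>f\<close> with itself; only meaningful for \<open>k \<ge> 1\<close>.\<close>

definition conv_power :: "('a::euclidean_space \<Rightarrow> real) \<Rightarrow> nat \<Rightarrow> 'a \<Rightarrow> real" where
  "conv_power f k = (convolution f ^^ (k - 1)) f"

definition shifted_splines ::
    "nat \<Rightarrow> 'a::euclidean_space set \<Rightarrow> 'a set \<Rightarrow> ('a \<Rightarrow> real) set" where
  "shifted_splines k V P = (\<lambda>p x. conv_power (indicat_real V) k (x - p)) ` P"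

text \<open>
  A possibly infinite linear combination of functions from \<open>B\<close>, evaluated pointwise on \<open>X\<close>.
  For Voronoi splines only finitely many summands are nonzero at each point, so the
  \<open>has_sum\<close> is a finite sum.
\<close>

definition linear_combination_on ::
    "'a set \<Rightarrow> ('a \<Rightarrow> real) set \<Rightarrow> ('a \<Rightarrow> real) \<Rightarrow> bool" where
  "linear_combination_on X B f \<longleftrightarrow> (\<exists>c. \<forall>x\<in>X. ((\<lambda>b. c b * b x) has_sum f x) B)"

text \<open>
  The splines of order \<open>k\<close> on the tessellations \<open>T\<^sub>0 + v j\<close>, \<open>j \<le> J\<close>, are refined by those on the
  tessellations \<open>s (T\<^sub>0 + v i) + w\<close>, \<open>i \<le> J\<close>. For \<open>k = 1\<close> values on cell boundaries are ignored.
\<close>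

definition refined_by ::
    "'a::euclidean_space set \<Rightarrow> nat \<Rightarrow> (nat \<Rightarrow> 'a) \<Rightarrow> nat \<Rightarrow> real \<Rightarrow> 'a \<Rightarrow> bool" where
  "refined_by L J v k s w \<longleftrightarrow>
     (let V = voronoi_cell L 0;
          T = (\<lambda>j. affine_tessellation 1 (v j) (voronoi_tessellation L));
          T1 = (\<lambda>i. affine_tessellation s w (T i));
          boundaries = (\<Union>C \<in> (\<Union>j\<le>J. T j \<union> T1 j). frontier C);
          X = (if k = 1 then - boundaries else UNIV);
          coarse = (\<lambda>j. shifted_splines k V ((\<lambda>p. p + v j) ` L));
          refined = (\<lambda>i. shifted_splines k ((*\<^sub>R) s ` V) ((\<lambda>p. s *\<^sub>R (p + v i) + w) ` L))
      in \<forall>j\<le>J. \<forall>f \<in> coarse j. linear_combination_on X (\<Union>i\<le>J. refined i) f)"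

end

theory Submission
  imports Defs "HOL-Computational_Algebra.Fundamental_Theorem_Algebra"
begin

text \<open>
  Suppose the spline of order \<open>k\<close> at a lattice point is a combination of the scaled splines. The rows
  pairing the scaled splines with test functions generate a submodule of the module of finitely supported
  functions on the scaled centers. Either a power of the difference in direction \<open>p\<close> maps everything
  into this submodule, or some nonzero coefficient function \<open>a\<close> that is multiplied by a character of the
  lattice under translations, with a nontrivial value at \<open>p\<close>, is orthogonal to it. In the second case \<open>a\<close> is
  a relation between the splines of order \<open>k\<close>; convolution operators are normal on the torus, so it is already a
  relation of order \<open>1\<close>. If \<open>p\<close> is a facet vector, efficiency provides points of the facet between \<open>c\<close> and
  \<open>c + p\<close> off all other cell boundaries, and crossing the facet there gives \<open>a c = a (c + p)\<close>, a
  contradiction. Hence the first case holds, and an iterated difference of the coefficients of the refinement has finite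
  support, which yields an identity between real Laplace transforms in direction \<open>p\<close>. As \<open>t \<rightarrow> \<infinity>\<close>, the part of
  \<open>V\<close> outside the prism over the facet contributes exponentially little to it, so near the facet \<open>V\<close> lies in the
  prism, and then everywhere by convexity. But a non-Cartesian root
  lattice has a vector \<open>r\<close> skew to \<open>p\<close> with \<open>r / 2 \<in> V\<close>, while \<open>V\<close> does not contain the projection of \<open>r / 2\<close> to the
  hyperplane of the facet.
\<close>

section \<open>Convolution of bounded functions\<close>

text \<open>The coefficients of a refinement are arbitrary: no growth bound is available, so they
  have no Fourier transform, and the vectors \<open>v j\<close> need not be commensurable with the
  lattice, so the scaled centers are only a finite union of cosets. Statements about coefficients
  are therefore made by duality with finitely supported functions, where finite generation over a
  group algebra takes the place of analysis. A character found there need not be unitary;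
  multiplication by the exponential of a linear map makes it trivial, and only then is the
  positivity of the torus integral available. Differences are taken in the single direction
  \<open>p\<close> because crossing a facet controls the shift by \<open>p\<close> only. The real
  Laplace transform isolates that facet: the prism over it contributes a constant times
  \<open>1 - exp (- (2 * h * t))\<close>, while a slanted remainder contributes a term that tends to
  0 more slowly than every exponential. The relation between \<open>t\<close> and
  \<open>s * t\<close> tolerates only exponentially small corrections, and this is the
  contradiction.\<close>

definition bounded_meas :: "('a::euclidean_space \<Rightarrow> complex) \<Rightarrow> bool" where
  "bounded_meas f \<longleftrightarrow> f \<in> borel_measurable borel \<and> bounded (range f)"

text \<open>Cells, their convolution powers and the test functions all lie in this class. It is
  closed under shifts, convolution and multiplication by bounded measurable functions, so
  integrability comes for free.\<close>

definition bounded_supp :: "('a::euclidean_space \<Rightarrow> complex) \<Rightarrow> bool" where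
  "bounded_supp f \<longleftrightarrow> bounded_meas f \<and> bounded {x. f x \<noteq> 0}"

text \<open>The complex counterpart of \<open>convolution\<close>: the splines are real, but the
  characters of the lattice are not.\<close>

definition cconv :: "('a::euclidean_space \<Rightarrow> complex) \<Rightarrow> ('a \<Rightarrow> complex) \<Rightarrow> 'a \<Rightarrow> complex" where
  "cconv f g x = (LINT y|lborel. f y * g (x - y))"

lemma bounded_meas_measurable [measurable_dest]: "bounded_meas f \<Longrightarrow> f \<in> borel_measurable borel"
  by (simp add: bounded_meas_def)

lemma bounded_meas_bound: assumes "bounded_meas f" obtains B where "0 \<le> B" "\<And>x. norm (f x) \<le> B"
proof -
  obtain B where "\<And>x. norm (f x) \<le> B" using assms unfolding bounded_meas_def bounded_iff by auto
  then have "0 \<le> max B 0" "\<And>x. norm (f x) \<le> max B 0" by (auto simp: le_max_iff_disj)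
  then show thesis using that by blast
qed

lemma bounded_measI: "f \<in> borel_measurable borel \<Longrightarrow> (\<And>x. norm (f x) \<le> B) \<Longrightarrow> bounded_meas f"
  unfolding bounded_meas_def bounded_iff by auto

lemma bounded_supp_imp_bounded_meas: "bounded_supp f \<Longrightarrow> bounded_meas f" by (simp add: bounded_supp_def)

lemma bounded_supp_measurable [measurable_dest]: "bounded_supp f \<Longrightarrow> f \<in> borel_measurable borel"
  by (simp add: bounded_meas_measurable bounded_supp_imp_bounded_meas)

lemma bounded_supp_support: assumes "bounded_supp f" obtains R where "0 \<le> R" "\<And>x. f x \<noteq> 0 \<Longrightarrow> norm x \<le> R"
proof -
  obtain R where "\<And>x. f x \<noteq> 0 \<Longrightarrow> norm x \<le> R" using assms unfolding bounded_supp_def bounded_iff by auto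
  then have "0 \<le> max R 0" "\<And>x. f x \<noteq> 0 \<Longrightarrow> norm x \<le> max R 0" by (auto simp: le_max_iff_disj)
  then show thesis using that by blast
qed

lemma bounded_suppI: "bounded_meas f \<Longrightarrow> (\<And>x. f x \<noteq> 0 \<Longrightarrow> norm x \<le> R) \<Longrightarrow> bounded_supp f"
  unfolding bounded_supp_def bounded_iff by auto

lemma integrable_bounded_support:
  fixes f :: "'a::euclidean_space \<Rightarrow> 'b::{banach,second_countable_topology}"
  assumes [measurable]: "f \<in> borel_measurable borel"
    and B: "\<And>x. norm (f x) \<le> B" and R: "\<And>x. f x \<noteq> 0 \<Longrightarrow> norm x \<le> R"
  shows "integrable lborel f"
proof (rule integrableI_bounded_set[where A="cball 0 R" and B=B])
  show "emeasure lborel (cball (0::'a) R) < \<infinity>"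
    by (rule emeasure_lborel_cball_finite)
qed (use B R in auto)

lemma bounded_supp_integrable: assumes "bounded_supp f" shows "integrable lborel f"
proof -
  obtain B R where "\<And>x. norm (f x) \<le> B" "\<And>x. f x \<noteq> 0 \<Longrightarrow> norm x \<le> R"
    using assms bounded_meas_bound[OF bounded_supp_imp_bounded_meas] bounded_supp_support by metis
  then show ?thesis using assms by (intro integrable_bounded_support bounded_supp_measurable)
qed

lemma bounded_meas_mult: assumes "bounded_meas f" "bounded_meas g" shows "bounded_meas (\<lambda>x. f x * g x)"
proof -
  obtain B where B: "0 \<le> B" "\<And>x. norm (f x) \<le> B" using assms(1) bounded_meas_bound by metis
  obtain C where C: "\<And>x. norm (g x) \<le> C" using assms(2) bounded_meas_bound by metis
  show ?thesis
  proof (rule bounded_measI)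
    show "(\<lambda>x. f x * g x) \<in> borel_measurable borel"
      using assms by (intro borel_measurable_times bounded_meas_measurable)
    show "norm (f x * g x) \<le> B * C" for x
      unfolding norm_mult using B C by (intro mult_mono) auto
  qed
qed

lemma bounded_meas_shift: assumes "bounded_meas f" shows "bounded_meas (\<lambda>x. f (x - c))" "bounded_meas (\<lambda>x. f (x + c))" "bounded_meas (\<lambda>x. f (c - x))"
proof -
  have [measurable]: "f \<in> borel_measurable borel" using assms bounded_meas_measurable by auto
  obtain B where "\<And>x. norm (f x) \<le> B" using assms bounded_meas_bound by metis
  then show "bounded_meas (\<lambda>x. f (x - c))" "bounded_meas (\<lambda>x. f (x + c))" "bounded_meas (\<lambda>x. f (c - x))"
    by (auto intro!: bounded_measI[where B=B])
qed

lemma bounded_supp_mult: assumes "bounded_supp f" "bounded_meas g" shows "bounded_supp (\<lambda>x. f x * g x)"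
proof -
  have "bounded {x. f x * g x \<noteq> 0}"
    by (rule bounded_subset[of "{x. f x \<noteq> 0}"]) (use assms in \<open>auto simp: bounded_supp_def\<close>)
  then show ?thesis using assms by (auto simp: bounded_supp_def bounded_meas_mult)
qed

lemma bounded_supp_shift: assumes "bounded_supp f" shows "bounded_supp (\<lambda>x. f (x - c))" "bounded_supp (\<lambda>x. f (x + c))" "bounded_supp (\<lambda>x. f (c - x))"
proof -
  obtain R where R: "\<And>x. f x \<noteq> 0 \<Longrightarrow> norm x \<le> R" using assms bounded_supp_support by metis
  have bounded_meas: "bounded_meas f" using assms by (rule bounded_supp_imp_bounded_meas)
  show "bounded_supp (\<lambda>x. f (x - c))"
  proof (rule bounded_suppI[where R="R + norm c", OF bounded_meas_shift(1)[OF bounded_meas]])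
    fix x assume "f (x - c) \<noteq> 0"
    then show "norm x \<le> R + norm c" using R[of "x - c"] norm_triangle_ineq2[of x c] by linarith
  qed
  show "bounded_supp (\<lambda>x. f (x + c))"
  proof (rule bounded_suppI[where R="R + norm c", OF bounded_meas_shift(2)[OF bounded_meas]])
    fix x assume "f (x + c) \<noteq> 0"
    then show "norm x \<le> R + norm c" using R[of "x + c"] norm_triangle_ineq2[of x "-c"] by simp
  qed
  show "bounded_supp (\<lambda>x. f (c - x))"
  proof (rule bounded_suppI[where R="R + norm c", OF bounded_meas_shift(3)[OF bounded_meas]])
    fix x assume "f (c - x) \<noteq> 0"
    then show "norm x \<le> R + norm c"
      using R[of "c - x"] norm_triangle_ineq2[of x c] by (simp add: norm_minus_commute)
  qed
qed

lemma cconv_integrable: assumes "bounded_supp f" "bounded_meas g" shows "integrable lborel (\<lambda>y. f y * g (x - y))"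
  using assms by (intro bounded_supp_integrable bounded_supp_mult bounded_meas_shift)

lemma bounded_meas_cconv: assumes "bounded_supp f" "bounded_meas g" shows "bounded_meas (cconv f g)"
proof -
  have [measurable]: "f \<in> borel_measurable borel" "g \<in> borel_measurable borel"
    using assms bounded_meas_measurable bounded_supp_measurable by auto
  obtain B where B: "0 \<le> B" "\<And>x. norm (g x) \<le> B" using assms bounded_meas_bound by metis
  show ?thesis
  proof (rule bounded_measI)
    show "cconv f g \<in> borel_measurable borel"
      unfolding cconv_def[abs_def] by measurable
    have i: "integrable lborel (\<lambda>y. norm (f y) * B)"
      by (intro integrable_mult_left integrable_norm bounded_supp_integrable assms)
    show "norm (cconv f g x) \<le> (LINT y|lborel. norm (f y) * B)" for x
      unfolding cconv_def
      by (intro order_trans[OF integral_norm_bound] integral_mono integrable_norm cconv_integrable assms i)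
         (auto simp: norm_mult B intro!: mult_left_mono)
  qed
qed

lemma cconv_support:
  assumes "\<And>x. f x \<noteq> 0 \<Longrightarrow> norm x \<le> R" "\<And>x. g x \<noteq> 0 \<Longrightarrow> norm x \<le> S" "cconv f g x \<noteq> 0"
  shows "norm x \<le> R + S"
proof (rule ccontr)
  assume n: "\<not> norm x \<le> R + S"
  have "f y * g (x - y) = 0" for y
  proof (rule ccontr)
    assume "f y * g (x - y) \<noteq> 0"
    then have "norm y \<le> R" "norm (x - y) \<le> S" using assms by auto
    then show False using n norm_triangle_ineq[of y "x - y"] by simp
  qed
  then have "cconv f g x = 0" unfolding cconv_def using Bochner_Integration.integral_cong[of lborel lborel "\<lambda>y. f y * g (x - y)" "\<lambda>_. 0"] by simp
  then show False using assms(3) by simp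
qed

lemma bounded_supp_cconv: assumes "bounded_supp f" "bounded_supp g" shows "bounded_supp (cconv f g)"
proof -
  obtain R where R: "\<And>x. f x \<noteq> 0 \<Longrightarrow> norm x \<le> R" using assms(1) bounded_supp_support by metis
  obtain S where S: "\<And>x. g x \<noteq> 0 \<Longrightarrow> norm x \<le> S" using assms(2) bounded_supp_support by metis
  show ?thesis
    by (rule bounded_suppI[OF bounded_meas_cconv[OF assms(1) bounded_supp_imp_bounded_meas[OF assms(2)]] cconv_support[OF R S]])
qed

lemma integrable_product_bounded:
  fixes F :: "'a::euclidean_space \<times> 'b::euclidean_space \<Rightarrow> 'c::{banach,second_countable_topology}"
  assumes "F \<in> borel_measurable borel" and B: "\<And>z. norm (F z) \<le> B"
    and R: "\<And>y z. F (y, z) \<noteq> 0 \<Longrightarrow> norm y \<le> R \<and> norm z \<le> S"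
  shows "integrable (lborel \<Otimes>\<^sub>M lborel) F"
  unfolding lborel_prod
proof (rule integrable_bounded_support[where B=B and R="R+S"])
  fix x assume "F x \<noteq> 0"
  then have "norm (fst x) \<le> R" "norm (snd x) \<le> S" using R[of "fst x" "snd x"] by auto
  then show "norm x \<le> R + S"
    using norm_Pair_le[of "fst x" "snd x"] by simp
qed (use assms in auto)

text \<open>Fubini exchanges the two kernels, while the third function only has to be bounded. This
  commutation is what makes convolution operators on a torus normal.\<close>

lemma cconv_swap:
  assumes "bounded_supp f" "bounded_supp g" "bounded_meas u" shows "cconv f (cconv g u) = cconv g (cconv f u)"
proof
  fix x
  have [measurable]: "f \<in> borel_measurable borel" "g \<in> borel_measurable borel" "u \<in> borel_measurable borel"
    using assms bounded_meas_measurable bounded_supp_measurable by auto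
  obtain B where B: "0 \<le> B" "\<And>x. norm (f x) \<le> B" using assms bounded_meas_bound bounded_supp_imp_bounded_meas by metis
  obtain C where C: "0 \<le> C" "\<And>x. norm (g x) \<le> C" using assms bounded_meas_bound bounded_supp_imp_bounded_meas by metis
  obtain D where D: "0 \<le> D" "\<And>x. norm (u x) \<le> D" using assms bounded_meas_bound by metis
  obtain R where R: "\<And>x. f x \<noteq> 0 \<Longrightarrow> norm x \<le> R" using assms(1) bounded_supp_support by metis
  obtain S where S: "\<And>x. g x \<noteq> 0 \<Longrightarrow> norm x \<le> S" using assms(2) bounded_supp_support by metis
  have i: "integrable (lborel \<Otimes>\<^sub>M lborel) (\<lambda>(y,z). f y * (g z * u (x - y - z)))"
  proof (rule integrable_product_bounded[where B="B*(C*D)" and R=R and S=S])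
    show "(\<lambda>(y,z). f y * (g z * u (x - y - z))) \<in> borel_measurable borel"
      by (simp add: borel_prod[symmetric])
    show "cmod (case z of (y, z) \<Rightarrow> f y * (g z * u (x - y - z))) \<le> B * (C*D)" for z
      by (cases z) (auto simp: norm_mult intro!: mult_mono B C D mult_nonneg_nonneg)
  qed (use R S in auto)
  have "cconv f (cconv g u) x = (LINT y|lborel. LINT z|lborel. f y * (g z * u (x - y - z)))"
    unfolding cconv_def by (simp add: algebra_simps)
  also have "\<dots> = (LINT z|lborel. LINT y|lborel. f y * (g z * u (x - y - z)))"
    using lborel_pair.Fubini_integral[OF i] by simp
  also have "\<dots> = (LINT z|lborel. LINT y|lborel. g z * (f y * u (x - z - y)))"
    by (simp add: algebra_simps)
  also have "\<dots> = cconv g (cconv f u) x"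
    unfolding cconv_def by simp
  finally show "cconv f (cconv g u) x = cconv g (cconv f u) x" .
qed

lemma integral_affine:
  fixes h :: "'a::euclidean_space \<Rightarrow> 'b::{banach, second_countable_topology}"
  assumes h [measurable]: "h \<in> borel_measurable borel" and c: "c \<noteq> 0"
  shows "(LINT y|lborel. h y) = \<bar>c\<bar> ^ DIM('a) *\<^sub>R (LINT y|lborel. h (t + c *\<^sub>R y))"
proof -
  have "(LINT y|lborel. h y) = (LINT y|density (distr lborel borel (\<lambda>x. t + c *\<^sub>R x)) (\<lambda>_. ennreal (\<bar>c\<bar> ^ DIM('a))). h y)"
    by (rule arg_cong[where f="\<lambda>M. integral\<^sup>L M h", OF lborel_affine[OF c]])
  also have "\<dots> = (LINT y|distr lborel borel (\<lambda>x. t + c *\<^sub>R x). \<bar>c\<bar> ^ DIM('a) *\<^sub>R h y)"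
    by (subst integral_density) auto
  also have "\<dots> = (LINT y|lborel. \<bar>c\<bar> ^ DIM('a) *\<^sub>R h (t + c *\<^sub>R y))"
    by (subst integral_distr) auto
  finally show ?thesis by simp
qed

lemma integral_shift:
  fixes h :: "'a::euclidean_space \<Rightarrow> 'b::{banach, second_countable_topology}"
  assumes "h \<in> borel_measurable borel"
  shows "(LINT y|lborel. h (y + c)) = (LINT y|lborel. h y)" "(LINT y|lborel. h (y - c)) = (LINT y|lborel. h y)"
    "(LINT y|lborel. h (c - y)) = (LINT y|lborel. h y)"
proof -
  have *: "(LINT y|lborel. h (y + c)) = (LINT y|lborel. h y)" for c
  proof -
    have "(LINT y|lborel. h (y + c)) = (LINT y|lborel. h (c + 1 *\<^sub>R y))" by (simp add: add.commute)
    also have "\<dots> = (LINT y|lborel. h y)" using integral_affine[OF assms, of 1 c] by simp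
    finally show ?thesis .
  qed
  show "(LINT y|lborel. h (y + c)) = (LINT y|lborel. h y)" by (rule *)
  show "(LINT y|lborel. h (y - c)) = (LINT y|lborel. h y)" using *[of "-c"] by simp
  have "(LINT y|lborel. h (c - y)) = (LINT y|lborel. h (c + (-1) *\<^sub>R y))" by simp
  also have "\<dots> = (LINT y|lborel. h y)" using integral_affine[OF assms, of "-1" c] by simp
  finally show "(LINT y|lborel. h (c - y)) = (LINT y|lborel. h y)" .
qed

lemma cconv_assoc:
  assumes "bounded_supp f" "bounded_supp g" "bounded_meas u" shows "cconv f (cconv g u) = cconv (cconv f g) u"
proof
  fix x
  have [measurable]: "f \<in> borel_measurable borel" "g \<in> borel_measurable borel" "u \<in> borel_measurable borel"
    using assms bounded_meas_measurable bounded_supp_measurable by auto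
  obtain B where B: "0 \<le> B" "\<And>x. norm (f x) \<le> B" using assms bounded_meas_bound bounded_supp_imp_bounded_meas by metis
  obtain C where C: "0 \<le> C" "\<And>x. norm (g x) \<le> C" using assms bounded_meas_bound bounded_supp_imp_bounded_meas by metis
  obtain D where D: "0 \<le> D" "\<And>x. norm (u x) \<le> D" using assms bounded_meas_bound by metis
  obtain R where R: "\<And>x. f x \<noteq> 0 \<Longrightarrow> norm x \<le> R" using assms(1) bounded_supp_support by metis
  obtain S where S: "\<And>x. g x \<noteq> 0 \<Longrightarrow> norm x \<le> S" using assms(2) bounded_supp_support by metis
  have i: "integrable (lborel \<Otimes>\<^sub>M lborel) (\<lambda>(y,z). f y * (g (z - y) * u (x - z)))"
  proof (rule integrable_product_bounded[where B="B*(C*D)" and R=R and S="R+S"])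
    show "(\<lambda>(y,z). f y * (g (z - y) * u (x - z))) \<in> borel_measurable borel"
      by (simp add: borel_prod[symmetric])
    show "cmod (case z of (y, z) \<Rightarrow> f y * (g (z - y) * u (x - z))) \<le> B * (C*D)" for z
      by (cases z) (auto simp: norm_mult intro!: mult_mono B C D mult_nonneg_nonneg)
    fix y z assume "(case (y, z) of (y, z) \<Rightarrow> f y * (g (z - y) * u (x - z))) \<noteq> 0"
    then have "norm y \<le> R" "norm (z - y) \<le> S" using R S by auto
    then show "norm y \<le> R \<and> norm z \<le> R + S" using norm_triangle_ineq[of y "z - y"] by simp
  qed
  have "cconv f (cconv g u) x = (LINT y|lborel. f y * (LINT z|lborel. g (z - y) * u (x - z)))"
    unfolding cconv_def
  proof (rule Bochner_Integration.integral_cong[OF refl])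
    fix y
    show "f y * (LINT z|lborel. g z * u (x - y - z)) = f y * (LINT z|lborel. g (z - y) * u (x - z))"
      using integral_shift(2)[of "\<lambda>z. g z * u (x - y - z)" y] by (simp add: algebra_simps)
  qed
  also have "\<dots> = (LINT y|lborel. LINT z|lborel. f y * (g (z - y) * u (x - z)))"
    by simp
  also have "\<dots> = (LINT z|lborel. LINT y|lborel. f y * (g (z - y) * u (x - z)))"
    using lborel_pair.Fubini_integral[OF i] by simp
  also have "\<dots> = (LINT z|lborel. LINT y|lborel. (f y * g (z - y)) * u (x - z))"
    by (simp only: mult.assoc)
  also have "\<dots> = cconv (cconv f g) u x"
    unfolding cconv_def by simp
  finally show "cconv f (cconv g u) x = cconv (cconv f g) u x" .
qed

text \<open>Convolving with the constant function 1 gives the total integral, so this is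
  associativity with third factor 1.\<close>

lemma integral_cconv:
  assumes "bounded_supp f" "bounded_supp g"
  shows "(LINT x|lborel. cconv f g x) = (LINT x|lborel. f x) * (LINT x|lborel. g x)"
proof -
  have "cconv (cconv f g) (\<lambda>_. 1) 0 = cconv f (cconv g (\<lambda>_. 1)) 0"
    using cconv_assoc[OF assms, of "\<lambda>_. 1"] by (simp add: bounded_measI[of _ 1])
  then show ?thesis by (simp add: cconv_def)
qed

text \<open>Since \<open>exp (E y) * exp (E (x - y)) = exp (E x)\<close>, twisting by an exponential
  is multiplicative for convolution. Both the passage to periodic functions and the Laplace
  transforms rest on this.\<close>

lemma cconv_exp:
  fixes E :: "'a::euclidean_space \<Rightarrow> complex"
  assumes "linear E"
  shows "cconv (\<lambda>x. f x * exp (E x)) (\<lambda>x. g x * exp (E x)) = (\<lambda>x. cconv f g x * exp (E x))"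
proof
  fix x
  have "f y * exp (E y) * (g (x - y) * exp (E (x - y))) = f y * g (x - y) * exp (E x)" for y
    using linear_diff[OF assms, of x y] by (simp add: exp_diff)
  then have "cconv (\<lambda>x. f x * exp (E x)) (\<lambda>x. g x * exp (E x)) x = (LINT y|lborel. f y * g (x - y) * exp (E x))"
    unfolding cconv_def by (intro Bochner_Integration.integral_cong refl)
  then show "cconv (\<lambda>x. f x * exp (E x)) (\<lambda>x. g x * exp (E x)) x = cconv f g x * exp (E x)"
    by (simp add: cconv_def)
qed

lemma bounded_supp_exp:
  fixes E :: "'a::euclidean_space \<Rightarrow> complex"
  assumes f: "bounded_supp f" and E: "linear E"
  shows "bounded_supp (\<lambda>x. f x * exp (E x))"
proof -
  obtain R where R: "0 \<le> R" "\<And>x. f x \<noteq> 0 \<Longrightarrow> norm x \<le> R" using f bounded_supp_support by metis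
  obtain B where B: "0 \<le> B" "\<And>x. norm (f x) \<le> B" using f bounded_meas_bound bounded_supp_imp_bounded_meas by metis
  have c: "continuous_on UNIV (\<lambda>x. exp (E x))"
    using E by (intro continuous_intros linear_continuous_on) (simp add: linear_conv_bounded_linear)
  have "bounded ((\<lambda>x. exp (E x)) ` cball 0 R)"
    by (intro compact_imp_bounded compact_continuous_image continuous_on_subset[OF c] compact_cball subset_UNIV)
  then obtain M where M: "\<And>x. norm x \<le> R \<Longrightarrow> norm (exp (E x)) \<le> M"
    unfolding bounded_iff by (metis dist_0_norm image_eqI mem_cball)
  have M0: "0 \<le> M" using order_trans[OF norm_ge_zero M[of 0]] R(1) by simp
  show ?thesis
  proof (rule bounded_suppI[where R=R], rule bounded_measI[where B="B * M"])
    show "(\<lambda>x. f x * exp (E x)) \<in> borel_measurable borel"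
      using f c by (intro borel_measurable_times bounded_supp_measurable borel_measurable_continuous_onI)
    show "norm (f x * exp (E x)) \<le> B * M" for x
    proof (cases "f x = 0")
      case False
      then show ?thesis unfolding norm_mult using M R B by (intro mult_mono) auto
    qed (use B M0 in auto)
  qed (use R in auto)
qed

section \<open>Locally finite sums of translates\<close>

text \<open>Keeping only the nonzero terms makes the sum finite when \<open>P\<close> is locally
  finite and \<open>\<theta>\<close> has bounded support, so an infinite combination with arbitrary
  coefficients needs no notion of convergence.\<close>

definition dsum :: "'a::euclidean_space set \<Rightarrow> ('a \<Rightarrow> complex) \<Rightarrow> ('a \<Rightarrow> complex) \<Rightarrow> 'a \<Rightarrow> complex" where
  "dsum P \<alpha> \<theta> x = (\<Sum>\<tau> | \<tau> \<in> P \<and> \<theta> (x - \<tau>) \<noteq> 0. \<alpha> \<tau> * \<theta> (x - \<tau>))"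

definition locally_finite_set :: "'a::euclidean_space set \<Rightarrow> bool" where
  "locally_finite_set P \<longleftrightarrow> (\<forall>x r. finite (P \<inter> cball x r))"

lemma dsum_eq:
  assumes "finite Q" "Q \<subseteq> P" "\<And>\<tau>. \<tau> \<in> P \<Longrightarrow> \<theta> (x - \<tau>) \<noteq> 0 \<Longrightarrow> \<tau> \<in> Q"
  shows "dsum P \<alpha> \<theta> x = (\<Sum>\<tau>\<in>Q. \<alpha> \<tau> * \<theta> (x - \<tau>))"
  unfolding dsum_def using assms by (intro sum.mono_neutral_left) auto

text \<open>Only centers within distance \<open>R + S\<close> of \<open>x\<close> contribute to
  either side at \<open>x\<close>, which makes the exchange of sum and integral a finite
  one.\<close>

lemma cconv_dsum:
  assumes P: "locally_finite_set P" and "bounded_supp \<kappa>" "bounded_supp \<theta>"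
  shows "cconv \<kappa> (dsum P \<alpha> \<theta>) = dsum P \<alpha> (cconv \<kappa> \<theta>)"
proof
  fix x
  obtain R where R: "\<And>x. \<kappa> x \<noteq> 0 \<Longrightarrow> norm x \<le> R" using assms bounded_supp_support by metis
  obtain S where S: "\<And>x. \<theta> x \<noteq> 0 \<Longrightarrow> norm x \<le> S" using assms bounded_supp_support by metis
  define Q where "Q = P \<inter> cball x (R + S)"
  have Q: "finite Q" "Q \<subseteq> P" using P by (auto simp: Q_def locally_finite_set_def)
  have "\<kappa> y * dsum P \<alpha> \<theta> (x - y) = (\<Sum>\<tau>\<in>Q. \<alpha> \<tau> * (\<kappa> y * \<theta> (x - \<tau> - y)))" for y
  proof (cases "\<kappa> y = 0")
    case False
    have "dsum P \<alpha> \<theta> (x - y) = (\<Sum>\<tau>\<in>Q. \<alpha> \<tau> * \<theta> (x - y - \<tau>))"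
    proof (rule dsum_eq[OF Q])
      fix \<tau> assume "\<tau> \<in> P" "\<theta> (x - y - \<tau>) \<noteq> 0"
      then have "norm (x - y - \<tau>) \<le> S" "norm y \<le> R" using S R False by auto
      then have "norm (x - \<tau>) \<le> R + S" using norm_triangle_ineq[of y "x - y - \<tau>"] by simp
      then show "\<tau> \<in> Q" using \<open>\<tau> \<in> P\<close> by (simp add: Q_def dist_norm)
    qed
    then show ?thesis by (simp add: sum_distrib_left algebra_simps)
  qed simp
  then have "cconv \<kappa> (dsum P \<alpha> \<theta>) x = (LINT y|lborel. (\<Sum>\<tau>\<in>Q. \<alpha> \<tau> * (\<kappa> y * \<theta> (x - \<tau> - y))))"
    by (simp add: cconv_def)
  also have "\<dots> = (\<Sum>\<tau>\<in>Q. LINT y|lborel. \<alpha> \<tau> * (\<kappa> y * \<theta> (x - \<tau> - y)))"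
    using assms by (intro Bochner_Integration.integral_sum integrable_mult_right cconv_integrable bounded_supp_imp_bounded_meas)
  also have "\<dots> = (\<Sum>\<tau>\<in>Q. \<alpha> \<tau> * cconv \<kappa> \<theta> (x - \<tau>))"
    by (simp add: cconv_def)
  also have "\<dots> = dsum P \<alpha> (cconv \<kappa> \<theta>) x"
  proof (rule dsum_eq[OF Q, symmetric])
    fix \<tau> assume "\<tau> \<in> P" "cconv \<kappa> \<theta> (x - \<tau>) \<noteq> 0"
    then show "\<tau> \<in> Q" using cconv_support[OF R S] by (simp add: Q_def dist_norm)
  qed
  finally show "cconv \<kappa> (dsum P \<alpha> \<theta>) x = dsum P \<alpha> (cconv \<kappa> \<theta>) x" .
qed

text \<open>Truncations to growing balls are finite sums and at each point become constant in
  \<open>m\<close>.\<close>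

lemma dsum_measurable:
  assumes P: "locally_finite_set P" and "bounded_supp \<theta>"
  shows "dsum P \<alpha> \<theta> \<in> borel_measurable borel"
proof -
  obtain S where S: "\<And>x. \<theta> x \<noteq> 0 \<Longrightarrow> norm x \<le> S" using assms bounded_supp_support by metis
  define u where "u m x = (\<Sum>\<tau>\<in>P \<inter> cball 0 (real m). \<alpha> \<tau> * \<theta> (x - \<tau>))" for m x
  show ?thesis
  proof (rule borel_measurable_LIMSEQ_metric)
    show "u m \<in> borel_measurable borel" for m
      unfolding u_def[abs_def] using assms
      by (intro borel_measurable_sum borel_measurable_times borel_measurable_const bounded_supp_measurable bounded_supp_shift)
    fix x
    have "\<forall>\<^sub>F m in sequentially. u m x = dsum P \<alpha> \<theta> x"
      using eventually_ge_at_top[of "nat \<lceil>norm x + S\<rceil>"]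
    proof eventually_elim
      case (elim m)
      then have m: "norm x + S \<le> real m" by linarith
      show ?case unfolding u_def
      proof (rule dsum_eq[symmetric])
        fix \<tau> assume "\<tau> \<in> P" "\<theta> (x - \<tau>) \<noteq> 0"
        then show "\<tau> \<in> P \<inter> cball 0 (real m)"
          using S[of "x - \<tau>"] m norm_triangle_ineq2[of \<tau> x] by (simp add: norm_minus_commute)
      qed (use P in \<open>simp_all add: locally_finite_set_def\<close>)
    qed
    then show "(\<lambda>m. u m x) \<longlonglongrightarrow> dsum P \<alpha> \<theta> x" by (rule tendsto_eventually)
  qed
qed

section \<open>Modules of finitely supported functions\<close>

text \<open>Gaussian elimination: an unknown \<open>e\<close> with nonzero coefficient in equation
  \<open>d\<close> is eliminated, leaving one equation and one unknown fewer.\<close>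

lemma homogeneous_system_nontrivial:
  fixes w :: "'c \<Rightarrow> 'd \<Rightarrow> complex"
  assumes "finite D" "finite C" "card D < card C"
  shows "\<exists>g. (\<exists>c\<in>C. g c \<noteq> 0) \<and> (\<forall>d\<in>D. (\<Sum>c\<in>C. g c * w c d) = 0)"
  using assms
proof (induction D arbitrary: C w rule: finite_induct)
  case empty
  then obtain c where "c \<in> C" by (metis card.empty card_gt_0_iff ex_in_conv)
  then show ?case by (intro exI[of _ "\<lambda>_. 1"]) auto
next
  case (insert d D)
  show ?case
  proof (cases "\<forall>c\<in>C. w c d = 0")
    case True
    have "card D < card C" using insert by simp
    then obtain g where g: "\<exists>c\<in>C. g c \<noteq> 0" "\<forall>d\<in>D. (\<Sum>c\<in>C. g c * w c d) = 0"
      using insert.IH[of C w] insert.prems by auto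
    have "(\<Sum>c\<in>C. g c * w c d) = 0" using True by simp
    then show ?thesis using g by auto
  next
    case False
    then obtain e where e: "e \<in> C" "w e d \<noteq> 0" by blast
    define C' where "C' = C - {e}"
    have C: "C = insert e C'" "e \<notin> C'" "finite C'" using e insert.prems by (auto simp: C'_def)
    have "card D < card C'" using insert C by simp
    then obtain g where g: "\<exists>c\<in>C'. g c \<noteq> 0"
      "\<And>x. x \<in> D \<Longrightarrow> (\<Sum>c\<in>C'. g c * (w c x - w c d / w e d * w e x)) = 0"
      using insert.IH[of C' "\<lambda>c x. w c x - w c d / w e d * w e x"] C by blast
    \<comment> \<open>The value at \<open>e\<close> is the one that solves equation
      \<open>d\<close>.\<close>
    define g' where "g' = g(e := - (\<Sum>c\<in>C'. g c * w c d) / w e d)"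
    have s: "(\<Sum>c\<in>C. g' c * w c x) = (\<Sum>c\<in>C'. g c * (w c x - w c d / w e d * w e x))" for x
    proof -
      have "(\<Sum>c\<in>C. g' c * w c x) = g' e * w e x + (\<Sum>c\<in>C'. g' c * w c x)" using C by simp
      also have "(\<Sum>c\<in>C'. g' c * w c x) = (\<Sum>c\<in>C'. g c * w c x)"
        using C by (intro sum.cong) (auto simp: g'_def)
      also have "g' e * w e x = - (\<Sum>c\<in>C'. g c * (w c d / w e d * w e x))"
        by (simp add: g'_def sum_distrib_right sum_divide_distrib mult.assoc)
      finally show ?thesis by (simp add: right_diff_distrib sum_subtractf)
    qed
    have "\<exists>c\<in>C. g' c \<noteq> 0" using g(1) C by (auto simp: g'_def)
    moreover have "(\<Sum>c\<in>C. g' c * w c x) = 0" if "x \<in> insert d D" for x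
      using that g(2) e by (auto simp: s)
    ultimately show ?thesis by blast
  qed
qed

text \<open>
  \<open>W\<close> is a module over the group algebra of \<open>\<Gamma>\<close>, generated by the \<open>\<delta> \<rho>\<close> with \<open>\<rho> \<in> R\<close>, and \<open>Y \<gamma> c\<close> is
  multiplication by \<open>[\<gamma>] - c\<close>.
\<close>

locale shift_module =
  fixes P \<Gamma> R :: "'a::real_vector set" and p :: 'a
  assumes countable_P: "countable P" and finite_R: "finite R" and R_P: "R \<subseteq> P"
    and P_R: "\<And>\<tau>. \<tau> \<in> P \<Longrightarrow> \<exists>\<rho>\<in>R. \<exists>\<gamma>\<in>\<Gamma>. \<tau> = \<rho> + \<gamma>"
    and P_shift: "\<And>\<tau> \<gamma>. \<tau> \<in> P \<Longrightarrow> \<gamma> \<in> \<Gamma> \<Longrightarrow> \<tau> + \<gamma> \<in> P"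
    and p_in: "p \<in> \<Gamma>"
begin

definition W :: "('a \<Rightarrow> complex) set" where
  "W = {m. finite {\<tau>. m \<tau> \<noteq> 0} \<and> {\<tau>. m \<tau> \<noteq> 0} \<subseteq> P}"

definition sh :: "'a \<Rightarrow> ('a \<Rightarrow> complex) \<Rightarrow> 'a \<Rightarrow> complex" where
  "sh \<gamma> m = (\<lambda>\<tau>. m (\<tau> - \<gamma>))"

definition Y :: "'a \<Rightarrow> complex \<Rightarrow> ('a \<Rightarrow> complex) \<Rightarrow> 'a \<Rightarrow> complex" where
  "Y \<gamma> c m = (\<lambda>\<tau>. m (\<tau> - \<gamma>) - c * m \<tau>)"

abbreviation D :: "('a \<Rightarrow> complex) \<Rightarrow> 'a \<Rightarrow> complex" where "D \<equiv> Y p 1"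

definition \<delta> :: "'a \<Rightarrow> 'a \<Rightarrow> complex" where "\<delta> \<tau> = (\<lambda>\<sigma>. if \<sigma> = \<tau> then 1 else 0)"

definition submodule :: "('a \<Rightarrow> complex) set \<Rightarrow> bool" where
  "submodule M \<longleftrightarrow> M \<subseteq> W \<and> (\<lambda>_. 0) \<in> M \<and> (\<forall>m\<in>M. \<forall>m'\<in>M. \<forall>c. (\<lambda>\<tau>. m \<tau> + c * m' \<tau>) \<in> M)
     \<and> (\<forall>m\<in>M. \<forall>\<gamma>\<in>\<Gamma>. sh \<gamma> m \<in> M)"

text \<open>\<open>D\<close> acts injectively on \<open>W / M\<close>. Equivalently,
  \<open>M\<close> can be recovered from the submodule that it generates after \<open>D\<close> has
  been inverted.\<close>

definition saturated :: "('a \<Rightarrow> complex) set \<Rightarrow> bool" where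
  "saturated M \<longleftrightarrow> (\<forall>m\<in>W. D m \<in> M \<longrightarrow> m \<in> M)"

lemma subD:
  assumes "submodule M"
  shows "m \<in> M \<Longrightarrow> m \<in> W" "(\<lambda>_. 0) \<in> M" "m \<in> M \<Longrightarrow> m' \<in> M \<Longrightarrow> (\<lambda>\<tau>. m \<tau> + c * m' \<tau>) \<in> M"
    "m \<in> M \<Longrightarrow> \<gamma> \<in> \<Gamma> \<Longrightarrow> sh \<gamma> m \<in> M"
  using assms by (auto simp: submodule_def)

lemma submodule_scale: assumes "submodule M" "m \<in> M" shows "(\<lambda>\<tau>. c * m \<tau>) \<in> M"
  using subD(3)[OF assms(1) subD(2)[OF assms(1)] assms(2), of c] by simp

lemma submodule_add: assumes "submodule M" "m \<in> M" "m' \<in> M" shows "(\<lambda>\<tau>. m \<tau> + m' \<tau>) \<in> M"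
  using subD(3)[OF assms, of 1] by simp

lemma submodule_diff: assumes "submodule M" "m \<in> M" "m' \<in> M" shows "(\<lambda>\<tau>. m \<tau> - m' \<tau>) \<in> M"
  using subD(3)[OF assms, of "-1"] by simp

lemma submodule_sum: assumes "submodule M" "\<And>i. i \<in> I \<Longrightarrow> f i \<in> M" shows "(\<lambda>\<tau>. \<Sum>i\<in>I. c i * f i \<tau>) \<in> M"
  using assms(2)
proof (induction I rule: infinite_finite_induct)
  case (insert x F)
  have "(\<lambda>\<tau>. c x * f x \<tau> + (\<Sum>i\<in>F. c i * f i \<tau>)) \<in> M"
    using insert by (intro submodule_add submodule_scale assms(1)) auto
  then show ?case using insert by simp
qed (use assms(1) in \<open>auto simp: subD\<close>)

lemma submodule_Y: assumes "submodule M" "m \<in> M" "\<gamma> \<in> \<Gamma>" shows "Y \<gamma> c m \<in> M"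
  using submodule_diff[OF assms(1) subD(4)[OF assms] submodule_scale[OF assms(1,2), of c]]
  by (simp add: Y_def sh_def)

lemma submodule_W: "submodule W"
  unfolding submodule_def
proof (intro conjI ballI allI)
  show "(\<lambda>_. 0) \<in> W" by (simp add: W_def)
  show "(\<lambda>\<tau>. m \<tau> + c * m' \<tau>) \<in> W" if "m \<in> W" "m' \<in> W" for m m' c
  proof -
    have "{\<tau>. m \<tau> + c * m' \<tau> \<noteq> 0} \<subseteq> {\<tau>. m \<tau> \<noteq> 0} \<union> {\<tau>. m' \<tau> \<noteq> 0}" by auto
    moreover have "finite ({\<tau>. m \<tau> \<noteq> 0} \<union> {\<tau>. m' \<tau> \<noteq> 0})" using that by (simp add: W_def)
    ultimately show ?thesis using that finite_subset unfolding W_def by blast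
  qed
  show "sh \<gamma> m \<in> W" if "m \<in> W" "\<gamma> \<in> \<Gamma>" for m \<gamma>
  proof -
    have "{\<tau>. sh \<gamma> m \<tau> \<noteq> 0} = (\<lambda>\<tau>. \<tau> + \<gamma>) ` {\<tau>. m \<tau> \<noteq> 0}"
      by (force simp: sh_def image_iff intro: exI[of _ "_ - \<gamma>"])
    then show ?thesis using that P_shift by (auto simp: W_def)
  qed
qed simp

lemma Dn_lin: "(D ^^ n) (\<lambda>\<tau>. m \<tau> + c * m' \<tau>) = (\<lambda>\<tau>. (D ^^ n) m \<tau> + c * (D ^^ n) m' \<tau>)"
  by (induction n) (auto simp: Y_def algebra_simps)

lemma Dn_Y: "(D ^^ n) (Y \<gamma> c m) = Y \<gamma> c ((D ^^ n) m)"
  by (induction n) (auto simp: Y_def algebra_simps fun_eq_iff)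

lemma Dn_sh: "(D ^^ n) (sh \<gamma> m) = sh \<gamma> ((D ^^ n) m)"
  by (induction n) (auto simp: Y_def sh_def algebra_simps fun_eq_iff)

lemma Dn_sub: assumes "submodule M" "m \<in> M" shows "(D ^^ n) m \<in> M"
  using assms by (induction n) (auto intro: submodule_Y p_in)

lemma saturated_Dn: assumes "submodule M" "saturated M" "m \<in> W" "(D ^^ n) m \<in> M" shows "m \<in> M"
  using assms(4)
proof (induction n)
  case (Suc n)
  then have "D ((D ^^ n) m) \<in> M" by simp
  moreover have "(D ^^ n) m \<in> W" using Dn_sub[OF submodule_W assms(3)] .
  ultimately show ?case using Suc.IH assms(2) unfolding saturated_def by blast
qed simp

lemma \<delta>_shift: "\<delta> (\<tau> + \<gamma>) = sh \<gamma> (\<delta> \<tau>)"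
  by (auto simp: \<delta>_def sh_def fun_eq_iff algebra_simps)

lemma \<delta>_W: "\<tau> \<in> P \<Longrightarrow> \<delta> \<tau> \<in> W"
proof -
  assume "\<tau> \<in> P"
  moreover have "{\<sigma>. \<delta> \<tau> \<sigma> \<noteq> 0} = {\<tau>}" by (auto simp: \<delta>_def)
  ultimately show ?thesis by (simp add: W_def)
qed

lemma W_expand: assumes "m \<in> W" shows "m = (\<lambda>\<sigma>. \<Sum>\<tau> | m \<tau> \<noteq> 0. m \<tau> * \<delta> \<tau> \<sigma>)"
proof
  fix \<sigma>
  have "(\<Sum>\<tau> | m \<tau> \<noteq> 0. m \<tau> * \<delta> \<tau> \<sigma>) = (\<Sum>\<tau> | m \<tau> \<noteq> 0. if \<sigma> = \<tau> then m \<sigma> else 0)"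
    by (intro sum.cong) (auto simp: \<delta>_def)
  also have "\<dots> = m \<sigma>" using assms by (simp add: W_def)
  finally show "m \<sigma> = (\<Sum>\<tau> | m \<tau> \<noteq> 0. m \<tau> * \<delta> \<tau> \<sigma>)" by simp
qed

text \<open>The point masses at the finite set \<open>R\<close> generate \<open>W\<close>, because
  \<open>R\<close> meets every orbit. Finite generation is what keeps unions of chains
  proper.\<close>

lemma submodule_eq_W_iff: assumes "submodule M" shows "M = W \<longleftrightarrow> (\<forall>\<rho>\<in>R. \<delta> \<rho> \<in> M)"
proof
  assume *: "\<forall>\<rho>\<in>R. \<delta> \<rho> \<in> M"
  have d: "\<delta> \<tau> \<in> M" if "\<tau> \<in> P" for \<tau>
    using P_R[OF that] * subD(4)[OF assms] by (auto simp: \<delta>_shift)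
  have "m \<in> M" if "m \<in> W" for m
  proof -
    have "(\<lambda>\<sigma>. \<Sum>\<tau> | m \<tau> \<noteq> 0. m \<tau> * \<delta> \<tau> \<sigma>) \<in> M"
      using that by (intro submodule_sum assms d) (auto simp: W_def)
    then show ?thesis using W_expand[OF that] by simp
  qed
  then show "M = W" using assms by (auto simp: submodule_def)
qed (use R_P \<delta>_W in auto)

section \<open>Polynomials in a single shift\<close>

text \<open>The polynomial \<open>q\<close> evaluated at the shift by \<open>\<gamma>\<close>; thus
  \<open>X - c\<close> acts as \<open>Y \<gamma> c\<close>.\<close>

definition act :: "'a \<Rightarrow> complex poly \<Rightarrow> ('a \<Rightarrow> complex) \<Rightarrow> 'a \<Rightarrow> complex" where
  "act \<gamma> q m = (\<lambda>\<tau>. \<Sum>i\<le>degree q. coeff q i * m (\<tau> - real i *\<^sub>R \<gamma>))"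

lemma act_ge: assumes "degree q \<le> n" shows "act \<gamma> q m \<tau> = (\<Sum>i\<le>n. coeff q i * m (\<tau> - real i *\<^sub>R \<gamma>))"
  unfolding act_def using assms by (intro sum.mono_neutral_left) (auto simp: coeff_eq_0)

lemma act_pCons: "act \<gamma> (pCons a q) m = (\<lambda>\<tau>. a * m \<tau> + act \<gamma> q m (\<tau> - \<gamma>))"
proof
  fix \<tau>
  have "act \<gamma> (pCons a q) m \<tau> = (\<Sum>i\<le>Suc (degree q). coeff (pCons a q) i * m (\<tau> - real i *\<^sub>R \<gamma>))"
    by (rule act_ge) (rule degree_pCons_le)
  also have "\<dots> = a * m \<tau> + (\<Sum>i\<le>degree q. coeff q i * m (\<tau> - (1 + real i) *\<^sub>R \<gamma>))"
    by (subst sum.atMost_Suc_shift) (simp add: algebra_simps)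
  also have "\<dots> = a * m \<tau> + act \<gamma> q m (\<tau> - \<gamma>)"
    by (simp add: act_def algebra_simps)
  finally show "act \<gamma> (pCons a q) m \<tau> = a * m \<tau> + act \<gamma> q m (\<tau> - \<gamma>)" .
qed

lemma act_0 [simp]: "act \<gamma> 0 m = (\<lambda>_. 0)" by (simp add: act_def)

lemma act_add: "act \<gamma> (q + r) m = (\<lambda>\<tau>. act \<gamma> q m \<tau> + act \<gamma> r m \<tau>)"
proof
  fix \<tau>
  let ?n = "max (degree q) (degree r)"
  show "act \<gamma> (q + r) m \<tau> = act \<gamma> q m \<tau> + act \<gamma> r m \<tau>"
    by (subst (1 2 3) act_ge[where n = ?n]) (auto simp: degree_add_le algebra_simps sum.distrib)
qed

lemma act_smult: "act \<gamma> (smult c q) m = (\<lambda>\<tau>. c * act \<gamma> q m \<tau>)"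
proof
  fix \<tau>
  show "act \<gamma> (smult c q) m \<tau> = c * act \<gamma> q m \<tau>"
    by (subst (1 2) act_ge[where n = "degree q"]) (auto simp: sum_distrib_left algebra_simps)
qed

lemma act_sum: "act \<gamma> (\<Sum>i\<in>I. smult (c i) (q i)) m = (\<lambda>\<tau>. \<Sum>i\<in>I. c i * act \<gamma> (q i) m \<tau>)"
  by (induction I rule: infinite_finite_induct) (auto simp: act_add act_smult)

lemma act_linear_sum: "act \<gamma> q (\<lambda>\<tau>. \<Sum>i\<in>I. c i * f i \<tau>) = (\<lambda>\<tau>. \<Sum>i\<in>I. c i * act \<gamma> q (f i) \<tau>)"
proof
  fix \<tau>
  have "act \<gamma> q (\<lambda>\<tau>. \<Sum>i\<in>I. c i * f i \<tau>) \<tau>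
      = (\<Sum>j\<le>degree q. \<Sum>i\<in>I. c i * (coeff q j * f i (\<tau> - real j *\<^sub>R \<gamma>)))"
    by (simp add: act_def sum_distrib_left algebra_simps)
  also have "\<dots> = (\<Sum>i\<in>I. c i * act \<gamma> q (f i) \<tau>)"
    by (subst sum.swap) (simp add: act_def sum_distrib_left)
  finally show "act \<gamma> q (\<lambda>\<tau>. \<Sum>i\<in>I. c i * f i \<tau>) \<tau> = (\<Sum>i\<in>I. c i * act \<gamma> q (f i) \<tau>)" .
qed

lemma act_linear_factor: "act \<gamma> ([:- c, 1:] * q) m = Y \<gamma> c (act \<gamma> q m)"
proof -
  have "[:- c, 1:] * q = smult (- c) q + pCons 0 q" by simp
  then show ?thesis by (simp only: act_add act_smult act_pCons) (simp add: Y_def algebra_simps)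
qed

lemma act_Y: "act \<gamma> q (Y \<gamma> c m) = Y \<gamma> c (act \<gamma> q m)"
  by (simp add: act_def Y_def fun_eq_iff algebra_simps sum_distrib_left sum_subtractf)

lemma act_sub: assumes "submodule M" "m \<in> M" "\<gamma> \<in> \<Gamma>" shows "act \<gamma> q m \<in> M"
proof (induction q)
  case 0
  then show ?case using subD(2)[OF assms(1)] by simp
next
  case (pCons a q)
  have "(\<lambda>\<tau>. a * m \<tau> + sh \<gamma> (act \<gamma> q m) \<tau>) \<in> M"
    using pCons assms by (intro submodule_add submodule_scale subD(4))
  then show ?case by (simp add: act_pCons sh_def)
qed

text \<open>Over the complex numbers \<open>q\<close> splits into linear factors. Each acts as some
  \<open>Y \<gamma> z\<close> and is cancelled by \<open>inj\<close>, until a nonzero constant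
  remains.\<close>

lemma act_cancel:
  assumes M: "submodule M" and \<gamma>: "\<gamma> \<in> \<Gamma>" and inj: "\<And>c m. m \<in> W \<Longrightarrow> Y \<gamma> c m \<in> M \<Longrightarrow> m \<in> M"
    and u: "u \<in> W" and "q \<noteq> 0" "act \<gamma> q u \<in> M"
  shows "u \<in> M"
  using assms(5,6)
proof (induction "degree q" arbitrary: q)
  case 0
  then obtain a where q: "q = [:a:]" "a \<noteq> 0" by (metis degree_eq_zeroE pCons_0_0)
  then have "(\<lambda>\<tau>. a * u \<tau>) \<in> M" using 0 by (simp add: act_pCons)
  from submodule_scale[OF M this, of "inverse a"] show ?case using q by (simp add: mult.assoc[symmetric])
next
  case (Suc n)
  then have "\<not> constant (poly q)" by (simp add: constant_degree)
  then obtain z where "poly q z = 0" using fundamental_theorem_of_algebra by blast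
  then obtain r where r: "q = [:- z, 1:] * r" by (metis dvdE poly_eq_0_iff_dvd)
  then have "r \<noteq> 0" using Suc by auto
  then have "degree q = Suc (degree r)" unfolding r by (subst degree_mult_eq) auto
  then have n: "n = degree r" using Suc by simp
  have "Y \<gamma> z (act \<gamma> r u) \<in> M" using Suc.prems r act_linear_factor by metis
  then have "act \<gamma> r u \<in> M" using inj act_sub[OF submodule_W u \<gamma>] by blast
  then show ?case using Suc.hyps(1)[OF n \<open>r \<noteq> 0\<close>] by blast
qed

section \<open>Maximal saturated submodules\<close>

text \<open>These correspond to the proper submodules, over \<open>N\<close>, of the module obtained
  by inverting \<open>D\<close>; a maximal one therefore has a simple quotient there.\<close>

definition proper_over :: "('a \<Rightarrow> complex) set \<Rightarrow> ('a \<Rightarrow> complex) set \<Rightarrow> bool" where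
  "proper_over N M \<longleftrightarrow> N \<subseteq> M \<and> submodule M \<and> saturated M \<and> M \<noteq> W"

text \<open>Zorn's lemma starts from the saturation \<open>N'\<close> of \<open>N\<close>. It is
  proper: otherwise a power of \<open>D\<close> would carry each of the finitely many generators
  into \<open>N\<close>, and the largest exponent would serve them all. Unions of chains stay proper
  by finite generation.\<close>

lemma exists_maximal_saturated:
  assumes N: "submodule N" and n: "\<And>n. \<exists>\<rho>\<in>R. (D ^^ n) (\<delta> \<rho>) \<notin> N"
  shows "\<exists>M. proper_over N M \<and> (\<forall>M'. proper_over N M' \<longrightarrow> M \<subseteq> M' \<longrightarrow> M' = M)"
proof -
  define N' where "N' = {m \<in> W. \<exists>n. (D ^^ n) m \<in> N}"
  have "submodule N'" unfolding submodule_def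
  proof (intro conjI ballI allI)
    show "(\<lambda>_. 0) \<in> N'" using subD(2)[OF submodule_W] subD(2)[OF N] by (auto simp: N'_def intro!: exI[of _ 0])
    fix m m' c assume "m \<in> N'" "m' \<in> N'"
    then obtain j j' where m: "m \<in> W" "(D ^^ j) m \<in> N" "m' \<in> W" "(D ^^ j') m' \<in> N" by (auto simp: N'_def)
    have "(D ^^ (j + j')) (\<lambda>\<tau>. m \<tau> + c * m' \<tau>) \<in> N"
      unfolding Dn_lin using m Dn_sub[OF N m(2), of j'] Dn_sub[OF N m(4), of j]
      by (intro subD(3)[OF N]) (auto simp: funpow_add[symmetric] add.commute simp flip: comp_apply[of "_ ^^ _"])
    then show "(\<lambda>\<tau>. m \<tau> + c * m' \<tau>) \<in> N'" using m by (auto simp: N'_def intro: subD(3)[OF submodule_W])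
  next
    fix m \<gamma> assume "m \<in> N'" "\<gamma> \<in> \<Gamma>"
    then show "sh \<gamma> m \<in> N'" using subD(4)[OF N] subD(4)[OF submodule_W] by (auto simp: N'_def Dn_sh)
  qed (auto simp: N'_def)
  moreover have "saturated N'" unfolding saturated_def
  proof (intro ballI impI)
    fix m assume "m \<in> W" "D m \<in> N'"
    then obtain j where "(D ^^ j) (D m) \<in> N" by (auto simp: N'_def)
    moreover have "(D ^^ j) (D m) = (D ^^ Suc j) m" by (simp add: funpow_swap1)
    ultimately have "(D ^^ Suc j) m \<in> N" by simp
    then show "m \<in> N'" using \<open>m \<in> W\<close> unfolding N'_def by blast
  qed
  moreover have "N' \<noteq> W"
  proof
    assume "N' = W"
    then have "\<forall>\<rho>\<in>R. \<exists>n. (D ^^ n) (\<delta> \<rho>) \<in> N" using R_P \<delta>_W unfolding N'_def by blast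
    then obtain f where f: "\<And>\<rho>. \<rho> \<in> R \<Longrightarrow> (D ^^ f \<rho>) (\<delta> \<rho>) \<in> N" by metis
    have "(D ^^ Max (f ` R)) (\<delta> \<rho>) \<in> N" if "\<rho> \<in> R" for \<rho>
    proof -
      have "f \<rho> \<le> Max (f ` R)" using that finite_R by simp
      then obtain k where "Max (f ` R) = k + f \<rho>" using le_Suc_ex add.commute by metis
      then show ?thesis using Dn_sub[OF N f[OF that], of k] by (simp add: funpow_add)
    qed
    then show False using n by blast
  qed
  moreover have "N \<subseteq> N'" using subD(1)[OF N] by (auto simp: N'_def intro: exI[of _ 0])
  ultimately have N': "proper_over N N'" by (simp add: proper_over_def)
  have "\<exists>M\<in>Collect (proper_over N). \<forall>X\<in>Collect (proper_over N). M \<subseteq> X \<longrightarrow> X = M"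
  proof (rule subset_Zorn_nonempty)
    show "Collect (proper_over N) \<noteq> {}" using N' by auto
    fix \<C> assume \<C>: "\<C> \<noteq> {}" "subset.chain (Collect (proper_over N)) \<C>"
    then have submodule: "\<And>C. C \<in> \<C> \<Longrightarrow> submodule C \<and> N \<subseteq> C \<and> saturated C \<and> C \<noteq> W"
    proof -
      fix C assume "C \<in> \<C>"
      then have "proper_over N C" using \<C>(2) unfolding subset.chain_def by blast
      then show "submodule C \<and> N \<subseteq> C \<and> saturated C \<and> C \<noteq> W" by (simp add: proper_over_def)
    qed
    have two: "\<exists>C\<in>\<C>. m \<in> C \<and> m' \<in> C" if "m \<in> \<Union>\<C>" "m' \<in> \<Union>\<C>" for m m'
      using that \<C>(2) unfolding subset.chain_def by blast
    have "submodule (\<Union>\<C>)" unfolding submodule_def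
    proof (intro conjI ballI allI)
      show "(\<lambda>_. 0) \<in> \<Union>\<C>" using \<C>(1) submodule subD(2) by blast
      show "(\<lambda>\<tau>. m \<tau> + c * m' \<tau>) \<in> \<Union>\<C>" if "m \<in> \<Union>\<C>" "m' \<in> \<Union>\<C>" for m m' c
        using two[OF that] submodule subD(3) by blast
      show "sh \<gamma> m \<in> \<Union>\<C>" if "m \<in> \<Union>\<C>" "\<gamma> \<in> \<Gamma>" for m \<gamma> using that submodule subD(4) by blast
      show "\<Union>\<C> \<subseteq> W" using submodule subD(1) by blast
    qed
    moreover have "saturated (\<Union>\<C>)" using submodule unfolding saturated_def by blast
    moreover have "N \<subseteq> \<Union>\<C>" using submodule \<C>(1) by blast
    moreover have "\<Union>\<C> \<noteq> W"
    proof
      assume "\<Union>\<C> = W"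
      then have "\<delta> ` R \<subseteq> \<Union>\<C>" using \<delta>_W R_P by auto
      then obtain C where "C \<in> \<C>" "\<delta> ` R \<subseteq> C"
        using finite_subset_Union_chain[of "\<delta> ` R" \<C> "Collect (proper_over N)"] \<C> finite_R by auto
      then show False using submodule[of C] submodule_eq_W_iff[of C] by auto
    qed
    ultimately show "\<Union>\<C> \<in> Collect (proper_over N)" by (simp add: proper_over_def)
  qed
  then show ?thesis by auto
qed

text \<open>The pigeonhole behind the use of an uncountable field: data coded in one natural number
  agree for infinitely many scalars.\<close>

lemma uncountable_fiber:
  fixes f :: "complex \<Rightarrow> nat"
  obtains n where "infinite {c. f c = n}"
proof -
  have "UNIV = (\<Union>n. {c. f c = n})" by auto
  moreover have "\<not> countable (UNIV :: complex set)"
    using uncountable_UNIV_complex by simp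
  ultimately have "\<exists>n. \<not> countable {c. f c = n}" by (metis countable_UN[of UNIV] uncountable_def countableI_type)
  then show thesis using that countable_finite by blast
qed

text \<open>
  If no \<open>Y \<gamma> c\<close> vanishes on \<open>W / M\<close>, then by maximality every \<open>Y \<gamma> c\<close> is injective there and has
  some \<open>D\<^sup>j m0\<close> in its image. As \<open>\<complex>\<close> is uncountable, preimages for finitely many \<open>c\<close> with the same \<open>j\<close>
  are linearly dependent; clearing denominators, a nonzero polynomial in \<open>\<gamma>\<close> annihilates \<open>D\<^sup>j m0\<close>.
\<close>

lemma maximal_eigenvalue:
  assumes M: "proper_over N M" and max: "\<And>M'. proper_over N M' \<Longrightarrow> M \<subseteq> M' \<Longrightarrow> M' = M"
    and \<gamma>: "\<gamma> \<in> \<Gamma>"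
  shows "\<exists>c. \<forall>m\<in>W. Y \<gamma> c m \<in> M"
proof (rule ccontr)
  assume "\<not> ?thesis"
  then have n: "\<And>c. \<exists>m\<in>W. Y \<gamma> c m \<notin> M" by blast
  have submodule: "submodule M" and sat: "saturated M" and MW: "M \<noteq> W" and NM: "N \<subseteq> M"
    using M by (auto simp: proper_over_def)
  have inj: "m \<in> M" if "m \<in> W" "Y \<gamma> c m \<in> M" for c m
  proof -
    \<comment> \<open>The kernel of \<open>Y \<gamma> c\<close> on \<open>W / M\<close>, pulled back
      to \<open>W\<close>. It is saturated and, by assumption, proper, so maximality makes it equal
      to \<open>M\<close>.\<close>
    define K where "K = {m \<in> W. Y \<gamma> c m \<in> M}"
    have lin: "Y \<gamma> c (\<lambda>\<tau>. m \<tau> + d * m' \<tau>) = (\<lambda>\<tau>. Y \<gamma> c m \<tau> + d * Y \<gamma> c m' \<tau>)" for m m' d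
      by (auto simp: Y_def algebra_simps)
    have comm: "Y \<gamma> c (sh \<beta> m) = sh \<beta> (Y \<gamma> c m)" for \<beta> m by (auto simp: Y_def sh_def algebra_simps)
    have commD: "Y \<gamma> c (D m) = D (Y \<gamma> c m)" for m by (auto simp: Y_def algebra_simps)
    have "submodule K" unfolding submodule_def
    proof (intro conjI ballI allI)
      show "(\<lambda>_. 0) \<in> K" using subD(2)[OF submodule_W] subD(2)[OF submodule] by (simp add: K_def Y_def)
      show "(\<lambda>\<tau>. m \<tau> + d * m' \<tau>) \<in> K" if "m \<in> K" "m' \<in> K" for m m' d
        using that subD(3)[OF submodule] subD(3)[OF submodule_W] by (simp add: K_def lin)
      show "sh \<beta> m \<in> K" if "m \<in> K" "\<beta> \<in> \<Gamma>" for m \<beta>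
        using that subD(4)[OF submodule] subD(4)[OF submodule_W] by (simp add: K_def comm)
    qed (auto simp: K_def)
    moreover have "saturated K"
      using sat submodule_Y[OF submodule_W _ \<gamma>] by (auto simp: saturated_def K_def commD)
    moreover have "M \<subseteq> K" using submodule_Y[OF submodule _ \<gamma>] subD(1)[OF submodule] by (auto simp: K_def)
    moreover have "K \<noteq> W" using n[of c] by (auto simp: K_def)
    ultimately have "K = M" using max NM by (auto simp: proper_over_def)
    then show ?thesis using that by (auto simp: K_def)
  qed
  obtain m0 where m0: "m0 \<in> W" "m0 \<notin> M" using MW subD(1)[OF submodule] by blast
  have "\<exists>j. \<exists>w\<in>W. (\<lambda>\<tau>. (D ^^ j) m0 \<tau> - Y \<gamma> c w \<tau>) \<in> M" for c
  proof -
    \<comment> \<open>The elements that some power of \<open>D\<close> carries into the image of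
      \<open>Y \<gamma> c\<close> modulo \<open>M\<close>. By injectivity
      \<open>Y \<gamma> c m0\<close> lies in \<open>K\<close> but not in \<open>M\<close>, so
      maximality makes \<open>K\<close> all of \<open>W\<close>.\<close>
    define K where "K = {m \<in> W. \<exists>j. \<exists>w\<in>W. (\<lambda>\<tau>. (D ^^ j) m \<tau> - Y \<gamma> c w \<tau>) \<in> M}"
    have KI: "m \<in> K" if "m \<in> W" "w \<in> W" "(\<lambda>\<tau>. (D ^^ j) m \<tau> - Y \<gamma> c w \<tau>) \<in> M" for m w j
      using that by (auto simp: K_def)
    have "submodule K" unfolding submodule_def
    proof (intro conjI ballI allI)
      show "(\<lambda>_. 0) \<in> K" using subD(2)[OF submodule_W] subD(2)[OF submodule]
        by (intro KI[where w="\<lambda>_. 0" and j=0]) (auto simp: Y_def)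
    next
      fix m m' d assume "m \<in> K" "m' \<in> K"
      then obtain j w j' w' where m: "m \<in> W" "w \<in> W" "(\<lambda>\<tau>. (D ^^ j) m \<tau> - Y \<gamma> c w \<tau>) \<in> M"
        "m' \<in> W" "w' \<in> W" "(\<lambda>\<tau>. (D ^^ j') m' \<tau> - Y \<gamma> c w' \<tau>) \<in> M" by (auto simp: K_def)
      have A: "(\<lambda>\<tau>. (D ^^ (j' + j)) m \<tau> - Y \<gamma> c ((D ^^ j') w) \<tau>) \<in> M"
        using Dn_sub[OF submodule m(3), of j'] Dn_lin[of j' "(D ^^ j) m" "-1" "Y \<gamma> c w"]
        by (simp add: Dn_Y funpow_add)
      have B: "(\<lambda>\<tau>. (D ^^ (j' + j)) m' \<tau> - Y \<gamma> c ((D ^^ j) w') \<tau>) \<in> M"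
        using Dn_sub[OF submodule m(6), of j] Dn_lin[of j "(D ^^ j') m'" "-1" "Y \<gamma> c w'"]
        by (simp add: Dn_Y funpow_add add.commute[of j'])
      show "(\<lambda>\<tau>. m \<tau> + d * m' \<tau>) \<in> K"
      proof (rule KI)
        show "(\<lambda>\<tau>. (D ^^ j') w \<tau> + d * (D ^^ j) w' \<tau>) \<in> W"
          using m by (intro subD(3)[OF submodule_W] Dn_sub submodule_W)
        show "(\<lambda>\<tau>. (D ^^ (j' + j)) (\<lambda>\<tau>. m \<tau> + d * m' \<tau>) \<tau>
            - Y \<gamma> c (\<lambda>\<tau>. (D ^^ j') w \<tau> + d * (D ^^ j) w' \<tau>) \<tau>) \<in> M"
          using subD(3)[OF submodule A B, of d] unfolding Dn_lin by (simp add: Y_def algebra_simps)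
      qed (use m subD(3)[OF submodule_W] in auto)
    next
      fix m \<beta> assume "m \<in> K" "\<beta> \<in> \<Gamma>"
      then obtain j w where m: "m \<in> W" "w \<in> W" "(\<lambda>\<tau>. (D ^^ j) m \<tau> - Y \<gamma> c w \<tau>) \<in> M" by (auto simp: K_def)
      have "(\<lambda>\<tau>. (D ^^ j) (sh \<beta> m) \<tau> - Y \<gamma> c (sh \<beta> w) \<tau>) \<in> M"
        using subD(4)[OF submodule m(3) \<open>\<beta> \<in> \<Gamma>\<close>] unfolding Dn_sh by (simp add: Y_def sh_def algebra_simps)
      then show "sh \<beta> m \<in> K" using KI m subD(4)[OF submodule_W] \<open>\<beta> \<in> \<Gamma>\<close> by blast
    qed (auto simp: K_def)
    moreover have "saturated K" unfolding saturated_def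
    proof (intro ballI impI)
      fix m assume "m \<in> W" "D m \<in> K"
      then obtain j w where "w \<in> W" "(\<lambda>\<tau>. (D ^^ j) (D m) \<tau> - Y \<gamma> c w \<tau>) \<in> M" by (auto simp: K_def)
      moreover have "(D ^^ j) (D m) = (D ^^ Suc j) m" by (simp add: funpow_swap1)
      ultimately show "m \<in> K" using KI[OF \<open>m \<in> W\<close>, of w "Suc j"] by simp
    qed
    moreover have "M \<subseteq> K"
    proof
      fix m assume "m \<in> M"
      then show "m \<in> K" using subD(1)[OF submodule] subD(2)[OF submodule_W]
        by (intro KI[where w="\<lambda>_. 0" and j=0]) (auto simp: Y_def)
    qed
    moreover have "K \<noteq> M"
    proof
      assume "K = M"
      have "(\<lambda>\<tau>. (D ^^ 0) (Y \<gamma> c m0) \<tau> - Y \<gamma> c m0 \<tau>) \<in> M" using subD(2)[OF submodule] by simp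
      then have "Y \<gamma> c m0 \<in> K" using KI m0 submodule_Y[OF submodule_W _ \<gamma>] by blast
      then show False using \<open>K = M\<close> inj m0 by blast
    qed
    ultimately have "K = W" using max NM by (auto simp: proper_over_def)
    then show ?thesis using m0 by (auto simp: K_def)
  qed
  then obtain j w where w: "\<And>c. w c \<in> W" "\<And>c. (\<lambda>\<tau>. (D ^^ j c) m0 \<tau> - Y \<gamma> c (w c) \<tau>) \<in> M" by metis
  \<comment> \<open>Finite support places \<open>w c\<close> among the first \<open>k c\<close>
    points of an enumeration of \<open>P\<close>, so that two natural numbers, \<open>j c\<close>
    and \<open>k c\<close>, describe all that has to agree.\<close>
  have "\<exists>k. {\<tau>. w c \<tau> \<noteq> 0} \<subseteq> from_nat_into P ` {..<k}" for c
  proof -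
    have fin: "finite {\<tau>. w c \<tau> \<noteq> 0}" "{\<tau>. w c \<tau> \<noteq> 0} \<subseteq> P" using w(1)[of c] by (auto simp: W_def)
    then have "{\<tau>. w c \<tau> \<noteq> 0} \<subseteq> range (from_nat_into P)"
      using countable_P subset_range_from_nat_into by (metis subset_trans)
    then obtain S where S: "finite S" "{\<tau>. w c \<tau> \<noteq> 0} = from_nat_into P ` S"
      using fin(1) finite_subset_image[of _ "from_nat_into P" UNIV] by metis
    obtain k where "S \<subseteq> {..<k}" using S(1) finite_nat_iff_bounded by blast
    then show ?thesis using S(2) by blast
  qed
  then obtain k where k: "\<And>c. {\<tau>. w c \<tau> \<noteq> 0} \<subseteq> from_nat_into P ` {..<k c}" by metis
  obtain n where n: "infinite {c. prod_encode (j c, k c) = n}"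
    using uncountable_fiber[of "\<lambda>c. prod_encode (j c, k c)"] by blast
  obtain j0 k0 where "prod_decode n = (j0, k0)" by fastforce
  then have "n = prod_encode (j0, k0)" by (metis prod_decode_inverse)
  then have n: "infinite {c. j c = j0 \<and> k c = k0}" using n by (simp add: prod_encode_eq)
  \<comment> \<open>One scalar more than the \<open>k0\<close> points on which the preimages may be
    nonzero, which forces a linear dependence.\<close>
  obtain C where C: "finite C" "card C = Suc k0" "C \<subseteq> {c. j c = j0 \<and> k c = k0}"
    using infinite_arbitrarily_large[OF n] by blast
  let ?S = "from_nat_into P ` {..<k0}"
  have "card ?S < card C" using card_image_le[of "{..<k0}" "from_nat_into P"] C by simp
  then obtain g where g: "\<exists>c\<in>C. g c \<noteq> 0" "\<And>\<tau>. \<tau> \<in> ?S \<Longrightarrow> (\<Sum>c\<in>C. g c * w c \<tau>) = 0"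
    using homogeneous_system_nontrivial[of ?S C w] C by blast
  have g0: "(\<lambda>\<tau>. \<Sum>c\<in>C. g c * w c \<tau>) = (\<lambda>_. 0)"
  proof
    fix \<tau>
    show "(\<Sum>c\<in>C. g c * w c \<tau>) = 0"
    proof (cases "\<tau> \<in> ?S")
      case False
      then have "w c \<tau> = 0" if "c \<in> C" for c using k[of c] C that by auto
      then show ?thesis by simp
    qed (use g in auto)
  qed
  define u where "u = (D ^^ j0) m0"
  have u: "u \<in> W" unfolding u_def by (rule Dn_sub[OF submodule_W m0(1)])
  have uw: "(\<lambda>\<tau>. u \<tau> - Y \<gamma> c (w c) \<tau>) \<in> M" if "c \<in> C" for c using w(2)[of c] C that by (auto simp: u_def)
  \<comment> \<open>The factor of \<open>c\<close> is omitted, so that \<open>q c\<close> composed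
    with \<open>Y \<gamma> c\<close> is the same product for every \<open>c\<close>; in this way the
    dependence of the preimages annihilates the sum.\<close>
  define q where "q c = (\<Prod>c'\<in>C - {c}. [:- c', 1:])" for c
  define Q where "Q = (\<Sum>c\<in>C. smult (g c) (q c))"
  have "act \<gamma> (q c) (Y \<gamma> c (w c)) = act \<gamma> (\<Prod>c'\<in>C. [:- c', 1:]) (w c)" if "c \<in> C" for c
    using C(1) that by (simp only: act_Y act_linear_factor[symmetric] q_def prod.remove)
  then have "(\<lambda>\<tau>. \<Sum>c\<in>C. g c * act \<gamma> (q c) (Y \<gamma> c (w c)) \<tau>)
      = act \<gamma> (\<Prod>c'\<in>C. [:- c', 1:]) (\<lambda>\<tau>. \<Sum>c\<in>C. g c * w c \<tau>)"
    unfolding act_linear_sum by (intro ext sum.cong) auto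
  also have "\<dots> = (\<lambda>_. 0)" unfolding g0 by (simp add: act_def)
  finally have z: "(\<Sum>c\<in>C. g c * act \<gamma> (q c) (Y \<gamma> c (w c)) \<tau>) = 0" for \<tau> by (simp add: fun_eq_iff)
  have "act \<gamma> Q u = (\<lambda>\<tau>. \<Sum>c\<in>C. g c * act \<gamma> (q c) (\<lambda>\<tau>. u \<tau> - Y \<gamma> c (w c) \<tau>) \<tau>)"
  proof
    fix \<tau>
    have "(\<Sum>c\<in>C. g c * act \<gamma> (q c) (\<lambda>\<tau>. u \<tau> - Y \<gamma> c (w c) \<tau>) \<tau>)
      = (\<Sum>c\<in>C. g c * act \<gamma> (q c) u \<tau>) - (\<Sum>c\<in>C. g c * act \<gamma> (q c) (Y \<gamma> c (w c)) \<tau>)"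
      by (simp add: act_def algebra_simps sum_subtractf sum_distrib_left)
    then show "act \<gamma> Q u \<tau> = (\<Sum>c\<in>C. g c * act \<gamma> (q c) (\<lambda>\<tau>. u \<tau> - Y \<gamma> c (w c) \<tau>) \<tau>)"
      using z by (simp add: Q_def act_sum)
  qed
  also have "\<dots> \<in> M" using uw by (intro submodule_sum submodule act_sub \<gamma>)
  finally have QM: "act \<gamma> Q u \<in> M" .
  have "Q \<noteq> 0"
  proof
    assume "Q = 0"
    obtain c0 where c0: "c0 \<in> C" "g c0 \<noteq> 0" using g(1) by blast
    \<comment> \<open>At \<open>c0\<close> every summand of \<open>Q\<close> other than that of
      \<open>c0\<close> has a vanishing factor.\<close>
    have "0 = poly Q c0" using \<open>Q = 0\<close> by simp
    also have "\<dots> = (\<Sum>c\<in>C. g c * (\<Prod>c'\<in>C - {c}. c0 - c'))"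
      by (simp add: Q_def q_def poly_sum poly_prod)
    also have "\<dots> = (\<Sum>c\<in>{c0}. g c * (\<Prod>c'\<in>C - {c}. c0 - c'))"
      using C(1) c0 by (intro sum.mono_neutral_right) (auto intro!: prod_zero)
    also have "\<dots> \<noteq> 0" using c0 C(1) by (simp add: prod_zero_iff)
    finally show False by simp
  qed
  have "u \<in> M" by (rule act_cancel[OF submodule \<gamma> _ u \<open>Q \<noteq> 0\<close> QM]) (rule inj)
  then have "m0 \<in> M" using saturated_Dn[OF submodule sat m0(1)] by (simp add: u_def)
  then show False using m0 by simp
qed

text \<open>Modulo a maximal saturated \<open>M\<close> every shift is a scalar
  \<open>\<eta> \<gamma>\<close>, so \<open>M\<close> and one further vector \<open>m0\<close>
  already span a saturated submodule. Hence \<open>W / M\<close> is a line, and \<open>a\<close>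
  records the coordinates of the point masses on it. If \<open>\<eta> p\<close> were 1, then
  \<open>D m0\<close> would lie in \<open>M\<close>, against saturation.\<close>

theorem shift_module_alternative:
  assumes N: "submodule N"
  obtains n where "\<And>\<rho>. \<rho> \<in> R \<Longrightarrow> (D ^^ n) (\<delta> \<rho>) \<in> N"
  | a \<eta> \<tau>\<^sub>0 where "\<tau>\<^sub>0 \<in> P" "a \<tau>\<^sub>0 \<noteq> 0" "\<And>\<tau> \<gamma>. \<tau> \<in> P \<Longrightarrow> \<gamma> \<in> \<Gamma> \<Longrightarrow> a (\<tau> + \<gamma>) = \<eta> \<gamma> * a \<tau>" "\<eta> p \<noteq> 1"
      "\<And>m. m \<in> N \<Longrightarrow> (\<Sum>\<tau> | m \<tau> \<noteq> 0. m \<tau> * a \<tau>) = 0"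
proof (cases "\<exists>n. \<forall>\<rho>\<in>R. (D ^^ n) (\<delta> \<rho>) \<in> N")
  case False
  then obtain M where M: "proper_over N M" and max: "\<And>M'. proper_over N M' \<Longrightarrow> M \<subseteq> M' \<Longrightarrow> M' = M"
    using exists_maximal_saturated[OF N] by blast
  have submodule: "submodule M" and sat: "saturated M" and MW: "M \<noteq> W" and NM: "N \<subseteq> M"
    using M by (auto simp: proper_over_def)
  obtain \<eta> where \<eta>: "\<And>\<gamma> m. \<gamma> \<in> \<Gamma> \<Longrightarrow> m \<in> W \<Longrightarrow> Y \<gamma> (\<eta> \<gamma>) m \<in> M"
    using maximal_eigenvalue[OF M max] by metis
  obtain m0 where m0: "m0 \<in> W" "m0 \<notin> M" using MW subD(1)[OF submodule] by blast
  have "\<eta> p \<noteq> 1" using \<eta>[OF p_in, of m0] m0 sat by (auto simp: saturated_def)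
  \<comment> \<open>The span of \<open>M\<close> and \<open>m0\<close>. It is saturated because
    \<open>D\<close> acts modulo \<open>M\<close> as the nonzero scalar
    \<open>\<eta> p - 1\<close>.\<close>
  define K where "K = {m \<in> W. \<exists>c. (\<lambda>\<tau>. m \<tau> - c * m0 \<tau>) \<in> M}"
  have "submodule K" unfolding submodule_def
  proof (intro conjI ballI allI)
    show "(\<lambda>_. 0) \<in> K" using subD(2)[OF submodule_W] subD(2)[OF submodule] by (auto simp: K_def intro!: exI[of _ 0])
  next
    fix m m' d assume "m \<in> K" "m' \<in> K"
    then obtain c c' where m: "m \<in> W" "m' \<in> W" "(\<lambda>\<tau>. m \<tau> - c * m0 \<tau>) \<in> M" "(\<lambda>\<tau>. m' \<tau> - c' * m0 \<tau>) \<in> M"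
      by (auto simp: K_def)
    have "(\<lambda>\<tau>. m \<tau> + d * m' \<tau> - (c + d * c') * m0 \<tau>) \<in> M"
      using subD(3)[OF submodule m(3,4), of d] by (simp add: algebra_simps)
    then show "(\<lambda>\<tau>. m \<tau> + d * m' \<tau>) \<in> K" using subD(3)[OF submodule_W m(1,2)] unfolding K_def by blast
  next
    fix m \<gamma> assume "m \<in> K" "\<gamma> \<in> \<Gamma>"
    then obtain c where m: "m \<in> W" "(\<lambda>\<tau>. m \<tau> - c * m0 \<tau>) \<in> M" by (auto simp: K_def)
    have "(\<lambda>\<tau>. sh \<gamma> m \<tau> - (\<eta> \<gamma> * c) * m0 \<tau>) \<in> M"
      using submodule_add[OF submodule \<eta>[OF \<open>\<gamma> \<in> \<Gamma>\<close> m(1)] submodule_scale[OF submodule m(2), of "\<eta> \<gamma>"]]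
      by (simp add: Y_def sh_def algebra_simps)
    then show "sh \<gamma> m \<in> K" using subD(4)[OF submodule_W m(1) \<open>\<gamma> \<in> \<Gamma>\<close>] unfolding K_def by blast
  qed (auto simp: K_def)
  moreover have "saturated K" unfolding saturated_def
  proof (intro ballI impI)
    fix m assume m: "m \<in> W" "D m \<in> K"
    then obtain c where c: "(\<lambda>\<tau>. D m \<tau> - c * m0 \<tau>) \<in> M" by (auto simp: K_def)
    have "(\<lambda>\<tau>. (\<eta> p - 1) * m \<tau> - c * m0 \<tau>) \<in> M"
      using submodule_diff[OF submodule c \<eta>[OF p_in m(1)]] by (simp add: Y_def algebra_simps)
    note * = submodule_scale[OF submodule this, of "inverse (\<eta> p - 1)"]
    have "(\<lambda>\<tau>. m \<tau> - (inverse (\<eta> p - 1) * c) * m0 \<tau>) \<in> M"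
    proof -
      have "inverse (\<eta> p - 1) * ((\<eta> p - 1) * m \<tau> - c * m0 \<tau>) = m \<tau> - (inverse (\<eta> p - 1) * c) * m0 \<tau>" for \<tau>
        using \<open>\<eta> p \<noteq> 1\<close> by (simp add: field_simps)
      then show ?thesis using * by simp
    qed
    then show "m \<in> K" using m unfolding K_def by blast
  qed
  moreover have "M \<subseteq> K" using subD(1)[OF submodule] by (auto simp: K_def intro!: exI[of _ 0])
  moreover have "m0 \<in> K" using m0 subD(2)[OF submodule] by (auto simp: K_def intro!: exI[of _ 1])
  ultimately have "K = W" using max NM m0 unfolding proper_over_def by blast
  then have "\<exists>c. (\<lambda>\<tau>. m \<tau> - c * m0 \<tau>) \<in> M" if "m \<in> W" for m using that by (auto simp: K_def)
  then obtain l where l: "\<And>m. m \<in> W \<Longrightarrow> (\<lambda>\<tau>. m \<tau> - l m * m0 \<tau>) \<in> M" by metis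
  have zero: "c = 0" if "(\<lambda>\<tau>. c * m0 \<tau>) \<in> M" for c
  proof (rule ccontr)
    assume "c \<noteq> 0"
    then have "m0 \<in> M" using submodule_scale[OF submodule that, of "inverse c"] by (simp add: mult.assoc[symmetric])
    then show False using m0 by simp
  qed
  define a where "a \<tau> = l (\<delta> \<tau>)" for \<tau>
  have a: "(\<lambda>\<sigma>. \<delta> \<tau> \<sigma> - a \<tau> * m0 \<sigma>) \<in> M" if "\<tau> \<in> P" for \<tau> using l \<delta>_W that by (auto simp: a_def)
  obtain \<tau>\<^sub>0 where \<tau>\<^sub>0: "\<tau>\<^sub>0 \<in> P" "a \<tau>\<^sub>0 \<noteq> 0"
  proof (rule ccontr)
    assume "\<not> thesis"
    then have "\<And>\<tau>. \<tau> \<in> P \<Longrightarrow> a \<tau> = 0" using that by blast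
    then have "\<forall>\<rho>\<in>R. \<delta> \<rho> \<in> M" using a R_P by fastforce
    then show False using submodule_eq_W_iff[OF submodule] MW by blast
  qed
  moreover have "a (\<tau> + \<gamma>) = \<eta> \<gamma> * a \<tau>" if "\<tau> \<in> P" "\<gamma> \<in> \<Gamma>" for \<tau> \<gamma>
  proof -
    have 1: "(\<lambda>\<sigma>. sh \<gamma> (\<delta> \<tau>) \<sigma> - a (\<tau> + \<gamma>) * m0 \<sigma>) \<in> M" using a[OF P_shift[OF that]] by (simp add: \<delta>_shift)
    have 2: "(\<lambda>\<sigma>. sh \<gamma> (\<delta> \<tau>) \<sigma> - \<eta> \<gamma> * \<delta> \<tau> \<sigma>) \<in> M"
      using \<eta>[OF that(2) \<delta>_W[OF that(1)]] by (simp add: Y_def sh_def)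
    have "(\<lambda>\<sigma>. (\<eta> \<gamma> * a \<tau> - a (\<tau> + \<gamma>)) * m0 \<sigma>) \<in> M"
      using submodule_diff[OF submodule submodule_diff[OF submodule 1 2] submodule_scale[OF submodule a[OF that(1)], of "\<eta> \<gamma>"]]
      by (simp add: algebra_simps)
    then show ?thesis using zero by force
  qed
  moreover have "(\<Sum>\<tau> | m \<tau> \<noteq> 0. m \<tau> * a \<tau>) = 0" if "m \<in> N" for m
  proof -
    have m: "m \<in> M" "m \<in> W" using that NM subD(1)[OF submodule] by auto
    then have "(\<lambda>\<sigma>. \<Sum>\<tau> | m \<tau> \<noteq> 0. m \<tau> * (\<delta> \<tau> \<sigma> - a \<tau> * m0 \<sigma>)) \<in> M"
      by (intro submodule_sum[OF submodule] a) (auto simp: W_def)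
    then have "(\<lambda>\<sigma>. m \<sigma> - (\<Sum>\<tau> | m \<tau> \<noteq> 0. m \<tau> * a \<tau>) * m0 \<sigma>) \<in> M"
      by (simp only: right_diff_distrib sum_subtractf W_expand[OF m(2), THEN fun_cong, symmetric])
        (simp only: sum_distrib_right mult.assoc)
    from submodule_diff[OF submodule m(1) this] show ?thesis by (intro zero) simp
  qed
  ultimately show thesis using \<open>\<eta> p \<noteq> 1\<close> that(2) by blast
qed (use that(1) in blast)

end

section \<open>Convolution operators on a torus\<close>

lemma AE_lborel_affine_shift:
  fixes P :: "'a::euclidean_space \<Rightarrow> bool"
  assumes P: "AE x in lborel. P x" and c: "c \<noteq> 0"
  shows "AE x in lborel. P (t + c *\<^sub>R x)"
proof -
  have "AE x in density (distr lborel borel (\<lambda>x. t + c *\<^sub>R x)) (\<lambda>_. ennreal (\<bar>c\<bar> ^ DIM('a))). P x"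
    using P unfolding lborel_affine[OF c, of t, symmetric] .
  then have "AE x in distr lborel borel (\<lambda>x. t + c *\<^sub>R x). P x"
    using c by (subst (asm) AE_density) auto
  then show ?thesis by (rule AE_distrD[rotated]) simp
qed

text \<open>The integral does not see null sets, so equality almost everywhere improves to equality
  at every point.\<close>

lemma cconv_AE_cong:
  assumes "AE x in lborel. u x = v x" "bounded_meas u" "bounded_meas v" "bounded_supp \<kappa>"
  shows "cconv \<kappa> u x = cconv \<kappa> v x"
  unfolding cconv_def
proof (rule integral_cong_AE)
  show "AE y in lborel. \<kappa> y * u (x - y) = \<kappa> y * v (x - y)"
  proof -
    have "AE y in lborel. u (x - y) = v (x - y)"
      using AE_lborel_affine_shift[OF assms(1), of "-1" x] by simp
    then show ?thesis by eventually_elim simp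
  qed
  note [measurable] = bounded_meas_measurable[OF assms(2)] bounded_meas_measurable[OF assms(3)] bounded_supp_measurable[OF assms(4)]
  show "(\<lambda>y. \<kappa> y * u (x - y)) \<in> borel_measurable lborel" "(\<lambda>y. \<kappa> y * v (x - y)) \<in> borel_measurable lborel"
    by simp_all
qed

lemma finite_separated:
  fixes S :: "'a::euclidean_space set"
  assumes "bounded S" "0 < e" "\<And>x y. x \<in> S \<Longrightarrow> y \<in> S \<Longrightarrow> x \<noteq> y \<Longrightarrow> e \<le> dist x y"
  shows "finite S"
proof (rule ccontr)
  assume "infinite S"
  then obtain x where "x islimpt S" using bounded_infinite_imp_islimpt[OF subset_refl assms(1)] by blast
  moreover have "closed S"
    using discrete_imp_closed[OF assms(2), of S] assms(3) by (meson not_le)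
  ultimately have x: "x \<in> S" by (simp add: closed_limpt)
  obtain y where "y \<in> S" "y \<noteq> x" "dist y x < e"
    using \<open>x islimpt S\<close> \<open>0 < e\<close> unfolding islimpt_approachable by blast
  then show False using assms(3)[of y x] x by auto
qed

lemma measurable_cnj [measurable]: "cnj \<in> borel_measurable borel"
  by (intro borel_measurable_continuous_onI continuous_intros)

text \<open>\<open>B\<close> carries the integer vectors to the lattice \<open>\<Gamma>\<close> and
  \<open>C\<close> reads off coordinates. The torus is not formed as a quotient: periodic functions
  live on the whole space and are integrated over the half-open cell \<open>Dom\<close>.\<close>

locale lattice_torus =
  fixes B C :: "'a::euclidean_space \<Rightarrow> 'a"
  assumes linear_B: "linear B" and linear_C: "linear C" and BC: "\<And>x. B (C x) = x" and CB: "\<And>x. C (B x) = x"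
begin

definition \<Gamma> :: "'a set" where "\<Gamma> = {x. \<forall>i\<in>Basis. C x \<bullet> i \<in> \<int>}"
definition Dom :: "'a set" where "Dom = {x. \<forall>i\<in>Basis. 0 \<le> C x \<bullet> i \<and> C x \<bullet> i < 1}"
definition lattice_floor :: "'a \<Rightarrow> 'a" where "lattice_floor x = B (\<Sum>i\<in>Basis. real_of_int \<lfloor>C x \<bullet> i\<rfloor> *\<^sub>R i)"

lemma \<Gamma>_add: "x \<in> \<Gamma> \<Longrightarrow> y \<in> \<Gamma> \<Longrightarrow> x + y \<in> \<Gamma>"
  and \<Gamma>_minus: "x \<in> \<Gamma> \<Longrightarrow> - x \<in> \<Gamma>" and \<Gamma>_diff: "x \<in> \<Gamma> \<Longrightarrow> y \<in> \<Gamma> \<Longrightarrow> x - y \<in> \<Gamma>" and \<Gamma>_0: "0 \<in> \<Gamma>"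
  by (auto simp: \<Gamma>_def linear_add[OF linear_C] linear_diff[OF linear_C] linear_neg[OF linear_C]
      linear_0[OF linear_C] inner_simps)

lemma lattice_floor_\<Gamma>: "lattice_floor x \<in> \<Gamma>"
  by (simp add: \<Gamma>_def lattice_floor_def CB)

lemma diff_lattice_floor_Dom: "x - lattice_floor x \<in> Dom"
proof -
  have "C (x - lattice_floor x) \<bullet> i = C x \<bullet> i - real_of_int \<lfloor>C x \<bullet> i\<rfloor>" if "i \<in> Basis" for i
    using that by (simp add: lattice_floor_def linear_diff[OF linear_C] CB inner_diff_left)
  then show ?thesis by (auto simp: Dom_def) linarith
qed

lemma Dom_unique: assumes "x - \<gamma> \<in> Dom" "\<gamma> \<in> \<Gamma>" shows "\<gamma> = lattice_floor x"
proof -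
  have *: "C \<gamma> \<bullet> i = real_of_int \<lfloor>C x \<bullet> i\<rfloor>" if i: "i \<in> Basis" for i
  proof -
    obtain k where k: "C \<gamma> \<bullet> i = real_of_int k" using assms(2) i by (auto simp: \<Gamma>_def elim: Ints_cases)
    have "0 \<le> C x \<bullet> i - k" "C x \<bullet> i - k < 1"
      using assms(1) i k by (auto simp: Dom_def linear_diff[OF linear_C] inner_diff_left)
    then have "\<lfloor>C x \<bullet> i\<rfloor> = k" by (intro floor_unique) linarith+
    then show ?thesis using k by simp
  qed
  have "C \<gamma> = C (lattice_floor x)"
  proof (rule euclidean_eqI)
    fix b :: 'a assume b: "b \<in> Basis"
    have "C (lattice_floor x) \<bullet> b = real_of_int \<lfloor>C x \<bullet> b\<rfloor>" using b by (simp add: lattice_floor_def CB)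
    then show "C \<gamma> \<bullet> b = C (lattice_floor x) \<bullet> b" using *[OF b] by simp
  qed
  then show ?thesis by (metis BC)
qed

lemma bounded_Dom: "bounded Dom"
proof -
  have "Dom \<subseteq> B ` cbox 0 One"
  proof
    fix x assume "x \<in> Dom"
    then have "C x \<in> cbox 0 One" by (auto simp: Dom_def mem_box less_imp_le)
    then show "x \<in> B ` cbox 0 One" using BC[of x] by (metis image_eqI)
  qed
  moreover have "bounded (B ` cbox 0 One)"
    using linear_B by (intro bounded_linear_image bounded_cbox) (simp add: linear_conv_bounded_linear)
  ultimately show ?thesis by (rule bounded_subset[rotated])
qed

lemma Dom_measurable [measurable]: "Dom \<in> sets borel"
proof -
  have [measurable]: "C \<in> borel_measurable borel"
    using linear_C by (intro borel_measurable_continuous_onI linear_continuous_on) (simp add: linear_conv_bounded_linear)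
  show ?thesis unfolding Dom_def by measurable
qed

lemma locally_finite_\<Gamma>: "locally_finite_set \<Gamma>"
  unfolding locally_finite_set_def
proof (intro allI)
  fix x :: 'a and r :: real
  have "finite (C ` (\<Gamma> \<inter> cball x r))"
  proof (rule finite_separated[of _ 1])
    show "bounded (C ` (\<Gamma> \<inter> cball x r))"
      using linear_C by (intro bounded_linear_image) (auto simp: linear_conv_bounded_linear intro: bounded_subset[OF bounded_cball])
    fix y z assume "y \<in> C ` (\<Gamma> \<inter> cball x r)" "z \<in> C ` (\<Gamma> \<inter> cball x r)" "y \<noteq> z"
    then have yz: "\<And>i. i \<in> Basis \<Longrightarrow> (y - z) \<bullet> i \<in> \<int>" by (auto simp: \<Gamma>_def inner_diff_left)
    obtain i where i: "i \<in> Basis" "(y - z) \<bullet> i \<noteq> 0" using \<open>y \<noteq> z\<close> euclidean_eq_iff[of "y - z" 0] by auto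
    then have "1 \<le> \<bar>(y - z) \<bullet> i\<bar>" using yz Ints_nonzero_abs_ge1 by blast
    also have "\<dots> \<le> norm (y - z)" using i(1) by (rule Basis_le_norm)
    finally show "1 \<le> dist y z" by (simp add: dist_norm)
  qed simp
  moreover have "inj_on C (\<Gamma> \<inter> cball x r)" by (metis BC inj_onI)
  ultimately show "finite (\<Gamma> \<inter> cball x r)" by (rule finite_imageD)
qed

lemma countable_\<Gamma>: "countable \<Gamma>"
proof -
  have "\<Gamma> = (\<Union>n. \<Gamma> \<inter> cball 0 (real n))" using real_arch_simple by auto
  then show ?thesis using locally_finite_\<Gamma> unfolding locally_finite_set_def
    by (metis countable_UN countable_finite countableI_type)
qed

definition periodic :: "('a \<Rightarrow> complex) \<Rightarrow> bool" where
  "periodic u \<longleftrightarrow> bounded_meas u \<and> (\<forall>x. \<forall>\<gamma>\<in>\<Gamma>. u (x + \<gamma>) = u x)"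

definition torus_integral :: "('a \<Rightarrow> complex) \<Rightarrow> complex" where
  "torus_integral u = (LINT x|lborel. indicator Dom x * u x)"

lemma bounded_supp_indicator_Dom: "bounded_supp (indicator Dom)"
proof -
  obtain R where "\<And>x. x \<in> Dom \<Longrightarrow> norm x \<le> R" using bounded_Dom by (auto simp: bounded_iff)
  then show ?thesis
    by (intro bounded_suppI[of _ R] bounded_measI[where B=1]) (auto simp: indicator_def)
qed

text \<open>The shifted cell is cut along the translates of \<open>Dom\<close>, each piece is moved
  back by a period, and the pieces reassemble to \<open>Dom\<close>.\<close>

lemma torus_integral_translate: assumes "periodic u" shows "torus_integral (\<lambda>x. u (x + y)) = torus_integral u"
proof -
  have bounded_meas: "bounded_meas u" and pu: "\<And>x \<gamma>. \<gamma> \<in> \<Gamma> \<Longrightarrow> u (x + \<gamma>) = u x" using assms by (auto simp: periodic_def)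
  have [measurable]: "u \<in> borel_measurable borel" using bounded_meas bounded_meas_measurable by auto
  let ?I = "indicator Dom :: 'a \<Rightarrow> complex"
  obtain r where r: "\<And>x. x \<in> Dom \<Longrightarrow> norm x \<le> r" using bounded_Dom by (auto simp: bounded_iff)
  \<comment> \<open>Radius \<open>2 * r\<close> catches every period \<open>\<gamma>\<close> for
    which \<open>Dom + \<gamma>\<close> can meet \<open>Dom + y\<close>, so all sums are
    finite.\<close>
  define S where "S = \<Gamma> \<inter> cball y (2 * r)"
  have fin: "finite S" using locally_finite_\<Gamma> by (auto simp: S_def locally_finite_set_def)
  have S: "\<gamma> \<in> S" if "\<gamma> \<in> \<Gamma>" "x - y \<in> Dom" "x - \<gamma> \<in> Dom" for x \<gamma>
  proof -
    have "norm (y - \<gamma>) \<le> norm (x - \<gamma>) + norm (x - y)"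
      using norm_triangle_ineq4[of "x - \<gamma>" "x - y"] by simp
    then show ?thesis using r[OF that(2)] r[OF that(3)] that(1) by (simp add: S_def dist_norm)
  qed
  have one: "(\<Sum>\<gamma>\<in>S. ?I (x - \<gamma>)) = 1" if "x - y \<in> Dom" for x
  proof -
    have "lattice_floor x \<in> S" using S[OF lattice_floor_\<Gamma> that diff_lattice_floor_Dom] .
    have "(\<Sum>\<gamma>\<in>S. ?I (x - \<gamma>)) = (\<Sum>\<gamma>\<in>S. if \<gamma> = lattice_floor x then 1 else 0)"
      using Dom_unique diff_lattice_floor_Dom by (intro sum.cong) (auto simp: S_def indicator_def)
    then show ?thesis using fin \<open>lattice_floor x \<in> S\<close> by simp
  qed
  have one': "(\<Sum>\<gamma>\<in>S. ?I (x + \<gamma> - y)) = 1" if "x \<in> Dom" for x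
  proof -
    let ?g = "- lattice_floor (x - y)"
    have g: "?g \<in> \<Gamma>" "x + ?g - y \<in> Dom" using lattice_floor_\<Gamma> \<Gamma>_minus diff_lattice_floor_Dom[of "x - y"] by (auto simp: algebra_simps)
    then have "?g \<in> S" using S[of ?g "x + ?g"] that by simp
    have "?I (x + \<gamma> - y) = (if \<gamma> = ?g then 1 else 0)" if "\<gamma> \<in> S" for \<gamma>
    proof -
      have *: "\<gamma> = ?g" if "x + \<gamma> - y \<in> Dom"
      proof -
        have "x - y - (- \<gamma>) \<in> Dom" "- \<gamma> \<in> \<Gamma>"
          using that \<open>\<gamma> \<in> S\<close> \<Gamma>_minus by (auto simp: S_def algebra_simps)
        from Dom_unique[OF this] show ?thesis by (metis minus_minus)
      qed
      show ?thesis
      proof (cases "\<gamma> = ?g")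
        case True
        show ?thesis unfolding True using g(2) by simp
      next
        case False
        then have "x + \<gamma> - y \<notin> Dom" using * by blast
        then show ?thesis using False by simp
      qed
    qed
    then have "(\<Sum>\<gamma>\<in>S. ?I (x + \<gamma> - y)) = (\<Sum>\<gamma>\<in>S. if \<gamma> = ?g then 1 else 0)" by (intro sum.cong) auto
    then show ?thesis using fin \<open>?g \<in> S\<close> by simp
  qed
  have int: "integrable lborel (\<lambda>x. ?I (x - a) * (?I (x - b) * u x))" for a b
    by (rule bounded_supp_integrable[OF bounded_supp_mult[OF bounded_supp_shift(1)[OF bounded_supp_indicator_Dom]
          bounded_meas_mult[OF bounded_meas_shift(1)[OF bounded_supp_imp_bounded_meas[OF bounded_supp_indicator_Dom]] bounded_meas]]])
  have "torus_integral (\<lambda>x. u (x + y)) = (LINT x|lborel. ?I (x - y) * u x)"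
    unfolding torus_integral_def using integral_shift(2)[of "\<lambda>x. ?I x * u (x + y)" y] by simp
  also have "\<dots> = (LINT x|lborel. (\<Sum>\<gamma>\<in>S. ?I (x - y) * (?I (x - \<gamma>) * u x)))"
  proof (rule Bochner_Integration.integral_cong[OF refl])
    fix x
    show "?I (x - y) * u x = (\<Sum>\<gamma>\<in>S. ?I (x - y) * (?I (x - \<gamma>) * u x))"
      using one[of x] by (cases "x - y \<in> Dom") (auto simp flip: sum_distrib_right)
  qed
  also have "\<dots> = (\<Sum>\<gamma>\<in>S. LINT x|lborel. ?I (x - y) * (?I (x - \<gamma>) * u x))"
    by (intro Bochner_Integration.integral_sum int)
  also have "\<dots> = (\<Sum>\<gamma>\<in>S. LINT x|lborel. ?I (x - (y - \<gamma>)) * (?I (x - 0) * u x))"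
  proof (intro sum.cong refl)
    fix \<gamma> assume "\<gamma> \<in> S"
    then have "u (x + \<gamma>) = u x" for x using pu by (auto simp: S_def)
    then show "(LINT x|lborel. ?I (x - y) * (?I (x - \<gamma>) * u x)) = (LINT x|lborel. ?I (x - (y - \<gamma>)) * (?I (x - 0) * u x))"
      using integral_shift(1)[of "\<lambda>x. ?I (x - y) * (?I (x - \<gamma>) * u x)" \<gamma>] by (simp add: algebra_simps)
  qed
  also have "\<dots> = (LINT x|lborel. (\<Sum>\<gamma>\<in>S. ?I (x - (y - \<gamma>)) * (?I (x - 0) * u x)))"
    by (intro Bochner_Integration.integral_sum[symmetric] int)
  also have "\<dots> = torus_integral u" unfolding torus_integral_def
  proof (rule Bochner_Integration.integral_cong[OF refl])
    fix x
    show "(\<Sum>\<gamma>\<in>S. ?I (x - (y - \<gamma>)) * (?I (x - 0) * u x)) = ?I x * u x"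
    proof (cases "x \<in> Dom")
      case True
      have "(\<Sum>\<gamma>\<in>S. ?I (x - (y - \<gamma>)) * (?I (x - 0) * u x)) = (\<Sum>\<gamma>\<in>S. ?I (x + \<gamma> - y)) * u x"
        using True by (simp add: sum_distrib_right diff_diff_eq2)
      then show ?thesis using one'[OF True] True by simp
    qed simp
  qed
  finally show ?thesis .
qed

lemma periodic_bounded_meas: "periodic u \<Longrightarrow> bounded_meas u" by (simp add: periodic_def)

lemma periodic_cconv: assumes "periodic u" "bounded_supp \<kappa>" shows "periodic (cconv \<kappa> u)"
proof -
  have "u (x + \<gamma> - y) = u (x - y)" if "\<gamma> \<in> \<Gamma>" for x y \<gamma>
  proof -
    have "u (x - y + \<gamma>) = u (x - y)" using assms(1) that by (simp add: periodic_def)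
    then show ?thesis by (simp only: diff_add_eq)
  qed
  then show ?thesis using assms unfolding periodic_def by (simp add: bounded_meas_cconv cconv_def)
qed

lemma bounded_meas_cnj: "bounded_meas u \<Longrightarrow> bounded_meas (\<lambda>x. cnj (u x))"
  by (auto simp: bounded_meas_def bounded_iff)

text \<open>The kernel of the adjoint operator for the torus pairing.\<close>

definition adj :: "('a \<Rightarrow> complex) \<Rightarrow> 'a \<Rightarrow> complex" where "adj \<kappa> = (\<lambda>y. cnj (\<kappa> (- y)))"

lemma bounded_supp_adj: assumes "bounded_supp \<kappa>" shows "bounded_supp (adj \<kappa>)"
proof -
  obtain R where R: "\<And>x. \<kappa> x \<noteq> 0 \<Longrightarrow> norm x \<le> R" using assms bounded_supp_support by metis
  show ?thesis unfolding adj_def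
  proof (rule bounded_suppI[of _ R])
    show "bounded_meas (\<lambda>y. cnj (\<kappa> (- y)))" using bounded_meas_shift(3)[OF bounded_supp_imp_bounded_meas[OF assms], of 0] bounded_meas_cnj by simp
  qed (use R[of "- _"] in auto)
qed

text \<open>Fubini moves the kernel variable outside, translation invariance transfers the shift
  from \<open>u\<close> to \<open>v\<close>, and a reflection of the kernel variable then produces
  \<open>adj \<kappa>\<close>.\<close>

lemma torus_integral_adjoint:
  assumes u: "periodic u" and v: "periodic v" and \<kappa>: "bounded_supp \<kappa>"
  shows "torus_integral (\<lambda>x. cconv \<kappa> u x * cnj (v x)) = torus_integral (\<lambda>x. u x * cnj (cconv (adj \<kappa>) v x))"
proof -
  have bounded_meas: "bounded_meas u" "bounded_meas v" using u v by (auto simp: periodic_def)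
  have [measurable]: "u \<in> borel_measurable borel" "v \<in> borel_measurable borel" "\<kappa> \<in> borel_measurable borel"
    using bounded_meas \<kappa> bounded_meas_measurable bounded_supp_measurable by auto
  obtain U where U: "0 \<le> U" "\<And>x. norm (u x) \<le> U" using bounded_meas bounded_meas_bound by metis
  obtain V where V: "0 \<le> V" "\<And>x. norm (v x) \<le> V" using bounded_meas bounded_meas_bound by metis
  obtain K where K: "0 \<le> K" "\<And>x. norm (\<kappa> x) \<le> K" using \<kappa> bounded_meas_bound bounded_supp_imp_bounded_meas by metis
  obtain R where R: "\<And>x. \<kappa> x \<noteq> 0 \<Longrightarrow> norm x \<le> R" using \<kappa> bounded_supp_support by metis
  obtain r where r: "\<And>x. x \<in> Dom \<Longrightarrow> norm x \<le> r" using bounded_Dom by (auto simp: bounded_iff)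
  let ?I = "indicator Dom :: 'a \<Rightarrow> complex"
  have i1: "integrable (lborel \<Otimes>\<^sub>M lborel) (\<lambda>(x,y). ?I x * (\<kappa> y * u (x - y)) * cnj (v x))"
  proof (rule integrable_product_bounded[where B="1*(K*U)*V" and R=r and S=R])
    show "(\<lambda>(x,y). ?I x * (\<kappa> y * u (x - y)) * cnj (v x)) \<in> borel_measurable borel"
      by (simp add: borel_prod[symmetric])
    show "cmod (case z of (x, y) \<Rightarrow> ?I x * (\<kappa> y * u (x - y)) * cnj (v x)) \<le> 1*(K*U)*V" for z
      by (cases z) (auto simp: norm_mult indicator_def intro!: mult_mono U V K mult_nonneg_nonneg)
  qed (use R r in \<open>auto simp: indicator_def split: if_splits\<close>)
  have i2: "integrable (lborel \<Otimes>\<^sub>M lborel) (\<lambda>(x,y). \<kappa> y * (?I x * (u x * cnj (v (x + y)))))"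
  proof (rule integrable_product_bounded[where B="K*(1*(U*V))" and R=r and S=R])
    show "(\<lambda>(x,y). \<kappa> y * (?I x * (u x * cnj (v (x + y))))) \<in> borel_measurable borel"
      by (simp add: borel_prod[symmetric])
    show "cmod (case z of (x, y) \<Rightarrow> \<kappa> y * (?I x * (u x * cnj (v (x + y))))) \<le> K*(1*(U*V))" for z
      by (cases z) (auto simp: norm_mult indicator_def intro!: mult_mono U V K mult_nonneg_nonneg)
  qed (use R r in \<open>auto simp: indicator_def split: if_splits\<close>)
  have "torus_integral (\<lambda>x. cconv \<kappa> u x * cnj (v x)) = (LINT x|lborel. LINT y|lborel. ?I x * (\<kappa> y * u (x - y)) * cnj (v x))"
  proof -
    have *: "?I x * (cconv \<kappa> u x * cnj (v x)) = (LINT y|lborel. ?I x * (\<kappa> y * u (x - y)) * cnj (v x))" for x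
      unfolding cconv_def integral_mult_left_zero integral_mult_right_zero by (rule mult.assoc[symmetric])
    show ?thesis unfolding torus_integral_def by (intro Bochner_Integration.integral_cong refl *)
  qed
  also have "\<dots> = (LINT y|lborel. LINT x|lborel. ?I x * (\<kappa> y * u (x - y)) * cnj (v x))"
    using lborel_pair.Fubini_integral[OF i1] by simp
  also have "\<dots> = (LINT y|lborel. \<kappa> y * torus_integral (\<lambda>x. u (x - y) * cnj (v x)))"
    unfolding torus_integral_def by (simp add: mult_ac)
  also have "\<dots> = (LINT y|lborel. \<kappa> y * torus_integral (\<lambda>x. u x * cnj (v (x + y))))"
  proof (intro Bochner_Integration.integral_cong refl arg_cong2[where f="(*)"])
    fix y
    have "periodic (\<lambda>x. u (x - y) * cnj (v x))"
      unfolding periodic_def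
    proof (intro conjI allI ballI)
      show "bounded_meas (\<lambda>x. u (x - y) * cnj (v x))" by (intro bounded_meas_mult bounded_meas_shift bounded_meas_cnj bounded_meas)
      fix x \<gamma> assume "\<gamma> \<in> \<Gamma>"
      then have "v (x + \<gamma>) = v x" "u (x - y + \<gamma>) = u (x - y)" using u v by (auto simp: periodic_def)
      then show "u (x + \<gamma> - y) * cnj (v (x + \<gamma>)) = u (x - y) * cnj (v x)" by (simp add: algebra_simps)
    qed
    from torus_integral_translate[OF this, of y]
    show "torus_integral (\<lambda>x. u (x - y) * cnj (v x)) = torus_integral (\<lambda>x. u x * cnj (v (x + y)))" by simp
  qed
  also have "\<dots> = (LINT y|lborel. LINT x|lborel. \<kappa> y * (?I x * (u x * cnj (v (x + y)))))"
    unfolding torus_integral_def by simp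
  also have "\<dots> = (LINT x|lborel. LINT y|lborel. \<kappa> y * (?I x * (u x * cnj (v (x + y)))))"
    using lborel_pair.Fubini_integral[OF i2] by simp
  also have "\<dots> = (LINT x|lborel. LINT y|lborel. (?I x * u x) * (\<kappa> y * cnj (v (x + y))))"
    by (simp add: mult_ac)
  also have "\<dots> = (LINT x|lborel. (?I x * u x) * (LINT y|lborel. \<kappa> y * cnj (v (x + y))))"
    by simp
  also have "\<dots> = torus_integral (\<lambda>x. u x * cnj (cconv (adj \<kappa>) v x))"
    unfolding torus_integral_def
  proof (intro Bochner_Integration.integral_cong refl)
    fix x
    have "cnj (cconv (adj \<kappa>) v x) = (LINT y|lborel. \<kappa> (0 - y) * cnj (v (x + (0 - y))))"
      unfolding cconv_def adj_def Bochner_Integration.integral_cnj[symmetric] by simp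
    also have "\<dots> = (LINT y|lborel. \<kappa> y * cnj (v (x + y)))"
      by (rule integral_shift(3)[of "\<lambda>y. \<kappa> y * cnj (v (x + y))" 0]) simp
    finally show "?I x * u x * (LINT y|lborel. \<kappa> y * cnj (v (x + y))) = ?I x * (u x * cnj (cconv (adj \<kappa>) v x))"
      by (simp only: mult.assoc)
  qed
  finally show ?thesis .
qed

text \<open>The squared modulus has integral zero over every translate of \<open>Dom\<close> by a
  period, and these countably many translates cover the space.\<close>

lemma torus_integral_definite:
  assumes u: "periodic u" and 0: "torus_integral (\<lambda>x. u x * cnj (u x)) = 0"
  shows "AE x in lborel. u x = 0"
proof -
  have bounded_meas: "bounded_meas u" using u by (simp add: periodic_def)
  have [measurable]: "u \<in> borel_measurable borel" using bounded_meas bounded_meas_measurable by auto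
  have "AE x in lborel. x - \<gamma> \<in> Dom \<longrightarrow> u x = 0" if \<gamma>: "\<gamma> \<in> \<Gamma>" for \<gamma>
  proof -
    let ?f = "\<lambda>x. indicator Dom (x - \<gamma>) * (norm (u x))\<^sup>2 :: real"
    have c: "complex_of_real (?f x) = indicator Dom (x - \<gamma>) * (u x * cnj (u x))" for x
      by (auto simp: indicator_def complex_norm_square[symmetric])
    have ic: "integrable lborel (\<lambda>x. indicator Dom (x - \<gamma>) * (u x * cnj (u x)))"
      by (rule bounded_supp_integrable[OF bounded_supp_mult[OF bounded_supp_shift(1)[OF bounded_supp_indicator_Dom] bounded_meas_mult[OF bounded_meas bounded_meas_cnj[OF bounded_meas]]]])
    then have i: "integrable lborel ?f"
      unfolding c[symmetric] by (simp only: complex_of_real_integrable_eq )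
    have "complex_of_real (LINT x|lborel. ?f x) = (LINT x|lborel. indicator Dom (x - \<gamma>) * (u x * cnj (u x)))"
      by (simp only: c[symmetric] integral_complex_of_real)
    also have "\<dots> = (LINT x|lborel. indicator Dom x * (u x * cnj (u x)))"
      using integral_shift(1)[of "\<lambda>x. indicator Dom (x - \<gamma>) * (u x * cnj (u x))" \<gamma>] u \<gamma>
      by (simp add: periodic_def)
    also have "\<dots> = 0" using 0 by (simp add: torus_integral_def)
    finally have "(LINT x|lborel. ?f x) = 0" by simp
    then have "AE x in lborel. ?f x = 0"
      using integral_nonneg_eq_0_iff_AE[OF i] by simp
    then show ?thesis by eventually_elim (auto simp: indicator_def)
  qed
  then have "AE x in lborel. \<forall>\<gamma>\<in>\<Gamma>. x - \<gamma> \<in> Dom \<longrightarrow> u x = 0"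
    by (intro AE_ball_countable' countable_\<Gamma>)
  then show ?thesis by eventually_elim (use lattice_floor_\<Gamma> diff_lattice_floor_Dom in blast)
qed

lemma torus_integral_AE_zero: assumes "bounded_meas u" "AE x in lborel. u x = 0" "bounded_meas v" shows "torus_integral (\<lambda>x. v x * cnj (u x)) = 0" "torus_integral (\<lambda>x. u x * v x) = 0"
proof -
  have "bounded_meas (\<lambda>x. cnj (u x))" using assms bounded_meas_cnj by auto
  note [measurable] = bounded_meas_measurable[OF this] bounded_meas_measurable[OF assms(1)] bounded_meas_measurable[OF assms(3)]
  show "torus_integral (\<lambda>x. v x * cnj (u x)) = 0" unfolding torus_integral_def
    using assms(2) by (intro integral_eq_zero_AE) auto
  show "torus_integral (\<lambda>x. u x * v x) = 0" unfolding torus_integral_def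
    using assms(2) by (intro integral_eq_zero_AE) auto
qed

text \<open>Write \<open>T\<close> for the convolution and \<open>S\<close> for its adjoint.
  Commutation gives \<open>T (S (T w)) = S (T (T w)) = 0\<close>. Pairing this with
  \<open>T w\<close> yields \<open>S (T w) = 0\<close>, and pairing that with \<open>w\<close>
  yields \<open>T w = 0\<close>, both almost everywhere.\<close>

lemma normal_kernel_step:
  assumes w: "periodic w" and \<kappa>: "bounded_supp \<kappa>" and z: "AE x in lborel. cconv \<kappa> (cconv \<kappa> w) x = 0"
  shows "AE x in lborel. cconv \<kappa> w x = 0"
proof -
  let ?T = "cconv \<kappa>" and ?S = "cconv (adj \<kappa>)"
  note S = bounded_supp_adj[OF \<kappa>]
  have periodic: "periodic (?T w)" "periodic (?S (?T w))" "periodic (?T (?T w))" using w \<kappa> S by (auto intro: periodic_cconv)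
  have "?T (?S (?T w)) = ?S (?T (?T w))" by (rule cconv_swap) (use \<kappa> S periodic periodic_bounded_meas in auto)
  also have "\<dots> = ?S (\<lambda>_. 0)"
    using cconv_AE_cong[OF z _ _ S] periodic periodic_bounded_meas bounded_measI[of "\<lambda>_. 0" 0] by (auto simp: fun_eq_iff)
  also have "\<dots> = (\<lambda>_. 0)" by (simp add: cconv_def fun_eq_iff)
  finally have "torus_integral (\<lambda>x. ?S (?T w) x * cnj (?S (?T w) x)) = 0"
    using torus_integral_adjoint[OF periodic(2) periodic(1) \<kappa>] by (simp add: torus_integral_def)
  then have "AE x in lborel. ?S (?T w) x = 0" by (rule torus_integral_definite[OF periodic(2)])
  then have "torus_integral (\<lambda>x. w x * cnj (?S (?T w) x)) = 0" using torus_integral_AE_zero periodic periodic_bounded_meas w by blast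
  then have "torus_integral (\<lambda>x. ?T w x * cnj (?T w x)) = 0" using torus_integral_adjoint[OF w periodic(1) \<kappa>] by simp
  then show ?thesis by (rule torus_integral_definite[OF periodic(1)])
qed

theorem normal_kernel_power:
  assumes w: "periodic w" and \<kappa>: "bounded_supp \<kappa>" and z: "AE x in lborel. (cconv \<kappa> ^^ Suc j) w x = 0"
  shows "AE x in lborel. cconv \<kappa> w x = 0"
  using z
proof (induction j)
  case (Suc j)
  have "periodic ((cconv \<kappa> ^^ j) w)" by (induction j) (use w \<kappa> periodic_cconv in auto)
  then have "AE x in lborel. cconv \<kappa> ((cconv \<kappa> ^^ j) w) x = 0"
    by (rule normal_kernel_step[OF _ \<kappa>]) (use Suc.prems in simp)
  then show ?case by (intro Suc.IH) simp
qed simp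

end

section \<open>Exponential twists and characters of the lattice\<close>

lemma bounded_supp_cpow: "bounded_supp f \<Longrightarrow> bounded_supp ((cconv f ^^ j) f)"
  by (induction j) (auto intro: bounded_supp_cconv)

lemma cconv_cpow:
  assumes "bounded_supp f" "bounded_meas u"
  shows "cconv ((cconv f ^^ j) f) u = (cconv f ^^ Suc j) u"
proof (induction j)
  case (Suc j)
  have "cconv ((cconv f ^^ Suc j) f) u = cconv f (cconv ((cconv f ^^ j) f) u)"
    using cconv_assoc[OF assms(1) bounded_supp_cpow[OF assms(1)] assms(2), of j] by simp
  then show ?case using Suc by simp
qed simp

lemma cpow_exp:
  fixes E :: "'a::euclidean_space \<Rightarrow> complex"
  assumes "linear E"
  shows "(cconv (\<lambda>x. f x * exp (E x)) ^^ j) (\<lambda>x. f x * exp (E x)) = (\<lambda>x. (cconv f ^^ j) f x * exp (E x))"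
  by (induction j) (auto simp: cconv_exp[OF assms])

lemma dsum_exp:
  fixes E :: "'a::euclidean_space \<Rightarrow> complex"
  assumes "linear E"
  shows "dsum P (\<lambda>\<tau>. a \<tau> * exp (E \<tau>)) (\<lambda>x. g x * exp (E x)) x = exp (E x) * dsum P a g x"
proof -
  have "exp (E \<tau>) * exp (E (x - \<tau>)) = exp (E x)" for \<tau>
    using linear_diff[OF assms, of x \<tau>] by (simp flip: exp_add)
  then have *: "a \<tau> * exp (E \<tau>) * (g (x - \<tau>) * exp (E (x - \<tau>))) = exp (E x) * (a \<tau> * g (x - \<tau>))" for \<tau>
    by (simp only: mult_ac)
  show ?thesis unfolding dsum_def sum_distrib_left by (intro sum.cong *) simp
qed

lemma dsum_translate:
  assumes "\<And>\<tau>. \<tau> \<in> P \<longleftrightarrow> \<tau> + \<gamma> \<in> P"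
  shows "dsum P a g (x + \<gamma>) = dsum P (\<lambda>\<tau>. a (\<tau> + \<gamma>)) g x"
  unfolding dsum_def
  by (rule sum.reindex_bij_witness[where i="\<lambda>\<tau>. \<tau> + \<gamma>" and j="\<lambda>\<tau>. \<tau> - \<gamma>"])
     (use assms[of "_ - \<gamma>"] assms in \<open>auto simp: algebra_simps\<close>)

lemma AE_lborel_open_witness:
  fixes S :: "'a::euclidean_space set"
  assumes "AE x in lborel. Q x" "open S" "S \<noteq> {}"
  shows "\<exists>x\<in>S. Q x"
proof (rule ccontr)
  assume "\<not> ?thesis"
  then have "AE x in lborel. x \<notin> S" using assms(1) by (auto elim!: eventually_mono)
  then have "S \<in> null_sets lborel"
    using assms(2) by (subst (asm) AE_iff_null_sets[symmetric]) auto
  then have "negligible S" by (simp add: negligible_iff_null_sets null_sets_completionI)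
  then show False using open_not_negligible assms by blast
qed

context lattice_torus begin

text \<open>Serves as an induction principle: integer coordinates are reached from the basis by
  repeated addition and subtraction.\<close>

lemma \<Gamma>_generated:
  assumes S: "\<And>i. i \<in> Basis \<Longrightarrow> B i \<in> S" "0 \<in> S" "\<And>x y. x \<in> S \<Longrightarrow> y \<in> S \<Longrightarrow> x - y \<in> S"
    and \<gamma>: "\<gamma> \<in> \<Gamma>"
  shows "\<gamma> \<in> S"
proof -
  have minus: "- x \<in> S" if "x \<in> S" for x using S(3)[OF S(2) that] by simp
  have add: "x + y \<in> S" if "x \<in> S" "y \<in> S" for x y using S(3)[OF that(1) minus[OF that(2)]] by simp
  have nat: "real n *\<^sub>R x \<in> S" if "x \<in> S" for n x
    by (induction n) (auto simp: S algebra_simps intro: add that)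
  have int: "real_of_int k *\<^sub>R x \<in> S" if "x \<in> S" for k x
    using nat[OF that, of "nat k"] minus[OF nat[OF that, of "nat (- k)"]]
    by (cases "k \<ge> 0") auto
  have sum: "(\<Sum>i\<in>F. g i) \<in> S" if "\<And>i. i \<in> F \<Longrightarrow> g i \<in> S" for F :: "'a set" and g
    using that by (induction F rule: infinite_finite_induct) (auto intro: add simp: S)
  have "\<gamma> = B (\<Sum>i\<in>Basis. (C \<gamma> \<bullet> i) *\<^sub>R i)" by (simp add: euclidean_representation BC)
  also have "\<dots> = (\<Sum>i\<in>Basis. (C \<gamma> \<bullet> i) *\<^sub>R B i)" by (simp add: linear_sum[OF linear_B] linear_scale[OF linear_B])
  also have "\<dots> \<in> S"
  proof (rule sum)
    fix i :: 'a assume i: "i \<in> Basis"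
    then obtain k where "C \<gamma> \<bullet> i = real_of_int k" using \<gamma> by (auto simp: \<Gamma>_def elim: Ints_cases)
    then show "(C \<gamma> \<bullet> i) *\<^sub>R B i \<in> S" using int S(1)[OF i] by simp
  qed
  finally show ?thesis .
qed

text \<open>A logarithm is chosen at each generator \<open>B i\<close> and extended linearly.
  Multiplicativity makes the values of \<open>\<eta>\<close> nonzero; their modulus is arbitrary, so
  \<open>E\<close> need not be imaginary.\<close>

lemma character_exponent:
  assumes add: "\<And>x y. x \<in> \<Gamma> \<Longrightarrow> y \<in> \<Gamma> \<Longrightarrow> \<eta> (x + y) = \<eta> x * \<eta> y" and 0: "\<eta> 0 = (1::complex)"
  shows "\<exists>E. linear E \<and> (\<forall>\<gamma>\<in>\<Gamma>. exp (E \<gamma>) = \<eta> \<gamma>)"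
proof -
  define E where "E x = (\<Sum>i\<in>Basis. (C x \<bullet> i) *\<^sub>R Ln (\<eta> (B i)))" for x
  have nz: "\<eta> x \<noteq> 0" if "x \<in> \<Gamma>" for x using add[OF that \<Gamma>_minus[OF that]] 0 by auto
  have lin: "linear E"
    unfolding E_def
    by (intro linearI) (auto simp: linear_add[OF linear_C] linear_scale[OF linear_C] inner_simps
        algebra_simps sum.distrib scaleR_sum_right)
  have Bi: "B i \<in> \<Gamma>" if "i \<in> Basis" for i using that by (auto simp: \<Gamma>_def CB inner_Basis)
  have "\<gamma> \<in> {x \<in> \<Gamma>. exp (E x) = \<eta> x}" if "\<gamma> \<in> \<Gamma>" for \<gamma>
  proof (rule \<Gamma>_generated[OF _ _ _ that])
    fix i :: 'a assume i: "i \<in> Basis"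
    have "E (B i) = (\<Sum>j\<in>Basis. if j = i then Ln (\<eta> (B i)) else 0)"
      unfolding E_def CB using i by (intro sum.cong) (auto simp: inner_Basis)
    then have "exp (E (B i)) = \<eta> (B i)" using i nz[OF Bi[OF i]] by simp
    then show "B i \<in> {x \<in> \<Gamma>. exp (E x) = \<eta> x}" using Bi i by simp
  next
    show "0 \<in> {x \<in> \<Gamma>. exp (E x) = \<eta> x}" using \<Gamma>_0 0 linear_0[OF lin] by simp
  next
    fix x y assume x: "x \<in> {x \<in> \<Gamma>. exp (E x) = \<eta> x}" and y: "y \<in> {x \<in> \<Gamma>. exp (E x) = \<eta> x}"
    have "\<eta> x = \<eta> (x - y) * \<eta> y" using add[of "x - y" y] x y \<Gamma>_diff by simp
    moreover have "exp (E x) = exp (E (x - y)) * exp (E y)" by (simp add: linear_diff[OF lin] flip: exp_add)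
    ultimately have "exp (E (x - y)) * exp (E y) = \<eta> (x - y) * exp (E y)" using x y by simp
    then show "x - y \<in> {x \<in> \<Gamma>. exp (E x) = \<eta> x}" using x y \<Gamma>_diff by simp
  qed
  then show ?thesis using lin by blast
qed

text \<open>Periodicity reduces the bound to \<open>Dom\<close>, where finitely many centers
  contribute.\<close>

lemma periodic_dsum:
  assumes P: "locally_finite_set P" and shift: "\<And>\<tau> \<gamma>. \<tau> \<in> P \<Longrightarrow> \<gamma> \<in> \<Gamma> \<Longrightarrow> \<tau> + \<gamma> \<in> P"
    and \<alpha>: "\<And>\<tau> \<gamma>. \<tau> \<in> P \<Longrightarrow> \<gamma> \<in> \<Gamma> \<Longrightarrow> \<alpha> (\<tau> + \<gamma>) = \<alpha> \<tau>" and \<theta>: "bounded_supp \<theta>"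
  shows "periodic (dsum P \<alpha> \<theta>)"
proof -
  have periodic: "dsum P \<alpha> \<theta> (x + \<gamma>) = dsum P \<alpha> \<theta> x" if "\<gamma> \<in> \<Gamma>" for x \<gamma>
  proof -
    have iff: "\<tau> \<in> P \<longleftrightarrow> \<tau> + \<gamma> \<in> P" for \<tau>
      using shift[of \<tau> \<gamma>] shift[of "\<tau> + \<gamma>" "- \<gamma>"] \<Gamma>_minus[OF that] that by auto
    show ?thesis unfolding dsum_translate[OF iff]
      unfolding dsum_def using \<alpha> that by (intro sum.cong) auto
  qed
  obtain T where T: "0 \<le> T" "\<And>x. norm (\<theta> x) \<le> T" using \<theta> bounded_meas_bound bounded_supp_imp_bounded_meas by metis
  obtain R where R: "\<And>x. \<theta> x \<noteq> 0 \<Longrightarrow> norm x \<le> R" using \<theta> bounded_supp_support by metis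
  obtain r where r: "\<And>x. x \<in> Dom \<Longrightarrow> norm x \<le> r" using bounded_Dom by (auto simp: bounded_iff)
  define Q where "Q = P \<inter> cball 0 (r + R)"
  have Q: "finite Q" "Q \<subseteq> P" using P by (auto simp: Q_def locally_finite_set_def)
  have bd: "norm (dsum P \<alpha> \<theta> x) \<le> (\<Sum>\<tau>\<in>Q. norm (\<alpha> \<tau>) * T)" if "x \<in> Dom" for x
  proof -
    have "dsum P \<alpha> \<theta> x = (\<Sum>\<tau>\<in>Q. \<alpha> \<tau> * \<theta> (x - \<tau>))"
    proof (rule dsum_eq[OF Q])
      fix \<tau> assume "\<tau> \<in> P" "\<theta> (x - \<tau>) \<noteq> 0"
      then show "\<tau> \<in> Q" using R[of "x - \<tau>"] r[OF that] norm_triangle_ineq4[of x "x - \<tau>"] by (simp add: Q_def)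
    qed
    also have "norm \<dots> \<le> (\<Sum>\<tau>\<in>Q. norm (\<alpha> \<tau>) * T)"
      by (rule order_trans[OF norm_sum]) (auto simp: norm_mult intro!: sum_mono mult_left_mono T)
    finally show ?thesis .
  qed
  have "bounded_meas (dsum P \<alpha> \<theta>)"
  proof (rule bounded_measI)
    show "dsum P \<alpha> \<theta> \<in> borel_measurable borel" using dsum_measurable[OF P \<theta>] .
    show "norm (dsum P \<alpha> \<theta> x) \<le> (\<Sum>\<tau>\<in>Q. norm (\<alpha> \<tau>) * T)" for x
      using bd[OF diff_lattice_floor_Dom[of x]] periodic[OF lattice_floor_\<Gamma>[of x], of "x - lattice_floor x"] by simp
  qed
  then show ?thesis using periodic by (simp add: periodic_def)
qed

text \<open>Multiplying by an exponential that cancels \<open>\<eta>\<close> makes the coefficients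
  periodic and turns the relation into the vanishing of a power of one convolution operator on a
  periodic function. \<open>normal_kernel_power\<close> lowers that power to one, and the twist is
  undone. The twisted kernel is no indicator any more, but normality holds for every kernel.\<close>

theorem character_kernel_power:
  assumes P: "locally_finite_set P" and shift: "\<And>\<tau> \<gamma>. \<tau> \<in> P \<Longrightarrow> \<gamma> \<in> \<Gamma> \<Longrightarrow> \<tau> + \<gamma> \<in> P"
    and a: "\<And>\<tau> \<gamma>. \<tau> \<in> P \<Longrightarrow> \<gamma> \<in> \<Gamma> \<Longrightarrow> a (\<tau> + \<gamma>) = \<eta> \<gamma> * a \<tau>"
    and \<tau>\<^sub>0: "\<tau>\<^sub>0 \<in> P" "a \<tau>\<^sub>0 \<noteq> 0" and f: "bounded_supp f"
    and z: "\<And>\<theta> x. bounded_supp \<theta> \<Longrightarrow> dsum P a (cconv ((cconv f ^^ j) f) \<theta>) x = 0"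
    and \<theta>: "bounded_supp \<theta>"
  shows "AE x in lborel. dsum P a (cconv f \<theta>) x = 0"
proof -
  have "\<eta> (x + y) * a \<tau>\<^sub>0 = \<eta> x * \<eta> y * a \<tau>\<^sub>0" if "x \<in> \<Gamma>" "y \<in> \<Gamma>" for x y
  proof -
    have "\<eta> (x + y) * a \<tau>\<^sub>0 = a (\<tau>\<^sub>0 + y + x)" using a[OF \<tau>\<^sub>0(1) \<Gamma>_add[OF that]] by (simp add: algebra_simps)
    also have "\<dots> = \<eta> x * (\<eta> y * a \<tau>\<^sub>0)" using a shift \<tau>\<^sub>0 that by simp
    finally show ?thesis by simp
  qed
  then have "\<And>x y. x \<in> \<Gamma> \<Longrightarrow> y \<in> \<Gamma> \<Longrightarrow> \<eta> (x + y) = \<eta> x * \<eta> y" using \<tau>\<^sub>0 by simp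
  moreover have "\<eta> 0 = 1" using a[OF \<tau>\<^sub>0(1) \<Gamma>_0] \<tau>\<^sub>0 by simp
  ultimately obtain E0 where E0: "linear E0" "\<And>\<gamma>. \<gamma> \<in> \<Gamma> \<Longrightarrow> exp (E0 \<gamma>) = \<eta> \<gamma>"
    using character_exponent by blast
  \<comment> \<open>The sign is chosen so that the exponential cancels the character in
    \<open>\<alpha>\<close>.\<close>
  define E where "E x = - E0 x" for x
  have E: "linear E" unfolding E_def using E0(1) by (rule linear_compose_neg)
  define \<alpha> where "\<alpha> \<tau> = a \<tau> * exp (E \<tau>)" for \<tau>
  define f' where "f' x = f x * exp (E x)" for x
  define \<theta>' where "\<theta>' x = \<theta> x * exp (E x)" for x
  have bounded_supp: "bounded_supp f'" "bounded_supp \<theta>'" unfolding f'_def \<theta>'_def using f \<theta> E bounded_supp_exp by auto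
  have "\<alpha> (\<tau> + \<gamma>) = \<alpha> \<tau>" if "\<tau> \<in> P" "\<gamma> \<in> \<Gamma>" for \<tau> \<gamma>
  proof -
    have "\<eta> \<gamma> * exp (E \<gamma>) = 1" using E0(2)[OF that(2), symmetric] by (simp add: E_def flip: exp_add)
    then show ?thesis using a[OF that] linear_add[OF E, of \<tau> \<gamma>] by (simp add: \<alpha>_def exp_add)
  qed
  then have u: "periodic (dsum P \<alpha> \<theta>')" using periodic_dsum[OF P shift] bounded_supp by blast
  have "(cconv f' ^^ Suc j) (dsum P \<alpha> \<theta>') x = 0" for x
  proof -
    have "(cconv f' ^^ Suc j) (dsum P \<alpha> \<theta>') x = dsum P \<alpha> (cconv ((cconv f' ^^ j) f') \<theta>') x"
      using cconv_cpow[OF bounded_supp(1) periodic_bounded_meas[OF u], of j] cconv_dsum[OF P bounded_supp_cpow[OF bounded_supp(1)] bounded_supp(2)] by metis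
    also have "\<dots> = exp (E x) * dsum P a (cconv ((cconv f ^^ j) f) \<theta>) x"
      unfolding \<alpha>_def[abs_def] f'_def[abs_def] \<theta>'_def[abs_def] cpow_exp[OF E] cconv_exp[OF E] dsum_exp[OF E] ..
    finally show ?thesis using z[OF \<theta>] by simp
  qed
  then have "AE x in lborel. (cconv f' ^^ Suc j) (dsum P \<alpha> \<theta>') x = 0" by simp
  then have "AE x in lborel. cconv f' (dsum P \<alpha> \<theta>') x = 0" by (rule normal_kernel_power[OF u bounded_supp(1)])
  moreover have "cconv f' (dsum P \<alpha> \<theta>') x = exp (E x) * dsum P a (cconv f \<theta>) x" for x
    unfolding cconv_dsum[OF P bounded_supp] unfolding \<alpha>_def[abs_def] f'_def[abs_def] \<theta>'_def[abs_def]
      cconv_exp[OF E] dsum_exp[OF E] ..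
  ultimately show ?thesis by simp
qed

end

section \<open>Relations between indicator functions\<close>

text \<open>Testing with the indicator of a ball of radius \<open>e / 2\<close> recovers point
  values: near \<open>x0\<close> its convolution with each translate of \<open>U\<close> is either
  the volume of the ball or zero.\<close>

lemma dsum_locally_constant:
  fixes U :: "'a::euclidean_space set"
  assumes P: "locally_finite_set P" and U: "U \<in> sets borel" "bounded U" and e: "0 < e"
    and c: "\<And>\<tau>. \<tau> \<in> P \<Longrightarrow> (\<forall>y\<in>ball x0 e. y - \<tau> \<in> U) \<or> (\<forall>y\<in>ball x0 e. y - \<tau> \<notin> U)"
    and z: "\<And>\<theta>. bounded_supp \<theta> \<Longrightarrow> AE x in lborel. dsum P a (cconv (indicator U) \<theta>) x = 0"
  shows "(\<Sum>\<tau> | \<tau> \<in> P \<and> x0 - \<tau> \<in> U. a \<tau>) = 0"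
proof -
  let ?b = "ball (0::'a) (e/2)"
  let ?\<theta> = "indicator ?b :: 'a \<Rightarrow> complex"
  obtain R where R: "\<And>x. x \<in> U \<Longrightarrow> norm x \<le> R" using U by (auto simp: bounded_iff)
  have [measurable]: "U \<in> sets borel" by fact
  have [measurable]: "?b \<in> sets borel" by simp
  have \<theta>: "bounded_supp ?\<theta>" by (intro bounded_suppI[of _ "e/2"] bounded_measI[of _ 1]) (auto simp: indicator_def)
  \<comment> \<open>The relation holds only almost everywhere, so a nearby point replaces
    \<open>x0\<close>; the radii \<open>e / 2\<close> leave room for both displacements.\<close>
  obtain x where x: "x \<in> ball x0 (e/2)" "dsum P a (cconv (indicator U) ?\<theta>) x = 0"
    using AE_lborel_open_witness[OF z[OF \<theta>], of "ball x0 (e/2)"] e by auto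
  define Q where "Q = {\<tau>. \<tau> \<in> P \<and> x0 - \<tau> \<in> U}"
  have "Q \<subseteq> P \<inter> cball x0 R" using R by (auto simp: Q_def dist_norm)
  then have fin: "finite Q" using P finite_subset unfolding locally_finite_set_def by blast
  have vol: "(LINT y|lborel. ?\<theta> (x - \<tau> - y)) = of_real (measure lborel ?b)" for \<tau>
  proof -
    have "(LINT y|lborel. ?\<theta> (x - \<tau> - y)) = (LINT y|lborel. ?\<theta> y)" by (rule integral_shift(3)) simp
    also have "\<dots> = (LINT y|lborel. complex_of_real (indicator ?b y))" by (intro Bochner_Integration.integral_cong) (auto simp: indicator_def)
    also have "\<dots> = of_real (measure lborel ?b)" by (simp only: integral_complex_of_real) simp
    finally show ?thesis .
  qed
  have near: "x - y \<in> ball x0 e" if "y \<in> ?b" for y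
  proof -
    have "dist x0 (x - y) \<le> dist x0 x + norm y" using dist_triangle[of x0 "x - y" x] by (simp add: dist_norm)
    then show ?thesis using x that by simp
  qed
  have val: "cconv (indicator U) ?\<theta> (x - \<tau>) = (if \<tau> \<in> Q then of_real (measure lborel ?b) else 0)" if "\<tau> \<in> P" for \<tau>
  proof (cases "\<tau> \<in> Q")
    case True
    then have "\<forall>y\<in>ball x0 e. y - \<tau> \<in> U" using c[OF that] e by (auto simp: Q_def)
    then have "y \<in> U" if "x - \<tau> - y \<in> ?b" for y
      using near[OF that] by (auto dest!: bspec[of _ _ "y + \<tau>"] simp: algebra_simps)
    then have *: "indicator U y * ?\<theta> (x - \<tau> - y) = ?\<theta> (x - \<tau> - y)" for y
      by (auto simp: indicator_def)
    show ?thesis unfolding cconv_def * vol using True by simp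
  next
    case False
    then have "\<forall>y\<in>ball x0 e. y - \<tau> \<notin> U" using c[OF that] e that by (auto simp: Q_def)
    then have "y \<notin> U" if "x - \<tau> - y \<in> ?b" for y
      using near[OF that] by (auto dest!: bspec[of _ _ "y + \<tau>"] simp: algebra_simps)
    then have *: "indicator U y * ?\<theta> (x - \<tau> - y) = 0" for y
      by (auto simp: indicator_def)
    show ?thesis unfolding cconv_def * using False by simp
  qed
  have "0 = dsum P a (cconv (indicator U) ?\<theta>) x" using x by simp
  also have "\<dots> = (\<Sum>\<tau>\<in>Q. a \<tau> * cconv (indicator U) ?\<theta> (x - \<tau>))"
    using val by (intro dsum_eq fin) (auto simp: Q_def split: if_splits)
  also have "\<dots> = (\<Sum>\<tau>\<in>Q. a \<tau>) * of_real (measure lborel ?b)"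
    using val by (auto simp: sum_distrib_right Q_def intro!: sum.cong)
  finally have "(\<Sum>\<tau>\<in>Q. a \<tau>) * of_real (measure lborel ?b) = 0" by simp
  moreover have "measure lborel ?b \<noteq> 0" using content_ball_pos[of "e/2" "0::'a"] e by simp
  ultimately show ?thesis by (simp add: Q_def)
qed

section \<open>Asymptotics of Laplace transforms\<close>

text \<open>Terms with equal exponents are collected. Then \<open>m\<close> is the largest exponent
  whose total coefficient \<open>C\<close> survives, and \<open>e\<close> is the gap to the
  exponents below it.\<close>

lemma exponential_sum_leading_term:
  fixes g \<mu> :: "'z \<Rightarrow> real"
  assumes "finite Z"
  defines "S \<equiv> \<lambda>t. \<Sum>z\<in>Z. g z * exp (t * \<mu> z)"
  assumes nz: "\<exists>t. S t \<noteq> 0"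
  shows "\<exists>C m M e. C \<noteq> 0 \<and> e > 0 \<and> (\<forall>t\<ge>0. \<bar>S t * exp (- (t * m)) - C\<bar> \<le> M * exp (- (e * t)))"
proof -
  define c where "c l = (\<Sum>z\<in>{z \<in> Z. \<mu> z = l}. g z)" for l
  define \<Lambda> where "\<Lambda> = {l \<in> \<mu> ` Z. c l \<noteq> 0}"
  have fin: "finite \<Lambda>" using assms by (simp add: \<Lambda>_def)
  have S: "S t = (\<Sum>l\<in>\<Lambda>. c l * exp (t * l))" for t
  proof -
    have "S t = (\<Sum>l\<in>\<mu> ` Z. \<Sum>z\<in>{z \<in> Z. \<mu> z = l}. g z * exp (t * \<mu> z))"
      unfolding S_def using assms by (intro sum.image_gen)
    also have "\<dots> = (\<Sum>l\<in>\<mu> ` Z. c l * exp (t * l))"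
      by (simp add: c_def sum_distrib_right)
    also have "\<dots> = (\<Sum>l\<in>\<Lambda>. c l * exp (t * l))"
      unfolding \<Lambda>_def using assms by (intro sum.mono_neutral_right) auto
    finally show ?thesis .
  qed
  have ne: "\<Lambda> \<noteq> {}" using nz S by auto
  define m where "m = Max \<Lambda>"
  have m: "m \<in> \<Lambda>" "\<And>l. l \<in> \<Lambda> \<Longrightarrow> l \<le> m" using fin ne by (auto simp: m_def)
  define \<Lambda>' where "\<Lambda>' = \<Lambda> - {m}"
  have fin': "finite \<Lambda>'" using fin by (simp add: \<Lambda>'_def)
  have "\<exists>e>0. \<forall>l\<in>\<Lambda>'. l \<le> m - e"
  proof (cases "\<Lambda>' = {}")
    case False
    have "Max \<Lambda>' \<in> \<Lambda>'" using False fin' by simp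
    then have "Max \<Lambda>' < m" using m(2)[of "Max \<Lambda>'"] by (auto simp: \<Lambda>'_def)
    then show ?thesis using fin' by (intro exI[of _ "m - Max \<Lambda>'"]) auto
  qed (auto intro: exI[of _ 1])
  then obtain e where e: "e > 0" "\<And>l. l \<in> \<Lambda>' \<Longrightarrow> l \<le> m - e" by blast
  have "\<bar>S t * exp (- (t * m)) - c m\<bar> \<le> (\<Sum>l\<in>\<Lambda>'. \<bar>c l\<bar>) * exp (- (e * t))" if "t \<ge> 0" for t
  proof -
    have *: "exp (t * l) * exp (- (t * m)) = exp (t * (l - m))" for l
      by (simp add: algebra_simps flip: exp_add)
    have "S t * exp (- (t * m)) = (\<Sum>l\<in>\<Lambda>. c l * exp (t * (l - m)))"
      by (simp add: S sum_distrib_right mult.assoc *)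
    also have "\<dots> = c m + (\<Sum>l\<in>\<Lambda>'. c l * exp (t * (l - m)))"
      using m fin by (simp add: \<Lambda>'_def sum.remove)
    finally have "\<bar>S t * exp (- (t * m)) - c m\<bar> = \<bar>\<Sum>l\<in>\<Lambda>'. c l * exp (t * (l - m))\<bar>" by simp
    also have "\<dots> \<le> (\<Sum>l\<in>\<Lambda>'. \<bar>c l\<bar> * exp (- (e * t)))"
    proof (rule order_trans[OF sum_abs], rule sum_mono)
      fix l assume "l \<in> \<Lambda>'"
      then have "t * (l - m) \<le> - (e * t)" using mult_left_mono[OF e(2)[of l], of t] that by (simp add: algebra_simps)
      then show "\<bar>c l * exp (t * (l - m))\<bar> \<le> \<bar>c l\<bar> * exp (- (e * t))"
        by (simp add: abs_mult mult_left_mono)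
    qed
    finally show ?thesis by (simp add: sum_distrib_right)
  qed
  moreover have "c m \<noteq> 0" using m by (simp add: \<Lambda>_def)
  ultimately show ?thesis using e(1) by blast
qed

lemma exp_neg_tendsto_0: assumes "0 < e" shows "((\<lambda>t::real. exp (- (e * t))) \<longlongrightarrow> 0) at_top"
proof -
  have "filterlim (\<lambda>t. e * t) at_top at_top"
    using assms by (intro filterlim_tendsto_pos_mult_at_top[OF tendsto_const] filterlim_ident)
  then have "filterlim (\<lambda>t. - (e * t)) at_bot at_top" by (simp add: filterlim_uminus_at_bot)
  then show ?thesis by (rule filterlim_compose[OF exp_at_bot])
qed

text \<open>Turns a rate of convergence for the \<open>k\<close>-th power of a ratio into the same
  rate for the ratio.\<close>

lemma abs_diff_1_le_power:
  fixes x :: real assumes "0 \<le> x" "1 \<le> k" shows "\<bar>x - 1\<bar> \<le> \<bar>x ^ k - 1\<bar>"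
proof (cases "x \<le> 1")
  case True
  then have "x ^ k \<le> x ^ 1" using assms by (intro power_decreasing) auto
  then show ?thesis using True assms by simp
next
  case False
  then have "x ^ 1 \<le> x ^ k" using assms by (intro power_increasing) auto
  then show ?thesis using False by simp
qed

lemma filterlim_scale_at_top: "0 < s \<Longrightarrow> filterlim (\<lambda>t::real. s * t) at_top at_top"
  by (intro filterlim_tendsto_pos_mult_at_top[OF tendsto_const] filterlim_ident)

text \<open>\<open>D\<close> is squeezed by telescoping along \<open>t, t / s, t / s\<^sup>2, \<dots>\<close>.\<close>

lemma exponential_decay_from_scaling:
  fixes D :: "real \<Rightarrow> real"
  assumes s: "0 < s" "s < 1" and e: "0 < e" and K: "0 < K" and lim: "(D \<longlongrightarrow> 0) at_top"
    and ev: "eventually (\<lambda>t. \<bar>D t - D (s * t)\<bar> \<le> K * exp (- (e * t))) at_top"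
  shows "eventually (\<lambda>t. D t \<le> 2 * K * exp (- (e * t))) at_top"
proof -
  define N where "N t = D t - 2 * K * exp (- (e * t))" for t
  obtain t0 where t0: "\<And>t. t \<ge> t0 \<Longrightarrow> \<bar>D t - D (s * t)\<bar> \<le> K * exp (- (e * t))"
    using ev unfolding eventually_at_top_linorder by blast
  define d where "d = e * (1 / s - 1)"
  have d: "0 < d" using s e by (simp add: d_def)
  \<comment> \<open>One telescoping term \<open>K * exp (- (e * (t / s)))\<close> must fit into the
    drop of \<open>2 * K * exp (- (e * t))\<close> between \<open>t\<close> and
    \<open>t / s\<close>; the ratio 2/3 of the exponentials is exactly what this requires.\<close>
  have "eventually (\<lambda>t. exp (- (d * t)) < 2 / 3) at_top"
    using order_tendstoD(2)[OF exp_neg_tendsto_0[OF d], of "2/3"] by simp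
  then obtain t1 where t1: "\<And>t. t \<ge> t1 \<Longrightarrow> exp (- (d * t)) < 2 / 3"
    unfolding eventually_at_top_linorder by blast
  define T where "T = max 0 (max t0 t1)"
  have Ts: "t / s \<ge> t" if "t \<ge> T" for t using s that mult_right_mono[of s 1 t] by (simp add: T_def field_simps)
  have step: "N t \<le> N (t / s)" if "t \<ge> T" for t
  proof -
    have "\<bar>D (t / s) - D t\<bar> \<le> K * exp (- (e * (t / s)))"
      using t0[of "t / s"] Ts[OF that] that s by (simp add: T_def)
    moreover have "exp (- (e * (t / s))) = exp (- (d * t)) * exp (- (e * t))"
      using s by (simp add: d_def field_simps flip: exp_add)
    moreover have "exp (- (d * t)) * exp (- (e * t)) \<le> 2 / 3 * exp (- (e * t))"
      using t1[of t] that by (intro mult_right_mono) (auto simp: T_def)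
    ultimately have *: "\<bar>D (t / s) - D t\<bar> \<le> K * exp (- (e * (t / s)))"
      "exp (- (e * (t / s))) \<le> 2 / 3 * exp (- (e * t))" by simp_all
    have "3 * (K * exp (- (e * (t / s)))) \<le> 2 * (K * exp (- (e * t)))"
      using mult_left_mono[OF *(2), of "3 * K"] K by simp
    then show ?thesis using *(1) unfolding N_def by linarith
  qed
  have pos: "N t \<le> 0" if "t \<ge> T" "t > 0" for t
  proof -
    have le: "t * (1 / s) ^ j \<ge> t" for j
      using that s one_le_power[of "1 / s" j] by (simp add: mult_le_cancel_left1 del: one_le_power)
    have N: "N t \<le> N (t * (1 / s) ^ j)" for j
    proof (induction j)
      case (Suc j)
      then show ?case using step[of "t * (1 / s) ^ j"] le[of j] that by (simp add: mult.assoc)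
    qed simp
    have "((\<lambda>t. D t - 2 * K * exp (- (e * t))) \<longlongrightarrow> 0 - 2 * K * 0) at_top"
      by (intro tendsto_intros lim exp_neg_tendsto_0 e)
    then have "(N \<longlongrightarrow> 0) at_top" by (simp add: N_def[abs_def])
    moreover have "filterlim (\<lambda>j. t * (1 / s) ^ j) at_top sequentially"
    proof -
      have "filterlim (\<lambda>j. (1 / s) ^ j) at_top sequentially"
      proof (rule filterlim_at_infinity_imp_filterlim_at_top)
        show "filterlim (\<lambda>j. (1 / s) ^ j) at_infinity sequentially"
          using s by (intro filterlim_realpow_sequentially_gt1) simp
      qed (use s in simp)
      then show ?thesis by (rule filterlim_tendsto_pos_mult_at_top[OF tendsto_const that(2)])
    qed
    ultimately have "(\<lambda>j. N (t * (1 / s) ^ j)) \<longlonglongrightarrow> 0" by (rule filterlim_compose)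
    then show ?thesis by (rule LIMSEQ_le_const) (use N in auto)
  qed
  show ?thesis
    using eventually_ge_at_top[of T] eventually_gt_at_top[of 0]
    by eventually_elim (use pos in \<open>auto simp: N_def\<close>)
qed

text \<open>Since \<open>q\<close> tends to \<open>a\<close>, the exponential sum tends to a nonzero
  constant and, being an exponential sum, does so exponentially fast. Hence \<open>q t\<close> and
  \<open>q (s * t)\<close> differ by an exponentially small amount, and telescoping makes
  \<open>D\<close> exponentially small, against \<open>low\<close>.\<close>

lemma scaling_relation_contradiction:
  fixes q D :: "real \<Rightarrow> real" and g \<mu> :: "'z \<Rightarrow> real"
  assumes s: "0 < s" "s < 1" and a: "0 < a" and h: "0 < h" and k: "1 \<le> k" and \<sigma>: "0 < \<sigma>" and Z: "finite Z"
    and q: "\<And>t. t > 0 \<Longrightarrow> q t = a * (1 - exp (- (2 * h * t))) + D t"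
    and lim: "(D \<longlongrightarrow> 0) at_top"
    and low: "\<And>\<delta>. \<delta> > 0 \<Longrightarrow> \<exists>c>0. \<forall>t\<ge>1. c * exp (- (\<delta> * t)) \<le> D t"
    and rel: "\<And>t. t > 0 \<Longrightarrow> (exp (- (\<sigma> * t)) - 1) ^ n * q t ^ k = q (s * t) ^ k * (\<Sum>z\<in>Z. g z * exp (t * \<mu> z))"
  shows False
proof -
  define S where "S t = (\<Sum>z\<in>Z. g z * exp (t * \<mu> z))" for t
  define w where "w t = (exp (- (\<sigma> * t)) - 1) ^ n" for t
  have qlim: "(q \<longlongrightarrow> a) at_top"
  proof -
    have "((\<lambda>t. a * (1 - exp (- ((2 * h) * t))) + D t) \<longlongrightarrow> a * (1 - 0) + 0) at_top"
      by (intro tendsto_intros lim exp_neg_tendsto_0) (use h in simp)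
    then have "((\<lambda>t. a * (1 - exp (- (2 * h * t))) + D t) \<longlongrightarrow> a) at_top" by simp
    then show ?thesis
    proof (rule Lim_transform_eventually)
      show "eventually (\<lambda>t. a * (1 - exp (- (2 * h * t))) + D t = q t) at_top"
        using eventually_gt_at_top[of 0] by eventually_elim (use q in simp)
    qed
  qed
  have qslim: "((\<lambda>t. q (s * t)) \<longlongrightarrow> a) at_top"
    by (rule filterlim_compose[OF qlim filterlim_scale_at_top[OF s(1)]])
  have ev_q: "eventually (\<lambda>t. q t > 0) at_top" using order_tendstoD(1)[OF qlim a] .
  have ev_qs: "eventually (\<lambda>t. q (s * t) > 0) at_top" using order_tendstoD(1)[OF qslim a] .
  have ev_qs2: "eventually (\<lambda>t. q (s * t) < 2 * a) at_top" using order_tendstoD(2)[OF qslim, of "2 * a"] a by simp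
  have wlim: "(w \<longlongrightarrow> (- 1) ^ n) at_top"
  proof -
    have "((\<lambda>t. (exp (- (\<sigma> * t)) - 1) ^ n) \<longlongrightarrow> (0 - 1) ^ n) at_top"
      by (intro tendsto_intros exp_neg_tendsto_0 \<sigma>)
    then show ?thesis by (simp add: w_def[abs_def])
  qed
  have ratio: "eventually (\<lambda>t. S t = w t * (q t / q (s * t)) ^ k) at_top"
    using ev_qs eventually_gt_at_top[of 0]
    by eventually_elim (use rel in \<open>simp add: S_def w_def power_divide field_simps\<close>)
  have rlim: "((\<lambda>t. (q t / q (s * t)) ^ k) \<longlongrightarrow> 1) at_top"
    using tendsto_power[OF tendsto_divide[OF qlim qslim], of k] a by simp
  have Slim: "(S \<longlongrightarrow> (- 1) ^ n) at_top"
    using tendsto_mult[OF wlim rlim] ratio by (auto intro: Lim_transform_eventually elim!: eventually_mono)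
  have "\<exists>t. S t \<noteq> 0"
  proof (rule ccontr)
    assume "\<not> ?thesis"
    then have "(S \<longlongrightarrow> 0) at_top" by (auto intro!: tendsto_eventually always_eventually)
    then have "(- 1 :: real) ^ n = 0" using tendsto_unique[OF trivial_limit_at_top_linorder Slim] by blast
    then show False by simp
  qed
  then obtain C m M e where C: "C \<noteq> 0" "e > 0" and S: "\<And>t. t \<ge> 0 \<Longrightarrow> \<bar>S t * exp (- (t * m)) - C\<bar> \<le> M * exp (- (e * t))"
    using exponential_sum_leading_term[OF Z, of g \<mu>] unfolding S_def by blast
  have Clim: "((\<lambda>t. S t * exp (- (t * m))) \<longlongrightarrow> C) at_top"
  proof -
    have "((\<lambda>t. S t * exp (- (t * m)) - C) \<longlongrightarrow> 0) at_top"
    proof (rule Lim_null_comparison)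
      show "eventually (\<lambda>t. norm (S t * exp (- (t * m)) - C) \<le> M * exp (- (e * t))) at_top"
        using eventually_ge_at_top[of 0] by eventually_elim (use S in auto)
      show "((\<lambda>t. M * exp (- (e * t))) \<longlongrightarrow> 0) at_top"
        using tendsto_mult_right_zero[OF exp_neg_tendsto_0[OF C(2)]] by simp
    qed
    then show ?thesis by (simp add: Lim_null[symmetric])
  qed
  have elim: "((\<lambda>t. exp (- (t * m))) \<longlongrightarrow> C / (- 1) ^ n) at_top"
  proof (rule Lim_transform_eventually)
    show "((\<lambda>t. S t * exp (- (t * m)) / S t) \<longlongrightarrow> C / (- 1) ^ n) at_top"
      by (intro tendsto_divide Clim Slim) simp
    have "eventually (\<lambda>t. S t \<noteq> 0) at_top" using tendsto_imp_eventually_ne[OF Slim, of 0] by simp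
    then show "eventually (\<lambda>t. S t * exp (- (t * m)) / S t = exp (- (t * m))) at_top"
      by eventually_elim simp
  qed
  have "m = 0"
  proof (rule ccontr)
    assume "m \<noteq> 0"
    then consider "m > 0" | "m < 0" by linarith
    then show False
    proof cases
      case 1
      then have "((\<lambda>t. exp (- (t * m))) \<longlongrightarrow> 0) at_top" using exp_neg_tendsto_0[of m] by (simp add: mult.commute)
      then have "C / (- 1) ^ n = 0" using tendsto_unique[OF trivial_limit_at_top_linorder elim] by blast
      then show False using C by simp
    next
      case 2
      then have "((\<lambda>t. exp (- ((- m) * t))) \<longlongrightarrow> 0) at_top" by (intro exp_neg_tendsto_0) simp
      from tendsto_mult[OF elim this] have "((\<lambda>t. exp (- (t * m)) * exp (- ((- m) * t))) \<longlongrightarrow> 0) at_top" by simp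
      moreover have "exp (- (t * m)) * exp (- ((- m) * t)) = 1" for t by (simp add: algebra_simps flip: exp_add)
      ultimately have "((\<lambda>t::real. 1::real) \<longlongrightarrow> 0) at_top" by simp
      then show False by (simp add: tendsto_const_iff)
    qed
  qed
  then have "(S \<longlongrightarrow> C) at_top" using Clim by simp
  then have C1: "C = (- 1) ^ n" using tendsto_unique[OF trivial_limit_at_top_linorder _ Slim] by blast
  \<comment> \<open>A rate common to the exponential sum and to the factor \<open>w\<close>, which
    approaches its limit with rate \<open>\<sigma>\<close>.\<close>
  define e' where "e' = min e \<sigma>"
  have e': "0 < e'" "e' \<le> e" "e' \<le> \<sigma>" using C \<sigma> by (auto simp: e'_def)
  have expm: "exp (- (b * t)) \<le> exp (- (c * t))" if "c \<le> b" "t \<ge> 0" for b c t :: real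
    using that by (simp add: mult_right_mono)
  have Sw: "\<bar>S t - w t\<bar> \<le> (\<bar>M\<bar> + real n) * exp (- (e' * t))" if "t \<ge> 0" for t
  proof -
    let ?x = "exp (- (\<sigma> * t))"
    have x: "0 \<le> ?x" "?x \<le> 1" using that \<sigma> by auto
    have "w t = (- 1) ^ n * (1 - ?x) ^ n"
      unfolding w_def by (simp flip: power_mult_distrib)
    then have "\<bar>(- 1) ^ n - w t\<bar> = \<bar>(- 1) ^ n * (1 - (1 - ?x) ^ n)\<bar>" by (simp add: right_diff_distrib)
    also have "\<dots> = \<bar>1 - (1 - ?x) ^ n\<bar>" by (simp add: abs_mult power_abs)
    also have "\<dots> \<le> real n * ?x"
    proof -
      \<comment> \<open>Bernoulli's inequality keeps the deviation of \<open>w t\<close> from its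
        limit linear in \<open>?x\<close> for every \<open>n\<close>.\<close>
      have "1 + real n * (- ?x) \<le> (1 + (- ?x)) ^ n" by (rule Bernoulli_inequality) (use x in simp)
      moreover have "(1 - ?x) ^ n \<le> 1" using x by (intro power_le_one) auto
      ultimately show ?thesis by simp
    qed
    also have "\<dots> \<le> real n * exp (- (e' * t))" using expm[OF e'(3) that] by (intro mult_left_mono) auto
    finally have A: "\<bar>(- 1) ^ n - w t\<bar> \<le> real n * exp (- (e' * t))" .
    have "\<bar>S t - (- 1) ^ n\<bar> \<le> M * exp (- (e * t))" using S[OF that] \<open>m = 0\<close> C1 by simp
    also have "\<dots> \<le> \<bar>M\<bar> * exp (- (e' * t))" using expm[OF e'(2) that] by (intro mult_mono) auto
    finally show ?thesis using A by (simp add: distrib_right)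
  qed
  define M' where "M' = \<bar>M\<bar> + real n"
  have ev_w: "eventually (\<lambda>t. \<bar>w t\<bar> > 1 / 2) at_top"
  proof -
    have "((\<lambda>t. \<bar>w t\<bar>) \<longlongrightarrow> \<bar>(- 1) ^ n\<bar>) at_top" by (intro tendsto_intros wlim)
    then have "((\<lambda>t. \<bar>w t\<bar>) \<longlongrightarrow> 1) at_top" by (simp add: power_abs)
    then show ?thesis by (rule order_tendstoD(1)) simp
  qed
  have dq: "eventually (\<lambda>t. \<bar>q t - q (s * t)\<bar> \<le> 4 * a * M' * exp (- (e' * t))) at_top"
    using ratio ev_w ev_q ev_qs ev_qs2 eventually_ge_at_top[of 0]
  proof eventually_elim
    case (elim t)
    let ?r = "q t / q (s * t)"
    have "\<bar>?r - 1\<bar> \<le> \<bar>?r ^ k - 1\<bar>" using elim k by (intro abs_diff_1_le_power) auto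
    moreover have "\<bar>w t\<bar> * \<bar>?r ^ k - 1\<bar> = \<bar>S t - w t\<bar>" using elim by (simp add: right_diff_distrib flip: abs_mult)
    moreover have "\<bar>?r ^ k - 1\<bar> \<le> 2 * (\<bar>w t\<bar> * \<bar>?r ^ k - 1\<bar>)"
      using mult_right_mono[of "1/2" "\<bar>w t\<bar>" "\<bar>?r ^ k - 1\<bar>"] elim by simp
    ultimately have 1: "\<bar>?r - 1\<bar> \<le> 2 * (M' * exp (- (e' * t)))"
      using Sw[of t] elim by (simp add: M'_def)
    have "\<bar>q t - q (s * t)\<bar> = q (s * t) * \<bar>?r - 1\<bar>"
    proof -
      have "q t - q (s * t) = q (s * t) * (?r - 1)" using elim by (simp add: field_simps)
      then show ?thesis using elim by (simp add: abs_mult)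
    qed
    also have "\<dots> \<le> (2 * a) * (2 * (M' * exp (- (e' * t))))"
      using 1 elim a by (intro mult_mono) auto
    finally show ?case by simp
  qed
  \<comment> \<open>The explicit exponentials in \<open>q t\<close> and \<open>q (s * t)\<close>
    decay with rates \<open>2 * h\<close> and \<open>2 * h * s\<close>; the second is the slower one
    and must be absorbed too.\<close>
  define e2 where "e2 = min e' (2 * h * s)"
  have e2: "0 < e2" "e2 \<le> e'" "e2 \<le> 2 * h * s" "e2 \<le> 2 * h"
    using e' h s by (auto simp: e2_def min_le_iff_disj)
  define K where "K = 4 * a * M' + 2 * a"
  have M': "0 \<le> M'" by (simp add: M'_def)
  have K: "0 < K" using a M' by (simp add: K_def add_nonneg_pos)
  have dD: "eventually (\<lambda>t. \<bar>D t - D (s * t)\<bar> \<le> K * exp (- (e2 * t))) at_top"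
    using dq eventually_gt_at_top[of 0]
  proof eventually_elim
    case (elim t)
    have "D t - D (s * t) = (q t - q (s * t)) + a * exp (- (2 * h * t)) - a * exp (- (2 * h * s * t))"
      using q[of t] q[of "s * t"] elim s by (simp add: algebra_simps)
    moreover have "a * exp (- (2 * h * t)) \<le> a * exp (- (e2 * t))"
      using expm[OF e2(4), of t] elim a by simp
    moreover have "a * exp (- (2 * h * s * t)) \<le> a * exp (- (e2 * t))"
      using expm[OF e2(3), of t] elim a by simp
    moreover have "4 * a * M' * exp (- (e' * t)) \<le> 4 * a * M' * exp (- (e2 * t))"
      using expm[OF e2(2), of t] elim a M' by (intro mult_left_mono) auto
    moreover have "0 \<le> a * exp (- (2 * h * t))" "0 \<le> a * exp (- (2 * h * s * t))" using a by auto
    moreover have "K * exp (- (e2 * t)) = 4 * a * M' * exp (- (e2 * t)) + 2 * (a * exp (- (e2 * t)))"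
      by (simp add: K_def algebra_simps)
    ultimately show ?case using elim(1) by linarith
  qed
  have up: "eventually (\<lambda>t. D t \<le> 2 * K * exp (- (e2 * t))) at_top"
    by (rule exponential_decay_from_scaling[OF s e2(1) K lim dD])
  \<comment> \<open>\<open>low\<close> holds for every positive rate, and half of the rate obtained
    for \<open>D\<close> already contradicts the upper bound.\<close>
  obtain c where c: "c > 0" "\<And>t. t \<ge> 1 \<Longrightarrow> c * exp (- (e2 / 2 * t)) \<le> D t" using low[of "e2 / 2"] e2 by auto
  have "eventually (\<lambda>t. exp (- (e2 / 2 * t)) < c / (2 * K)) at_top"
    using c K e2 by (intro order_tendstoD(2)[OF exp_neg_tendsto_0]) auto
  with up eventually_ge_at_top[of 1] have "eventually (\<lambda>t::real. False) at_top"
  proof eventually_elim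
    case (elim t)
    let ?x = "exp (- (e2 / 2 * t))"
    have "exp (- (e2 * t)) = ?x * ?x" by (simp flip: exp_add)
    then have "c * ?x \<le> (2 * K * ?x) * ?x" using elim(1) c(2)[OF elim(2)] by (simp only: mult.assoc)
    then have "c \<le> 2 * K * ?x" by (rule mult_right_le_imp_le) simp
    moreover have "2 * K * ?x < c" using elim(3) K by (simp add: field_simps)
    ultimately show False by simp
  qed
  then show False by simp
qed

section \<open>Integration along lines parallel to a vector\<close>

text \<open>For each \<open>x\<close> the parameters \<open>l\<close> with
  \<open>x - l *\<^sub>R p\<close> in the slab form an interval of length 1, so the double integral
  counts every point with weight 1. This avoids coordinates on the orthogonal hyperplane.\<close>

lemma slab_fubini:
  fixes G :: "'a::euclidean_space \<Rightarrow> real" and p :: 'a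
  assumes G [measurable]: "G \<in> borel_measurable borel" and B: "\<And>x. \<bar>G x\<bar> \<le> B"
    and R: "\<And>x. G x \<noteq> 0 \<Longrightarrow> norm x \<le> R" and p: "p \<noteq> 0"
  shows "(LINT x|lborel. G x)
    = (LINT x|lborel. indicator {x. 0 \<le> x \<bullet> p \<and> x \<bullet> p < p \<bullet> p} x * (LINT l|lborel. G (x + l *\<^sub>R p)))"
proof -
  let ?S = "{x. 0 \<le> x \<bullet> p \<and> x \<bullet> p < p \<bullet> p}"
  let ?I = "indicator ?S :: 'a \<Rightarrow> real"
  define N where "N = p \<bullet> p"
  have N: "0 < N" using p by (simp add: N_def)
  have [measurable]: "?S \<in> sets borel" by measurable
  have R0: "0 \<le> R \<or> (\<forall>x. G x = 0)" using R order_trans[OF norm_ge_zero] by blast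
  have B0: "0 \<le> B" using B[of 0] by linarith
  have bnd: "\<bar>x \<bullet> p\<bar> \<le> R * norm p" if "G x \<noteq> 0" for x
    using Cauchy_Schwarz_ineq2[of x p] mult_right_mono[OF R[OF that], of "norm p"] by simp
  define T where "T = (R * norm p + N) / N"
  have T: "\<bar>l\<bar> \<le> T" if "G x \<noteq> 0" "x - l *\<^sub>R p \<in> ?S" for x l
  proof -
    have "x \<bullet> p - l * N \<ge> 0" "x \<bullet> p - l * N < N" using that(2) by (auto simp: inner_diff_left N_def)
    then have "\<bar>l * N\<bar> \<le> R * norm p + N" using bnd[OF that(1)] by linarith
    then show ?thesis using N by (simp add: T_def field_simps abs_mult)
  qed
  have i1: "integrable (lborel \<Otimes>\<^sub>M lborel) (\<lambda>(x, l). ?I x * G (x + l *\<^sub>R p))"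
  proof (rule integrable_product_bounded[where B=B and R="R + T * norm p" and S=T])
    show "(\<lambda>(x, l). ?I x * G (x + l *\<^sub>R p)) \<in> borel_measurable borel"
      unfolding borel_prod[symmetric] by measurable
    show "norm (case z of (x, l) \<Rightarrow> ?I x * G (x + l *\<^sub>R p)) \<le> B" for z
      using B B0 by (cases z) (auto simp: indicator_def)
    fix x and l :: real assume "(case (x, l) of (x, l) \<Rightarrow> ?I x * G (x + l *\<^sub>R p)) \<noteq> 0"
    then have xl: "x \<in> ?S" "G (x + l *\<^sub>R p) \<noteq> 0" by (auto simp: indicator_def split: if_splits)
    have l: "\<bar>l\<bar> \<le> T" using T[OF xl(2), of l] xl(1) by simp
    have "norm x \<le> norm (x + l *\<^sub>R p) + \<bar>l\<bar> * norm p"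
      using norm_triangle_ineq4[of "x + l *\<^sub>R p" "l *\<^sub>R p"] by simp
    also have "\<dots> \<le> R + T * norm p" using R[OF xl(2)] l by (intro add_mono mult_right_mono) auto
    finally show "norm x \<le> R + T * norm p \<and> norm l \<le> T" using l by simp
  qed
  have i2: "integrable (lborel \<Otimes>\<^sub>M lborel) (\<lambda>(x, l). ?I (x - l *\<^sub>R p) * G x)"
  proof (rule integrable_product_bounded[where B=B and R=R and S=T])
    show "(\<lambda>(x, l). ?I (x - l *\<^sub>R p) * G x) \<in> borel_measurable borel"
      unfolding borel_prod[symmetric] by measurable
    show "norm (case z of (x, l) \<Rightarrow> ?I (x - l *\<^sub>R p) * G x) \<le> B" for z
      using B B0 by (cases z) (auto simp: indicator_def)
    fix x and l :: real assume "(case (x, l) of (x, l) \<Rightarrow> ?I (x - l *\<^sub>R p) * G x) \<noteq> 0"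
    then have xl: "x - l *\<^sub>R p \<in> ?S" "G x \<noteq> 0" by (auto simp: indicator_def split: if_splits)
    then show "norm x \<le> R \<and> norm l \<le> T" using R T by auto
  qed
  have one: "(LINT l|lborel. ?I (x - l *\<^sub>R p)) = 1" for x
  proof -
    have "x - l *\<^sub>R p \<in> ?S \<longleftrightarrow> l \<in> {x \<bullet> p / N - 1<..x \<bullet> p / N}" for l
      using N by (auto simp: inner_diff_left N_def[symmetric] field_simps)
    then have "(LINT l|lborel. ?I (x - l *\<^sub>R p)) = (LINT l|lborel. indicator {x \<bullet> p / N - 1<..x \<bullet> p / N} l)"
      by (intro Bochner_Integration.integral_cong) (auto simp: indicator_def)
    then show ?thesis by simp
  qed
  have "(LINT x|lborel. ?I x * (LINT l|lborel. G (x + l *\<^sub>R p)))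
      = (LINT x|lborel. LINT l|lborel. ?I x * G (x + l *\<^sub>R p))" by simp
  also have "\<dots> = (LINT l|lborel. LINT x|lborel. ?I x * G (x + l *\<^sub>R p))"
    using lborel_pair.Fubini_integral[OF i1] by simp
  also have "\<dots> = (LINT l|lborel. LINT x|lborel. ?I (x - l *\<^sub>R p) * G x)"
  proof (rule Bochner_Integration.integral_cong[OF refl])
    fix l :: real
    have "(LINT x|lborel. ?I (x - l *\<^sub>R p) * G (x - l *\<^sub>R p + l *\<^sub>R p)) = (LINT x|lborel. ?I x * G (x + l *\<^sub>R p))"
      by (rule integral_shift(2)[of "\<lambda>x. ?I x * G (x + l *\<^sub>R p)"]) measurable
    then show "(LINT x|lborel. ?I x * G (x + l *\<^sub>R p)) = (LINT x|lborel. ?I (x - l *\<^sub>R p) * G x)" by simp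
  qed
  also have "\<dots> = (LINT x|lborel. LINT l|lborel. ?I (x - l *\<^sub>R p) * G x)"
    using lborel_pair.Fubini_integral[OF i2] by simp
  also have "\<dots> = (LINT x|lborel. G x)" by (simp only: integral_mult_left_zero one) simp
  finally show ?thesis by simp
qed

lemma integral_exp_interval:
  fixes h t :: real
  assumes "0 \<le> h" "0 < t"
  shows "(LINT z|lborel. indicator {-h..h} z * exp (t * z)) = (exp (t * h) - exp (- (t * h))) / t"
proof -
  have "(LINT z|lborel. exp (t * z) * indicator {-h..h} z) = exp (t * h) / t - exp (t * (- h)) / t"
  proof (rule integral_FTC_Icc_real[where F="\<lambda>z. exp (t * z) / t"])
    show "DERIV (\<lambda>z. exp (t * z) / t) z :> exp (t * z)" for z
      using assms by (auto intro!: derivative_eq_intros)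
  qed (use assms in \<open>auto intro!: continuous_intros\<close>)
  then show ?thesis by (simp add: diff_divide_distrib mult.commute)
qed

text \<open>Here \<open>N\<close> is meant as \<open>p \<bullet> p\<close>: a move by
  \<open>l *\<^sub>R p\<close> changes the inner product with \<open>p\<close> by
  \<open>N * l\<close>, whence the factor in the denominator.\<close>

lemma integral_exp_line:
  fixes h t N b :: real
  assumes "0 \<le> h" "0 < t" "0 < N"
  shows "(LINT l|lborel. indicator {-h..h} (b + N * l) * exp (t * (b + N * l)))
      = (exp (t * h) - exp (- (t * h))) / (N * t)"
proof -
  have "(LINT z|lborel. indicator {-h..h} z * exp (t * z))
      = N * (LINT l|lborel. indicator {-h..h} (b + N * l) * exp (t * (b + N * l)))"
    using lborel_integral_real_affine[of N "\<lambda>z. indicator {-h..h} z * exp (t * z)" b] assms by simp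
  then have "(LINT l|lborel. indicator {-h..h} (b + N * l) * exp (t * (b + N * l)))
      = (LINT z|lborel. indicator {-h..h} z * exp (t * z)) / N" using assms(3) by simp
  then show ?thesis unfolding integral_exp_interval[OF assms(1,2)] by (simp add: mult.commute)
qed

section \<open>Laplace transform of a convex body with a flat cap\<close>

text \<open>\<open>V\<close> lies between two parallel hyperplanes, contains a neighbourhood of
  \<open>p / 2\<close> in the upper one, and repeats its upper facet, shifted by \<open>- p\<close>,
  in the lower one. The point \<open>y\<close> is the defect: its projection along \<open>p\<close>
  to the upper hyperplane leaves \<open>V\<close>, so \<open>V\<close> is not a prism.\<close>

locale capped_body =
  fixes V :: "'a::euclidean_space set" and p y :: 'a
  assumes compact_V: "compact V" and convex_V: "convex V" and p: "p \<noteq> 0"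
    and height: "\<And>x. x \<in> V \<Longrightarrow> \<bar>x \<bullet> p\<bar> \<le> p \<bullet> p / 2"
    and opposite: "\<And>x. x \<in> V \<Longrightarrow> x \<bullet> p = p \<bullet> p / 2 \<Longrightarrow> x - p \<in> V"
    and facet_ball: "\<exists>e>0. \<forall>x. dist x ((1/2) *\<^sub>R p) < e \<longrightarrow> x \<bullet> p \<le> p \<bullet> p / 2 \<longrightarrow> x \<in> V"
    and y: "y \<in> V" "y + ((p \<bullet> p / 2 - y \<bullet> p) / (p \<bullet> p)) *\<^sub>R p \<notin> V"
begin

definition "N = p \<bullet> p"
definition "h = p \<bullet> p / 2"
text \<open>Projection along \<open>p\<close> to the hyperplane of the upper facet.\<close>

definition lift :: "'a \<Rightarrow> 'a" where "lift x = x + ((h - x \<bullet> p) / N) *\<^sub>R p"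
definition "Cyl = {x. lift x \<in> V}"

lemma N_pos: "0 < N" and h_pos: "0 < h" and N_h: "N = 2 * h"
  using p by (auto simp: N_def h_def)

lemma lift_inner [simp]: "lift x \<bullet> p = h"
  using N_pos by (simp add: lift_def inner_add_left N_def[symmetric])

lemma lift_shift [simp]: "lift (x + l *\<^sub>R p) = lift x"
proof -
  have "lift (x + l *\<^sub>R p) = x + (l + (h - (x + l *\<^sub>R p) \<bullet> p) / N) *\<^sub>R p"
    by (simp add: lift_def scaleR_add_left add.assoc)
  also have "l + (h - (x + l *\<^sub>R p) \<bullet> p) / N = (h - x \<bullet> p) / N"
    using N_pos by (simp add: inner_add_left N_def[symmetric] diff_divide_distrib add_divide_distrib)
  finally show ?thesis by (simp add: lift_def)
qed

lemma lift_id: "x \<bullet> p = h \<Longrightarrow> lift x = x" by (simp add: lift_def)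

lemma lift_combination: assumes "u + v = 1" shows "lift (u *\<^sub>R a + v *\<^sub>R b) = u *\<^sub>R lift a + v *\<^sub>R lift b"
proof -
  have "(h - (u *\<^sub>R a + v *\<^sub>R b) \<bullet> p) / N = u * ((h - a \<bullet> p) / N) + v * ((h - b \<bullet> p) / N)"
  proof -
    have "h = u * h + v * h" using assms by (simp flip: distrib_right)
    then have "h - (u *\<^sub>R a + v *\<^sub>R b) \<bullet> p = u * (h - a \<bullet> p) + v * (h - b \<bullet> p)"
      by (simp add: inner_add_left algebra_simps)
    then show ?thesis by (simp add: add_divide_distrib)
  qed
  then show ?thesis by (simp add: lift_def algebra_simps)
qed

lemma continuous_lift: "continuous_on UNIV lift"
  unfolding lift_def[abs_def] by (intro continuous_intros) (use N_pos in auto)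

lemma closed_V: "closed V" using compact_V by (rule compact_imp_closed)

lemma closed_Cyl: "closed Cyl"
proof -
  have "Cyl = lift -` V" by (auto simp: Cyl_def)
  then show ?thesis using closed_vimage[OF closed_V continuous_lift] by simp
qed

lemma measurable_sets [measurable]: "V \<in> sets borel" "Cyl \<in> sets borel"
  using closed_V closed_Cyl by auto

text \<open>Over the facet the line meets \<open>V\<close> in a point of the upper hyperplane and,
  by \<open>opposite\<close>, in one of the lower; convexity fills the segment between them.\<close>

lemma line_in_V: assumes "x \<in> Cyl" shows "x + l *\<^sub>R p \<in> V \<longleftrightarrow> \<bar>x \<bullet> p + N * l\<bar> \<le> h"
proof
  assume "x + l *\<^sub>R p \<in> V"
  then show "\<bar>x \<bullet> p + N * l\<bar> \<le> h" using height by (force simp: inner_add_left N_def h_def mult.commute)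
next
  assume a: "\<bar>x \<bullet> p + N * l\<bar> \<le> h"
  have top: "lift x \<in> V" using assms by (simp add: Cyl_def)
  have bot: "lift x - p \<in> V" using opposite[OF top] by (simp add: h_def[symmetric])
  define \<theta> where "\<theta> = (h - (x \<bullet> p + N * l)) / N"
  have \<theta>: "0 \<le> \<theta>" "\<theta> \<le> 1" using a N_pos N_h by (auto simp: \<theta>_def field_simps)
  have "(1 - \<theta>) *\<^sub>R lift x + \<theta> *\<^sub>R (lift x - p) \<in> V" using convexD[OF convex_V top bot] \<theta> by simp
  moreover have "(1 - \<theta>) *\<^sub>R lift x + \<theta> *\<^sub>R (lift x - p) = lift x - \<theta> *\<^sub>R p" by (simp add: algebra_simps)
  moreover have "lift x - \<theta> *\<^sub>R p = x + l *\<^sub>R p"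
  proof -
    have "(h - x \<bullet> p) / N - \<theta> = l" using N_pos by (simp add: \<theta>_def field_simps)
    then show ?thesis by (simp add: lift_def flip: scaleR_diff_left)
  qed
  ultimately show "x + l *\<^sub>R p \<in> V" by simp
qed

definition R0 :: real where "R0 = (SOME R. 0 \<le> R \<and> (\<forall>x\<in>V. norm x \<le> R))"

lemma R0: "0 \<le> R0" "x \<in> V \<Longrightarrow> norm x \<le> R0"
proof -
  obtain R where "\<forall>x\<in>V. norm x \<le> R" using compact_imp_bounded[OF compact_V] by (auto simp: bounded_iff)
  then have "\<exists>R. 0 \<le> R \<and> (\<forall>x\<in>V. norm x \<le> R)" by (intro exI[of _ "max R 0"]) auto
  from someI_ex[OF this] show "0 \<le> R0" "x \<in> V \<Longrightarrow> norm x \<le> R0" by (auto simp: R0_def)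
qed

text \<open>
  \<open>Cyl\<close> is the prism over the facet \<open>x \<bullet> p = h\<close> of \<open>V\<close>; its contribution to \<open>F\<close> is explicit and \<open>D\<close> is the normalized
  contribution of the rest of \<open>V\<close>.
\<close>

definition F :: "real \<Rightarrow> real" where "F t = (LINT x|lborel. indicator V x * exp (t * (x \<bullet> p)))"
definition D :: "real \<Rightarrow> real" where
  "D t = t * exp (- (t * h)) * (LINT x|lborel. indicator V x * (1 - indicator Cyl x) * exp (t * (x \<bullet> p)))"

abbreviation "slab \<equiv> {x. 0 \<le> x \<bullet> p \<and> x \<bullet> p < p \<bullet> p}"
text \<open>The area of the facet divided by the length of \<open>p\<close>, written as a volume:
  the slab has width \<open>norm p\<close>, and \<open>N\<close> is the square of that.\<close>

definition "A = (LINT x|lborel. indicator slab x * indicator Cyl x) / N"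

lemma slab_bound: assumes "x \<in> slab" "x + l *\<^sub>R p \<in> V" shows "norm x \<le> R0 + 2 * norm p"
proof -
  have "\<bar>x \<bullet> p + N * l\<bar> \<le> h" using height[OF assms(2)] by (simp add: inner_add_left N_def h_def mult.commute)
  moreover have "0 \<le> x \<bullet> p" "x \<bullet> p < 2 * h" using assms(1) by (auto simp: h_def)
  ultimately have "\<bar>N * l\<bar> \<le> N * 2" using N_h by linarith
  then have "N * \<bar>l\<bar> \<le> N * 2" using N_pos by (simp add: abs_mult)
  then have "\<bar>l\<bar> \<le> 2" using N_pos by (simp only: mult_le_cancel_left_pos)
  then have "\<bar>l\<bar> * norm p \<le> 2 * norm p" by (intro mult_right_mono) auto
  moreover have "norm x \<le> norm (x + l *\<^sub>R p) + \<bar>l\<bar> * norm p"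
    using norm_triangle_ineq4[of "x + l *\<^sub>R p" "l *\<^sub>R p"] by simp
  ultimately show ?thesis using R0(2)[OF assms(2)] by linarith
qed

lemma exp_bound: assumes "x \<in> V" "0 \<le> t" shows "exp (t * (x \<bullet> p)) \<le> exp (t * h)"
proof -
  have "x \<bullet> p \<le> h" using height[OF assms(1)] unfolding h_def by linarith
  then show ?thesis using assms(2) by (simp add: mult_left_mono)
qed

lemma integrable_V:
  assumes t: "0 \<le> t" and f [measurable]: "f \<in> borel_measurable borel" and "\<And>x. 0 \<le> f x \<and> f x \<le> (1::real)"
  shows "integrable lborel (\<lambda>x. indicator V x * f x * exp (t * (x \<bullet> p)))"
proof (rule integrable_bounded_support[where R=R0 and B="exp (t * h)"])
  fix x
  show "norm (indicator V x * f x * exp (t * (x \<bullet> p))) \<le> exp (t * h)"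
  proof (cases "x \<in> V")
    case True
    have "f x * exp (t * (x \<bullet> p)) \<le> 1 * exp (t * h)" using exp_bound[OF True t] assms(3)[of x] by (intro mult_mono) auto
    then show ?thesis using True assms(3)[of x] by simp
  qed simp
qed (use R0 in \<open>auto simp: indicator_def split: if_splits\<close>)

text \<open>On the prism every line contributes the same integral over \<open>{-h..h}\<close>, so
  its share is \<open>A\<close> times an elementary function whose growth the factor in front
  cancels; the rest is \<open>D\<close> by definition.\<close>

lemma F_split: assumes t: "0 < t"
  shows "t * exp (- (t * h)) * F t = A * (1 - exp (- (2 * h * t))) + D t"
proof -
  have [measurable]: "slab \<in> sets borel" by measurable
  let ?G = "\<lambda>x. indicator V x * indicator Cyl x * exp (t * (x \<bullet> p)) :: real"
  have i: "integrable lborel ?G"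
    using t by (intro integrable_V) (auto simp: indicator_def)
  have i': "integrable lborel (\<lambda>x. indicator V x * (1 - indicator Cyl x) * exp (t * (x \<bullet> p)) :: real)"
    using t by (intro integrable_V) (auto simp: indicator_def)
  have "F t = (LINT x|lborel. ?G x + indicator V x * (1 - indicator Cyl x) * exp (t * (x \<bullet> p)))"
    unfolding F_def by (intro Bochner_Integration.integral_cong) (auto simp: algebra_simps)
  also have "\<dots> = (LINT x|lborel. ?G x) + (LINT x|lborel. indicator V x * (1 - indicator Cyl x) * exp (t * (x \<bullet> p)))"
    using i i' by (rule Bochner_Integration.integral_add)
  finally have "t * exp (- (t * h)) * F t = t * exp (- (t * h)) * (LINT x|lborel. ?G x) + D t"
    by (simp add: D_def distrib_left)
  moreover have G: "(LINT x|lborel. ?G x) = A * ((exp (t * h) - exp (- (t * h))) / t)"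
  proof -
    have "(LINT x|lborel. ?G x) = (LINT x|lborel. indicator slab x * (LINT l|lborel. ?G (x + l *\<^sub>R p)))"
    proof (rule slab_fubini[where B="exp (t * h)" and R=R0])
      show "?G \<in> borel_measurable borel" by measurable
      show "\<bar>?G x\<bar> \<le> exp (t * h)" for x
        using exp_bound[of x t] t by (auto simp: indicator_def)
    qed (use R0 p in \<open>auto simp: indicator_def split: if_splits\<close>)
    also have "\<dots> = (LINT x|lborel. (indicator slab x * indicator Cyl x) * ((exp (t * h) - exp (- (t * h))) / (N * t)))"
    proof (rule Bochner_Integration.integral_cong[OF refl])
      fix x
      have "(LINT l|lborel. ?G (x + l *\<^sub>R p)) = indicator Cyl x * ((exp (t * h) - exp (- (t * h))) / (N * t))"
      proof (cases "x \<in> Cyl")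
        case True
        then have "x + l *\<^sub>R p \<in> Cyl" for l by (simp add: Cyl_def)
        then have "?G (x + l *\<^sub>R p) = indicator {-h..h} (x \<bullet> p + N * l) * exp (t * (x \<bullet> p + N * l))" for l
          using line_in_V[OF True, of l] by (auto simp: indicator_def inner_add_left N_def mult.commute)
        then show ?thesis using integral_exp_line[of h t N "x \<bullet> p"] t h_pos N_pos True by simp
      next
        case False
        then have "x + l *\<^sub>R p \<notin> Cyl" for l by (simp add: Cyl_def)
        then show ?thesis using False by simp
      qed
      then show "indicator slab x * (LINT l|lborel. ?G (x + l *\<^sub>R p))
        = (indicator slab x * indicator Cyl x) * ((exp (t * h) - exp (- (t * h))) / (N * t))" by simp
    qed
    also have "\<dots> = A * ((exp (t * h) - exp (- (t * h))) / t)"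
      by (simp add: A_def)
    finally show ?thesis .
  qed
  moreover have "t * exp (- (t * h)) * (LINT x|lborel. ?G x) = A * (1 - exp (- (2 * h * t)))"
  proof -
    have "t * exp (- (t * h)) * (LINT x|lborel. ?G x) = A * (exp (- (t * h)) * (exp (t * h) - exp (- (t * h))))"
      unfolding G using t by simp
    also have "exp (- (t * h)) * (exp (t * h) - exp (- (t * h))) = 1 - exp (- (2 * h * t))"
      by (simp add: algebra_simps flip: exp_add)
    finally show ?thesis .
  qed
  ultimately show ?thesis by simp
qed

text \<open>Points of the open slab that \<open>lift\<close> sends close to \<open>p / 2\<close>
  form a nonempty open subset of the prism.\<close>

lemma A_pos: "0 < A"
proof -
  have [measurable]: "slab \<in> sets borel" by measurable
  let ?f = "\<lambda>x. indicator slab x * indicator Cyl x :: real"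
  obtain e where e: "e > 0" "\<And>x. dist x ((1/2) *\<^sub>R p) < e \<Longrightarrow> x \<bullet> p \<le> p \<bullet> p / 2 \<Longrightarrow> x \<in> V"
    using facet_ball by blast
  define W where "W = {x. 0 < x \<bullet> p \<and> x \<bullet> p < p \<bullet> p} \<inter> lift -` ball ((1/2) *\<^sub>R p) e"
  have "open W" unfolding W_def
    using continuous_lift
    by (intro open_Int open_Collect_conj open_Collect_less open_vimage continuous_intros) auto
  moreover have "(1/2) *\<^sub>R p \<in> W"
  proof -
    have "lift ((1/2) *\<^sub>R p) = (1/2) *\<^sub>R p" by (rule lift_id) (simp add: h_def)
    then show ?thesis using p e by (simp add: W_def)
  qed
  moreover have W: "W \<subseteq> slab \<inter> Cyl"
    using e(2) by (auto simp: W_def Cyl_def dist_commute h_def[symmetric])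
  ultimately have W': "open W" "W \<noteq> {}" "W \<subseteq> slab \<inter> Cyl" by auto
  have int: "integrable lborel ?f"
  proof (rule integrable_bounded_support[where B=1 and R="R0 + 2 * norm p"])
    show "norm x \<le> R0 + 2 * norm p" if "?f x \<noteq> 0" for x
    proof -
      have "x \<in> slab" "lift x \<in> V" using that by (auto simp: Cyl_def indicator_def split: if_splits)
      then show ?thesis using slab_bound[of x "(h - x \<bullet> p) / N"] by (simp add: lift_def)
    qed
  qed (auto simp: indicator_def)
  have "(LINT x|lborel. ?f x) \<noteq> 0"
  proof
    assume "(LINT x|lborel. ?f x) = 0"
    then have "AE x in lborel. ?f x = 0" using integral_nonneg_eq_0_iff_AE[OF int] by simp
    then obtain x where "x \<in> W" "?f x = 0" using AE_lborel_open_witness W' by blast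
    then show False using W'(3) by auto
  qed
  moreover have "(LINT x|lborel. ?f x) \<ge> 0" by (rule integral_nonneg_AE) auto
  ultimately have "(LINT x|lborel. ?f x) > 0" by linarith
  then show ?thesis using N_pos unfolding A_def by (rule divide_pos_pos)
qed

text \<open>Otherwise the facet would be stable under moving towards \<open>lift y\<close>.\<close>

lemma slanted_near_top: assumes "0 < \<delta>" shows "\<exists>x\<in>V. x \<notin> Cyl \<and> h - \<delta> < x \<bullet> p"
proof (rule ccontr)
  assume "\<not> ?thesis"
  then have n: "\<And>x. x \<in> V \<Longrightarrow> h - \<delta> < x \<bullet> p \<Longrightarrow> lift x \<in> V" by (auto simp: Cyl_def)
  have yV: "lift y \<notin> V" using y(2) by (simp add: lift_def h_def N_def)
  define g where "g = h - y \<bullet> p"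
  have g: "0 \<le> g" using height[OF y(1)] by (simp add: g_def h_def abs_le_iff)
  \<comment> \<open>Moving by the fraction \<open>\<theta>\<close> towards \<open>y\<close> costs
    the height \<open>\<theta> * g\<close>, which has to stay below \<open>\<delta>\<close>; the
    summand 1 guards against \<open>g = 0\<close>.\<close>
  define \<theta> where "\<theta> = min 1 (\<delta> / (g + 1))"
  have \<theta>: "0 < \<theta>" "\<theta> \<le> 1" using assms g by (auto simp: \<theta>_def)
  have "\<theta> * g \<le> \<delta> / (g + 1) * g" using g by (intro mult_right_mono) (auto simp: \<theta>_def)
  also have "\<dots> < \<delta>" using assms g by (simp add: field_simps)
  finally have \<theta>g: "\<theta> * g < \<delta>" .
  have step: "(1 - \<theta>) *\<^sub>R b + \<theta> *\<^sub>R lift y \<in> V" if "b \<in> V" "b \<bullet> p = h" for b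
  proof -
    let ?c = "(1 - \<theta>) *\<^sub>R b + \<theta> *\<^sub>R y"
    have "?c \<in> V" using convexD[OF convex_V that(1) y(1)] \<theta> by simp
    moreover have "?c \<bullet> p = h - \<theta> * g" using that by (simp add: inner_add_left g_def algebra_simps)
    ultimately have "lift ?c \<in> V" using n \<theta>g by simp
    then show ?thesis using lift_combination[of "1 - \<theta>" \<theta> b y] lift_id[OF that(2)] by simp
  qed
  have b0: "(1/2) *\<^sub>R p \<in> V" "((1/2) *\<^sub>R p) \<bullet> p = h" using facet_ball by (auto simp: h_def)
  \<comment> \<open>The closed form of repeatedly moving \<open>p / 2\<close> by the fraction
    \<open>\<theta>\<close> towards \<open>lift y\<close>; the limit \<open>lift y\<close> would
    have to lie in the closed set \<open>V\<close>.\<close>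
  define b where "b j = lift y + (1 - \<theta>) ^ j *\<^sub>R ((1/2) *\<^sub>R p - lift y)" for j :: nat
  have b: "b j \<in> V \<and> b j \<bullet> p = h" for j
  proof (induction j)
    case (Suc j)
    have "(1 - \<theta>) *\<^sub>R (u + w) + \<theta> *\<^sub>R u = u + (1 - \<theta>) *\<^sub>R w" for u w :: 'a by (simp add: algebra_simps)
    then have "b (Suc j) = (1 - \<theta>) *\<^sub>R b j + \<theta> *\<^sub>R lift y" by (simp add: b_def)
    moreover have "b (Suc j) \<bullet> p = h" using b0(2) by (simp add: b_def inner_add_left inner_diff_left)
    ultimately show ?case using step Suc by simp
  qed (use b0 in \<open>simp add: b_def\<close>)
  have "(\<lambda>j. lift y + (1 - \<theta>) ^ j *\<^sub>R ((1/2) *\<^sub>R p - lift y)) \<longlonglongrightarrow> lift y + 0 *\<^sub>R ((1/2) *\<^sub>R p - lift y)"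
    by (intro tendsto_intros LIMSEQ_power_zero) (use \<theta> in auto)
  then have "b \<longlonglongrightarrow> lift y" by (simp add: b_def[abs_def])
  then have "lift y \<in> V" using closed_sequentially[OF closed_V] b by blast
  then show False using yV by simp
qed

text \<open>A convex body with interior points is the closure of its interior. So a point near the
  top outside the prism yields an open part of \<open>V\<close> there, of positive volume, on which
  the integrand is at least \<open>exp (t * (h - \<delta>))\<close>.\<close>

lemma D_lower: assumes "0 < \<delta>" shows "\<exists>c>0. \<forall>t\<ge>1. c * exp (- (\<delta> * t)) \<le> D t"
proof -
  obtain x where x: "x \<in> V" "x \<notin> Cyl" "h - \<delta> < x \<bullet> p" using slanted_near_top[OF assms] by blast
  define U where "U = {x. h - \<delta> < x \<bullet> p} \<inter> - Cyl"
  have "open U" unfolding U_def using closed_Cyl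
    by (intro open_Int open_Collect_less continuous_intros) auto
  have "interior V \<noteq> {}"
  proof -
    obtain e where e: "e > 0" "\<And>x. dist x ((1/2) *\<^sub>R p) < e \<Longrightarrow> x \<bullet> p \<le> p \<bullet> p / 2 \<Longrightarrow> x \<in> V"
      using facet_ball by blast
    let ?W = "ball ((1/2) *\<^sub>R p) e \<inter> {x. x \<bullet> p < p \<bullet> p / 2}"
    have "open ?W" by (intro open_Int open_Collect_less continuous_intros) auto
    moreover have "?W \<subseteq> V" using e by (auto simp: dist_commute)
    moreover have "?W \<noteq> {}"
    proof -
      define r where "r = e / (2 * norm p)"
      have "dist ((1/2) *\<^sub>R p) ((1/2 - r) *\<^sub>R p) < e" "(1/2 - r) * (p \<bullet> p) < p \<bullet> p / 2"
        using e p by (auto simp: dist_norm r_def simp flip: scaleR_diff_left)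
      then have "(1/2 - r) *\<^sub>R p \<in> ?W" by simp
      then show ?thesis by blast
    qed
    ultimately show ?thesis using interior_maximal by blast
  qed
  then have "x \<in> closure (interior V)"
    using x(1) convex_closure_interior[OF convex_V] closure_subset by auto
  moreover have "x \<in> U" using x by (simp add: U_def)
  ultimately have ne: "U \<inter> interior V \<noteq> {}" using \<open>open U\<close> open_Int_closure_eq_empty[of U "interior V"] by blast
  define Q where "Q = U \<inter> interior V"
  have Q: "open Q" "Q \<noteq> {}" "Q \<subseteq> V" "Q \<inter> Cyl = {}" "\<And>x. x \<in> Q \<Longrightarrow> h - \<delta> < x \<bullet> p"
    using \<open>open U\<close> ne interior_subset by (auto simp: Q_def U_def)
  have [measurable]: "Q \<in> sets borel" using Q by simp
  have bd: "bounded Q" using Q compact_imp_bounded[OF compact_V] bounded_subset by blast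
  have fm: "emeasure lborel Q < \<infinity>" using emeasure_bounded_finite[OF bd] by simp
  have pos: "0 < measure lborel Q"
  proof -
    have "Q \<notin> null_sets lborel" using open_not_negligible[OF Q(1,2)]
      by (auto simp: negligible_iff_null_sets null_sets_completionI)
    then have "emeasure lborel Q \<noteq> 0" by auto
    then show ?thesis using fm by (simp add: measure_def enn2real_positive_iff zero_less_iff_neq_zero)
  qed
  have "measure lborel Q * exp (- (\<delta> * t)) \<le> D t" if t: "t \<ge> 1" for t
  proof -
    let ?G = "\<lambda>x. indicator V x * (1 - indicator Cyl x) * exp (t * (x \<bullet> p)) :: real"
    have "measure lborel Q * exp (t * (h - \<delta>)) = (LINT x|lborel. indicator Q x * exp (t * (h - \<delta>)))"
      by simp
    also have "\<dots> \<le> (LINT x|lborel. ?G x)"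
    proof (rule integral_mono)
      show "integrable lborel (\<lambda>x. indicator Q x * exp (t * (h - \<delta>)))" using fm by simp
      show "integrable lborel ?G" using t by (intro integrable_V) (auto simp: indicator_def)
      fix x
      show "indicator Q x * exp (t * (h - \<delta>)) \<le> ?G x"
      proof (cases "x \<in> Q")
        case True
        then have "x \<in> V" "x \<notin> Cyl" using Q(3,4) by blast+
        moreover have "t * (h - \<delta>) \<le> t * (x \<bullet> p)" using Q(5)[OF True] t by simp
        ultimately show ?thesis using True by simp
      qed (auto simp: indicator_def)
    qed
    finally have 1: "measure lborel Q * exp (t * (h - \<delta>)) \<le> (LINT x|lborel. ?G x)" .
    have "measure lborel Q * exp (- (\<delta> * t)) = exp (- (t * h)) * (measure lborel Q * exp (t * (h - \<delta>)))"
      by (simp add: algebra_simps flip: exp_add)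
    also have "\<dots> \<le> exp (- (t * h)) * (LINT x|lborel. ?G x)" using 1 by (intro mult_left_mono) auto
    also have "\<dots> \<le> t * (exp (- (t * h)) * (LINT x|lborel. ?G x))"
    proof -
      have "0 \<le> (LINT x|lborel. ?G x)" by (rule integral_nonneg_AE) (auto simp: indicator_def)
      then show ?thesis using t mult_right_mono[of 1 t "exp (- (t * h)) * (LINT x|lborel. ?G x)"] by simp
    qed
    finally show ?thesis by (simp add: D_def mult.assoc)
  qed
  then show ?thesis using pos by blast
qed

text \<open>Dominated convergence over the slab. On a line off the prism \<open>V\<close> ends
  strictly below the top, so the line integral decays exponentially, with a rate that depends on the
  line; the full line integral supplies the common bound \<open>1 / N\<close>.\<close>

lemma D_tendsto_0: "(D \<longlongrightarrow> 0) at_top"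
proof -
  have [measurable]: "slab \<in> sets borel" by measurable
  let ?G = "\<lambda>t x. indicator V x * (1 - indicator Cyl x) * exp (t * (x \<bullet> p)) :: real"
  define J where "J t x = indicator slab x * (t * exp (- (t * h)) * (LINT l|lborel. ?G t (x + l *\<^sub>R p)))" for t x
  have D: "D t = (LINT x|lborel. J t x)" if t: "t > 0" for t
  proof -
    have "(LINT x|lborel. ?G t x) = (LINT x|lborel. indicator slab x * (LINT l|lborel. ?G t (x + l *\<^sub>R p)))"
    proof (rule slab_fubini[where B="exp (t * h)" and R=R0])
      show "?G t \<in> borel_measurable borel" by measurable
      show "\<bar>?G t x\<bar> \<le> exp (t * h)" for x
        using exp_bound[of x t] t by (auto simp: indicator_def)
    qed (use R0 p in \<open>auto simp: indicator_def split: if_splits\<close>)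
    then have "D t = (LINT x|lborel. t * exp (- (t * h)) * (indicator slab x * (LINT l|lborel. ?G t (x + l *\<^sub>R p))))"
      by (simp add: D_def)
    then show ?thesis by (simp add: J_def mult_ac)
  qed
  have J0: "0 \<le> J t x" if "t > 0" for t x
    unfolding J_def using that by (intro mult_nonneg_nonneg integral_nonneg_AE) (auto simp: indicator_def)
  have inner_le: "(LINT l|lborel. ?G t (x + l *\<^sub>R p)) \<le> (LINT l|lborel. indicator {-h..h} (x \<bullet> p + N * l) * H (x \<bullet> p + N * l))"
    if "\<And>z. z \<in> V \<Longrightarrow> z \<notin> Cyl \<Longrightarrow> lift z = lift x \<Longrightarrow> exp (t * (z \<bullet> p)) \<le> H (z \<bullet> p)" "\<And>z. 0 \<le> H z"
      "integrable lborel (\<lambda>l. indicator {-h..h} (x \<bullet> p + N * l) * H (x \<bullet> p + N * l))" for t x and H :: "real \<Rightarrow> real"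
  proof (rule Bochner_Integration.integral_mono_AE'[OF that(3)])
    have ip: "(x + l *\<^sub>R p) \<bullet> p = x \<bullet> p + N * l" for l by (simp add: inner_add_left N_def)
    have "?G t (x + l *\<^sub>R p) \<le> indicator {-h..h} (x \<bullet> p + N * l) * H (x \<bullet> p + N * l)" for l
    proof (cases "x + l *\<^sub>R p \<in> V \<and> x + l *\<^sub>R p \<notin> Cyl")
      case True
      then have "\<bar>x \<bullet> p + N * l\<bar> \<le> h" using height[of "x + l *\<^sub>R p"] by (simp add: ip h_def)
      then show ?thesis using True that(1)[of "x + l *\<^sub>R p"]
        by (auto simp: ip indicator_def abs_le_iff)
    qed (use that(2) in \<open>auto simp: indicator_def\<close>)
    then show "AE l in lborel. ?G t (x + l *\<^sub>R p) \<le> indicator {-h..h} (x \<bullet> p + N * l) * H (x \<bullet> p + N * l)" by simp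
    show "AE l in lborel. 0 \<le> indicator {-h..h} (x \<bullet> p + N * l) * H (x \<bullet> p + N * l)"
      using that(2) by (simp add: indicator_def)
  qed
  have int_line: "integrable lborel (\<lambda>l. indicator {-h..h} (b + N * l) * H (b + N * l))"
    if [measurable]: "H \<in> borel_measurable borel" and "\<And>z. \<bar>z\<bar> \<le> h \<Longrightarrow> \<bar>H z\<bar> \<le> M" for b M and H :: "real \<Rightarrow> real"
  proof (rule integrable_bounded_support[where B="\<bar>M\<bar>" and R="(h + \<bar>b\<bar>) / N"])
    show "norm (indicator {- h..h} (b + N * l) * H (b + N * l)) \<le> \<bar>M\<bar>" for l
      using that(2)[of "b + N * l"] by (auto simp: indicator_def abs_le_iff)
    fix l assume "indicator {- h..h} (b + N * l) * H (b + N * l) \<noteq> 0"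
    then have "\<bar>b + N * l\<bar> \<le> h" by (auto simp: indicator_def abs_le_iff split: if_splits)
    then have "\<bar>N * l\<bar> \<le> h + \<bar>b\<bar>" by linarith
    then show "norm l \<le> (h + \<bar>b\<bar>) / N" using N_pos by (simp add: field_simps abs_mult)
  qed measurable
  have bound: "J t x \<le> indicator (cball 0 (R0 + 2 * norm p)) x / N" if t: "t > 0" for t x
  proof (cases "x \<in> slab \<and> (\<exists>l. x + l *\<^sub>R p \<in> V)")
    case True
    then have x: "x \<in> cball 0 (R0 + 2 * norm p)" using slab_bound by auto
    have "(LINT l|lborel. ?G t (x + l *\<^sub>R p)) \<le> (exp (t * h) - exp (- (t * h))) / (N * t)"
    proof (subst integral_exp_line[symmetric, of h t N "x \<bullet> p"])
      have "\<bar>exp (t * z)\<bar> \<le> exp (t * h)" if "\<bar>z\<bar> \<le> h" for z using that t by (simp add: mult_left_mono)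
      then show "(LINT l|lborel. ?G t (x + l *\<^sub>R p)) \<le> (LINT l|lborel. indicator {-h..h} (x \<bullet> p + N * l) * exp (t * (x \<bullet> p + N * l)))"
        by (intro inner_le[where H="\<lambda>z. exp (t * z)"] int_line[where H="\<lambda>z. exp (t * z)"]) auto
    qed (use t h_pos N_pos in auto)
    also have "\<dots> \<le> exp (t * h) / (N * t)" using t N_pos by (intro divide_right_mono) auto
    finally have "t * exp (- (t * h)) * (LINT l|lborel. ?G t (x + l *\<^sub>R p)) \<le> t * exp (- (t * h)) * (exp (t * h) / (N * t))"
      using t by (intro mult_left_mono) auto
    also have "\<dots> = 1 / N" using t by (simp add: exp_minus field_simps)
    finally show ?thesis using x True by (simp add: J_def)
  next
    case False
    then have "J t x = 0" by (auto simp: J_def indicator_def)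
    then show ?thesis using N_pos by simp
  qed
  have pointwise: "((\<lambda>t. J t x) \<longlongrightarrow> 0) at_top" for x
  proof (cases "x \<in> Cyl")
    case True
    then have "x + l *\<^sub>R p \<in> Cyl" for l by (simp add: Cyl_def)
    then show ?thesis by (simp add: J_def)
  next
    case False
    define Q where "Q = V \<inter> {z. lift z = lift x}"
    have "closed {z. lift z = lift x}"
      by (intro closed_Collect_eq continuous_lift continuous_intros)
    then have "compact Q" unfolding Q_def using compact_V by (rule compact_Int_closed[rotated])
    \<comment> \<open>\<open>Q\<close> is the part of \<open>V\<close> on the line through
      \<open>x\<close>. By compactness its height is attained, and it is not \<open>h\<close>, since
      the top point of the line is outside \<open>V\<close>.\<close>
    have "\<exists>\<eta>>0. \<forall>z\<in>Q. z \<bullet> p \<le> h - \<eta>"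
    proof (cases "Q = {}")
      case False
      have "continuous_on Q (\<lambda>z. z \<bullet> p)" by (intro continuous_intros)
      then obtain w where w: "w \<in> Q" "\<And>z. z \<in> Q \<Longrightarrow> z \<bullet> p \<le> w \<bullet> p"
        using continuous_attains_sup[OF \<open>compact Q\<close> False, of "\<lambda>z. z \<bullet> p"] by blast
      have "w \<bullet> p \<noteq> h"
      proof
        assume "w \<bullet> p = h"
        then have "lift w = w" by (rule lift_id)
        then have "lift x \<in> V" using w(1) unfolding Q_def by force
        then show False using \<open>x \<notin> Cyl\<close> by (simp add: Cyl_def)
      qed
      moreover have "w \<bullet> p \<le> h" using height[of w] w by (simp add: Q_def h_def abs_le_iff)
      ultimately show ?thesis using w by (intro exI[of _ "h - w \<bullet> p"]) auto
    qed (auto intro: exI[of _ 1])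
    then obtain \<eta> where \<eta>: "\<eta> > 0" "\<And>z. z \<in> Q \<Longrightarrow> z \<bullet> p \<le> h - \<eta>" by blast
    have upper: "J t x \<le> t * exp (- (\<eta> * t))" if t: "t > 0" for t
    proof -
      have "(LINT l|lborel. ?G t (x + l *\<^sub>R p)) \<le> (LINT l|lborel. indicator {-h..h} (x \<bullet> p + N * l) * exp (t * (h - \<eta>)))"
        using \<eta>(2) t by (intro inner_le[where H="\<lambda>_. exp (t * (h - \<eta>))"] int_line[where H="\<lambda>_. exp (t * (h - \<eta>))" and M="exp (t * (h - \<eta>))"])
          (auto simp: Q_def)
      also have "\<dots> = (LINT l|lborel. indicator {-h..h} (x \<bullet> p + N * l)) * exp (t * (h - \<eta>))" by simp
      also have "(LINT l|lborel. indicator {-h..h} (x \<bullet> p + N * l)) = (1::real)"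
      proof -
        have "(LINT z|lborel. indicator {-h..h} z :: real) = N * (LINT l|lborel. indicator {-h..h} (x \<bullet> p + N * l))"
          using lborel_integral_real_affine[of N "indicator {-h..h} :: real \<Rightarrow> real" "x \<bullet> p"] N_pos by simp
        then show ?thesis using N_pos N_h h_pos by simp
      qed
      finally have "(LINT l|lborel. ?G t (x + l *\<^sub>R p)) \<le> exp (t * (h - \<eta>))" by simp
      then have "t * exp (- (t * h)) * (LINT l|lborel. ?G t (x + l *\<^sub>R p)) \<le> t * exp (- (t * h)) * exp (t * (h - \<eta>))"
        using t by (intro mult_left_mono) auto
      also have "\<dots> = t * exp (- (\<eta> * t))" by (simp add: algebra_simps flip: exp_add)
      finally show ?thesis using t by (auto simp: J_def indicator_def)
    qed
    have lim: "((\<lambda>t. t * exp (- (\<eta> * t))) \<longlongrightarrow> 0) at_top" 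
    proof -
      have "filterlim (\<lambda>t. \<eta> * t) at_top at_top"
        using \<eta>(1) by (intro filterlim_tendsto_pos_mult_at_top[OF tendsto_const] filterlim_ident)
      then have "((\<lambda>t. (\<eta> * t) ^ 1 / exp (\<eta> * t)) \<longlongrightarrow> 0) at_top"
        by (rule filterlim_compose[OF tendsto_power_div_exp_0])
      from tendsto_mult_left[OF this, of "1 / \<eta>"] show ?thesis
        using \<eta>(1) by (simp add: exp_minus field_simps)
    qed
    show ?thesis
    proof (rule tendsto_sandwich[OF _ _ tendsto_const lim])
      show "eventually (\<lambda>t. 0 \<le> J t x) at_top" using eventually_gt_at_top[of 0] by eventually_elim (rule J0)
      show "eventually (\<lambda>t. J t x \<le> t * exp (- (\<eta> * t))) at_top" using eventually_gt_at_top[of 0] by eventually_elim (rule upper)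
    qed
  qed
  have "((\<lambda>t. LINT x|lborel. J t x) \<longlongrightarrow> (LINT (x::'a)|lborel. (0::real))) at_top"
  proof (rule integral_dominated_convergence_at_top[where s=J and f="\<lambda>_. 0" and M=lborel and w="\<lambda>x. indicator (cball 0 (R0 + 2 * norm p)) x / N"])
    show "J t \<in> borel_measurable lborel" for t
      unfolding J_def[abs_def] by measurable
    show "integrable lborel (\<lambda>x::'a. indicator (cball 0 (R0 + 2 * norm p)) x / N :: real)"
      using emeasure_lborel_cball_finite[of "0::'a" "R0 + 2 * norm p"]
      by (intro integrable_divide integrable_real_indicator) simp_all
    show "eventually (\<lambda>t. AE x in lborel. norm (J t x) \<le> indicator (cball 0 (R0 + 2 * norm p)) x / N) at_top"
      using eventually_gt_at_top[of 0] by eventually_elim (use J0 bound in auto)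
  qed (use pointwise in simp_all)
  then have "((\<lambda>t. LINT x|lborel. J t x) \<longlongrightarrow> 0) at_top" by simp
  then show ?thesis
  proof (rule Lim_transform_eventually)
    show "eventually (\<lambda>t. (LINT x|lborel. J t x) = D t) at_top"
      using eventually_gt_at_top[of 0] by eventually_elim (use D in simp)
  qed
qed

end

text \<open>Passing from \<open>F\<close> to the normalized \<open>q\<close> costs a factor
  \<open>s ^ k\<close> from the powers of \<open>t\<close> and shifts all exponents by
  \<open>real k * h * (1 - s)\<close>; the relation keeps its shape.\<close>

lemma (in capped_body) no_scaling_relation:
  assumes s: "0 < s" "s < 1" and k: "1 \<le> k" and \<sigma>: "0 < \<sigma>" and Z: "finite Z"
    and rel: "\<And>t. t > 0 \<Longrightarrow> (exp (- (\<sigma> * t)) - 1) ^ n * F t ^ k = c * F (s * t) ^ k * (\<Sum>z\<in>Z. g z * exp (t * \<mu> z))"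
  shows False
proof -
  define q where "q t = t * exp (- (t * h)) * F t" for t
  show False
  proof (rule scaling_relation_contradiction[OF s A_pos h_pos k \<sigma> Z _ D_tendsto_0 D_lower])
    show "q t = A * (1 - exp (- (2 * h * t))) + D t" if "t > 0" for t
      using F_split[OF that] by (simp add: q_def)
    show "(exp (- (\<sigma> * t)) - 1) ^ n * q t ^ k
        = q (s * t) ^ k * (\<Sum>z\<in>Z. (c * g z / s ^ k) * exp (t * (\<mu> z - real k * h * (1 - s))))" if t: "t > 0" for t
    proof -
      define E where "E = exp (- (t * h))"
      have e: "exp (t * (\<mu> z - real k * h * (1 - s))) * exp (- (s * t * h)) ^ k = E ^ k * exp (t * \<mu> z)" for z
        unfolding E_def by (simp add: algebra_simps flip: exp_add exp_of_nat_mult)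
      have "q (s * t) ^ k * (\<Sum>z\<in>Z. (c * g z / s ^ k) * exp (t * (\<mu> z - real k * h * (1 - s))))
          = (\<Sum>z\<in>Z. (t ^ k * c * F (s * t) ^ k) * (g z * (exp (t * (\<mu> z - real k * h * (1 - s))) * exp (- (s * t * h)) ^ k)))"
        using s by (simp add: q_def power_mult_distrib sum_distrib_left mult_ac)
      also have "\<dots> = t ^ k * E ^ k * (c * F (s * t) ^ k * (\<Sum>z\<in>Z. g z * exp (t * \<mu> z)))"
        unfolding e by (simp add: sum_distrib_left mult_ac)
      also have "\<dots> = t ^ k * E ^ k * ((exp (- (\<sigma> * t)) - 1) ^ n * F t ^ k)"
        using rel[OF t] by simp
      also have "\<dots> = (exp (- (\<sigma> * t)) - 1) ^ n * q t ^ k"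
        by (simp add: q_def E_def power_mult_distrib mult_ac)
      finally show ?thesis by simp
    qed
  qed
qed

lemma aff_dim_hyperplane_int:
  fixes a :: "'a::euclidean_space"
  assumes "a \<noteq> 0" shows "aff_dim {x. a \<bullet> x = b} = int DIM('a) - 1"
  using aff_dim_hyperplane[OF assms, of b] by (simp only: of_nat_diff[OF DIM_ge_Suc0[unfolded One_nat_def[symmetric]]] of_nat_1)

section \<open>Voronoi cells and efficient families\<close>

text \<open>\<open>relevant\<close> says that \<open>p / 2\<close> is nearer to 0 and
  \<open>p\<close> than to any other lattice point, so \<open>p / 2\<close> is a relative interior
  point of a facet; \<open>half_r\<close> says that \<open>r / 2\<close> lies in the cell of the
  origin. \<open>skew\<close> makes \<open>r\<close> neither orthogonal to \<open>p\<close> nor of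
  full height over the facet.\<close>

locale root_like_lattice =
  fixes L :: "'a::euclidean_space set" and p r :: 'a
  assumes zero: "0 \<in> L" and diff: "\<And>x y. x \<in> L \<Longrightarrow> y \<in> L \<Longrightarrow> x - y \<in> L"
    and separated: "\<exists>m>0. \<forall>x\<in>L. x \<noteq> 0 \<longrightarrow> m \<le> norm x" and spanning: "span L = UNIV"
    and p_L: "p \<in> L" and p_nz: "p \<noteq> 0" and r: "r \<in> L"
    and relevant: "\<And>q. q \<in> L \<Longrightarrow> q \<noteq> 0 \<Longrightarrow> q \<noteq> p \<Longrightarrow> q \<bullet> p < q \<bullet> q"
    and half_r: "\<And>q. q \<in> L \<Longrightarrow> q \<bullet> r \<le> q \<bullet> q"
    and skew: "0 < r \<bullet> p" "r \<bullet> p < p \<bullet> p"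
begin

lemma minus: "x \<in> L \<Longrightarrow> - x \<in> L" using diff[OF zero] by simp
lemma add: "x \<in> L \<Longrightarrow> y \<in> L \<Longrightarrow> x + y \<in> L" using diff[OF _ minus] by force

definition V :: "'a set" where "V = voronoi_cell L 0"

lemma V_iff: "x \<in> V \<longleftrightarrow> (\<forall>q\<in>L. x \<bullet> q \<le> q \<bullet> q / 2)"
proof -
  have "dist x 0 \<le> dist x q \<longleftrightarrow> x \<bullet> q \<le> q \<bullet> q / 2" for q
  proof -
    have "dist x 0 \<le> dist x q \<longleftrightarrow> (dist x 0)\<^sup>2 \<le> (dist x q)\<^sup>2" by (simp add: abs_le_square_iff[symmetric])
    also have "\<dots> \<longleftrightarrow> x \<bullet> q \<le> q \<bullet> q / 2"
      by (auto simp: dist_norm power2_norm_eq_inner inner_diff_left inner_diff_right inner_commute)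
    finally show ?thesis .
  qed
  then show ?thesis by (simp add: V_def voronoi_cell_def)
qed

lemma voronoi_cell_eq: assumes "q \<in> L" shows "voronoi_cell L q = (+) q ` V"
proof -
  have "x \<in> voronoi_cell L q \<longleftrightarrow> x - q \<in> V" for x
  proof
    assume x: "x \<in> voronoi_cell L q"
    have "dist (x - q) 0 \<le> dist (x - q) q'" if "q' \<in> L" for q'
      using x add[OF assms that] by (auto simp: voronoi_cell_def dist_norm algebra_simps)
    then show "x - q \<in> V" by (simp add: V_def voronoi_cell_def)
  next
    assume x: "x - q \<in> V"
    have "dist x q \<le> dist x q'" if "q' \<in> L" for q'
      using x diff[OF that assms] by (auto simp: V_def voronoi_cell_def dist_norm algebra_simps dest!: bspec[of _ _ "q' - q"])
    then show "x \<in> voronoi_cell L q" by (simp add: voronoi_cell_def)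
  qed
  then show ?thesis by (force simp: image_iff)
qed

lemma locally_finite_L: "locally_finite_set L"
  unfolding locally_finite_set_def
proof (intro allI)
  fix x :: 'a and R
  obtain m where m: "m > 0" "\<And>x. x \<in> L \<Longrightarrow> x \<noteq> 0 \<Longrightarrow> m \<le> norm x" using separated by blast
  show "finite (L \<inter> cball x R)"
  proof (rule finite_separated[OF _ m(1)])
    show "bounded (L \<inter> cball x R)" by (rule bounded_subset[OF bounded_cball]) blast
    show "m \<le> dist y z" if "y \<in> L \<inter> cball x R" "z \<in> L \<inter> cball x R" "y \<noteq> z" for y z
      using m(2)[of "y - z"] diff that by (auto simp: dist_norm)
  qed
qed

lemma V_zero: "0 \<in> V" by (simp add: V_iff)

lemma V_minus: "x \<in> V \<Longrightarrow> - x \<in> V"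
  using minus by (force simp: V_iff)

lemma closed_V: "closed V"
proof -
  have "V = (\<Inter>q\<in>L. {x. x \<bullet> q \<le> q \<bullet> q / 2})" by (auto simp: V_iff)
  then show ?thesis by (auto intro!: closed_INT closed_Collect_le continuous_intros)
qed

lemma convex_V: "convex V"
proof -
  have *: "V = (\<Inter>q\<in>L. {x. q \<bullet> x \<le> q \<bullet> q / 2})" by (auto simp: V_iff inner_commute)
  show ?thesis unfolding * by (intro convex_INT convex_halfspace_le)
qed

text \<open>\<open>L\<close> contains a basis \<open>K\<close>; the inequalities for its vectors and
  their negatives bound every linear functional on \<open>V\<close>.\<close>

lemma bounded_V: "bounded V"
proof -
  obtain K where K: "K \<subseteq> L" "independent K" "L \<subseteq> span K"
    using maximal_independent_subset[of L] by blast
  have fin: "finite K" using K(2) by (rule independent_imp_finite)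
  have spK: "span K = UNIV" using K spanning span_mono[OF K(3)] by (simp add: span_span top_le)
  have "\<exists>M. \<forall>x\<in>V. \<bar>x \<bullet> i\<bar> \<le> M" for i
  proof -
    have "i \<in> span K" using spK by simp
    then obtain u where u: "i = (\<Sum>b\<in>K. u b *\<^sub>R b)" using span_finite[OF fin] by auto
    have "\<bar>x \<bullet> i\<bar> \<le> (\<Sum>b\<in>K. \<bar>u b\<bar> * (b \<bullet> b / 2))" if x: "x \<in> V" for x
    proof -
      have b: "\<bar>x \<bullet> b\<bar> \<le> b \<bullet> b / 2" if "b \<in> K" for b
      proof -
        have "x \<bullet> b \<le> b \<bullet> b / 2" "(- x) \<bullet> b \<le> b \<bullet> b / 2"
          using x V_minus[OF x] K(1) that unfolding V_iff by blast+
        then show ?thesis unfolding inner_minus_left by linarith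
      qed
      have "\<bar>x \<bullet> i\<bar> \<le> (\<Sum>b\<in>K. \<bar>u b * (x \<bullet> b)\<bar>)" unfolding u by (simp add: inner_sum_right)
      also have "\<dots> \<le> (\<Sum>b\<in>K. \<bar>u b\<bar> * (b \<bullet> b / 2))"
        unfolding abs_mult using b by (intro sum_mono mult_left_mono) auto
      finally show ?thesis .
    qed
    then show ?thesis by blast
  qed
  then obtain M where M: "\<And>i x. x \<in> V \<Longrightarrow> \<bar>x \<bullet> i\<bar> \<le> M i" by metis
  have "norm x \<le> (\<Sum>i\<in>Basis. M i)" if "x \<in> V" for x
    using norm_le_l1[of x] sum_mono[of Basis "\<lambda>i. \<bar>x \<bullet> i\<bar>" M] M[OF that] by simp
  then show ?thesis by (auto simp: bounded_iff)
qed

lemma compact_V: "compact V" using bounded_V closed_V by (simp add: compact_eq_bounded_closed)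

text \<open>One radius serves infinitely many inequalities: for lattice vectors longer than
  \<open>2 * (norm x + 1)\<close> they follow from Cauchy-Schwarz, and finitely many others
  remain.\<close>

lemma strict_near: "\<exists>e>0. \<forall>y. dist y x < e \<longrightarrow> (\<forall>q\<in>L. x \<bullet> q < q \<bullet> q / 2 \<longrightarrow> y \<bullet> q < q \<bullet> q / 2)"
proof -
  define Q where "Q = {q \<in> L \<inter> cball 0 (2 * (norm x + 1)). x \<bullet> q < q \<bullet> q / 2}"
  have fin: "finite Q"
    by (rule finite_subset[of _ "L \<inter> cball 0 (2 * (norm x + 1))"])
       (use locally_finite_L in \<open>auto simp: Q_def locally_finite_set_def\<close>)
  have "eventually (\<lambda>y. \<forall>q\<in>Q. y \<bullet> q < q \<bullet> q / 2) (nhds x)"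
  proof (rule eventually_ball_finite[OF fin], intro ballI)
    fix q assume "q \<in> Q"
    moreover have "open {y. y \<bullet> q < q \<bullet> q / 2}" by (intro open_Collect_less continuous_intros)
    ultimately show "eventually (\<lambda>y. y \<bullet> q < q \<bullet> q / 2) (nhds x)"
      using eventually_nhds_in_open[of "{y. y \<bullet> q < q \<bullet> q / 2}" x] by (simp add: Q_def)
  qed
  then obtain d where d: "d > 0" "\<And>y q. dist y x < d \<Longrightarrow> q \<in> Q \<Longrightarrow> y \<bullet> q < q \<bullet> q / 2"
    unfolding eventually_nhds_metric by blast
  show ?thesis
  proof (intro exI[of _ "min d 1"] conjI allI impI ballI)
    fix y q assume y: "dist y x < min d 1" and q: "q \<in> L" "x \<bullet> q < q \<bullet> q / 2"
    show "y \<bullet> q < q \<bullet> q / 2"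
    proof (cases "q \<in> Q")
      case False
      then have n: "norm q > 2 * (norm x + 1)" using q by (simp add: Q_def)
      have "norm y < norm x + 1" using y norm_triangle_ineq2[of y x] by (simp add: dist_norm)
      then have "norm y * norm q < norm q * norm q / 2"
      proof -
        have "norm y < norm q / 2" using n \<open>norm y < norm x + 1\<close> by auto
        moreover have "0 < norm q" using \<open>norm y < norm q / 2\<close> norm_ge_zero[of y] by linarith
        ultimately
        show ?thesis using mult_strict_right_mono[of "norm y" "norm q / 2" "norm q"] by simp
      qed
      then show ?thesis using norm_cauchy_schwarz[of y q] by (simp add: norm_eq_sqrt_inner)
    qed (use d y in auto)
  qed (use d in auto)
qed

lemma near_facet_center:
  "\<exists>e>0. \<forall>x. dist x ((1/2) *\<^sub>R p) < e \<longrightarrow> (\<forall>q\<in>L. q \<noteq> 0 \<longrightarrow> q \<noteq> p \<longrightarrow> x \<bullet> q < q \<bullet> q / 2)"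
proof -
  obtain e where e: "e > 0" "\<And>x q. dist x ((1/2) *\<^sub>R p) < e \<Longrightarrow> q \<in> L \<Longrightarrow> ((1/2) *\<^sub>R p) \<bullet> q < q \<bullet> q / 2 \<Longrightarrow> x \<bullet> q < q \<bullet> q / 2"
    using strict_near[of "(1/2) *\<^sub>R p"] by blast
  have "((1/2) *\<^sub>R p) \<bullet> q < q \<bullet> q / 2" if "q \<in> L" "q \<noteq> 0" "q \<noteq> p" for q
    using relevant[OF that] by (simp add: inner_commute)
  then show ?thesis using e by blast
qed

sublocale capped_body V p "(1/2) *\<^sub>R r"
proof
  show "compact V" "convex V" "p \<noteq> 0" by (fact compact_V convex_V p_nz)+
  show "\<bar>x \<bullet> p\<bar> \<le> p \<bullet> p / 2" if "x \<in> V" for x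
    using that V_minus[OF that] p_L unfolding V_iff by (force simp: abs_le_iff)
  show "x - p \<in> V" if x: "x \<in> V" "x \<bullet> p = p \<bullet> p / 2" for x
    unfolding V_iff
  proof
    fix q assume "q \<in> L"
    \<comment> \<open>The inequality of \<open>x\<close> for \<open>q + p\<close>, less the tight
      one for \<open>p\<close>, is the inequality of \<open>x - p\<close> for
      \<open>q\<close>.\<close>
    then have "x \<bullet> (q + p) \<le> (q + p) \<bullet> (q + p) / 2" using x(1) add p_L unfolding V_iff by blast
    moreover have "x \<bullet> (q + p) = x \<bullet> q + x \<bullet> p" "(q + p) \<bullet> (q + p) = q \<bullet> q + 2 * (p \<bullet> q) + p \<bullet> p"
      by (simp_all add: inner_add_left inner_add_right inner_commute)
    ultimately show "(x - p) \<bullet> q \<le> q \<bullet> q / 2"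
      using x(2) unfolding inner_diff_left by linarith
  qed
  obtain e where e: "e > 0" "\<And>x q. dist x ((1/2) *\<^sub>R p) < e \<Longrightarrow> q \<in> L \<Longrightarrow> q \<noteq> 0 \<Longrightarrow> q \<noteq> p \<Longrightarrow> x \<bullet> q < q \<bullet> q / 2"
    using near_facet_center by blast
  have "x \<in> V" if "dist x ((1/2) *\<^sub>R p) < e" "x \<bullet> p \<le> p \<bullet> p / 2" for x
    unfolding V_iff
  proof
    fix q assume "q \<in> L"
    then show "x \<bullet> q \<le> q \<bullet> q / 2" using e(2)[OF that(1), of q] that(2) by (cases "q = 0 \<or> q = p") auto
  qed
  then show "\<exists>e>0. \<forall>x. dist x ((1/2) *\<^sub>R p) < e \<longrightarrow> x \<bullet> p \<le> p \<bullet> p / 2 \<longrightarrow> x \<in> V" using e(1) by blast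
  show "(1/2) *\<^sub>R r \<in> V"
    unfolding V_iff using half_r by (auto simp: inner_commute)
  show "(1/2) *\<^sub>R r + ((p \<bullet> p / 2 - ((1/2) *\<^sub>R r) \<bullet> p) / (p \<bullet> p)) *\<^sub>R p \<notin> V"
  proof
    \<comment> \<open>\<open>r / 2\<close> is already tight for the inequality of \<open>r\<close>,
      and \<open>p\<close> has positive inner product with \<open>r\<close>, so any positive move
      along \<open>p\<close> leaves \<open>V\<close>.\<close>
    define l where "l = (p \<bullet> p / 2 - ((1/2) *\<^sub>R r) \<bullet> p) / (p \<bullet> p)"
    have "0 < l" using skew by (auto simp: l_def intro!: divide_pos_pos)
    assume "(1/2) *\<^sub>R r + ((p \<bullet> p / 2 - ((1/2) *\<^sub>R r) \<bullet> p) / (p \<bullet> p)) *\<^sub>R p \<in> V"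
    then have "((1/2) *\<^sub>R r + l *\<^sub>R p) \<bullet> r \<le> r \<bullet> r / 2" using r unfolding V_iff l_def by blast
    then have "l * (p \<bullet> r) \<le> 0" by (simp add: inner_add_left)
    moreover have "0 < l * (p \<bullet> r)" using \<open>0 < l\<close> skew by (simp add: inner_commute)
    ultimately show False by simp
  qed
qed

section \<open>Facets of the Voronoi cell\<close>

text \<open>The part of the cell on the bisector of 0 and \<open>q\<close>. It is always a face,
  possibly empty or of small dimension; only its dimension decides whether it is a facet.\<close>

definition Fac :: "'a \<Rightarrow> 'a set" where "Fac q = V \<inter> {x. q \<bullet> x = q \<bullet> q / 2}"

lemma Fac_face: "q \<in> L \<Longrightarrow> Fac q face_of V"
  unfolding Fac_def by (rule face_of_Int_supporting_hyperplane_le[OF convex_V]) (auto simp: V_iff inner_commute)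

lemma Fac_p_shift: "Fac (- p) = (\<lambda>x. x - p) ` Fac p"
proof -
  have "x - p \<in> Fac (- p)" if "x \<in> Fac p" for x
    using that opposite[of x] by (auto simp: Fac_def inner_diff_right inner_commute)
  moreover have "x + p \<in> Fac p" if "x \<in> Fac (- p)" for x
  proof -
    have "- x \<in> V" "(- x) \<bullet> p = p \<bullet> p / 2" using that V_minus by (auto simp: Fac_def inner_commute)
    then have "- (- x - p) \<in> V" using opposite V_minus by blast
    then show ?thesis using that by (auto simp: Fac_def inner_add_right inner_commute add.commute)
  qed
  ultimately show ?thesis by force
qed

lemma interior_V_nonempty: "interior V \<noteq> {}"
proof -
  obtain e where e: "e > 0" "\<And>(x :: 'a) q. dist x 0 < e \<Longrightarrow> q \<in> L \<Longrightarrow> 0 < q \<bullet> q / 2 \<Longrightarrow> x \<bullet> q < q \<bullet> q / 2"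
    using strict_near[of 0] by auto
  have "ball 0 e \<subseteq> V"
  proof
    fix x :: 'a assume "x \<in> ball 0 e"
    then have "x \<bullet> q \<le> q \<bullet> q / 2" if "q \<in> L" for q using e(2)[of x q] that by (cases "q = 0") (auto simp: less_imp_le)
    then show "x \<in> V" by (simp add: V_iff)
  qed
  then have "ball 0 e \<subseteq> interior V" by (simp add: interior_maximal)
  then show ?thesis using e(1) by auto
qed

lemma aff_dim_V: "aff_dim V = int DIM('a)"
  using aff_dim_nonempty_interior[OF interior_V_nonempty] .

lemma Fac_facet: assumes "q \<in> L" "q \<noteq> 0" "aff_dim (Fac q) \<ge> int DIM('a) - 1" shows "Fac q facet_of V"
proof -
  have "aff_dim (Fac q) \<le> aff_dim {x. q \<bullet> x = q \<bullet> q / 2}" by (intro aff_dim_subset) (auto simp: Fac_def)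
  also have "\<dots> = int DIM('a) - 1" using assms(2) by (rule aff_dim_hyperplane_int)
  finally have "aff_dim (Fac q) = int DIM('a) - 1" using assms by simp
  moreover have "Fac q \<noteq> {}"
  proof
    assume "Fac q = {}"
    then show False using assms(3) by simp
  qed
  ultimately show ?thesis using Fac_face[OF assms(1)] by (simp add: facet_of_def aff_dim_V)
qed

lemma aff_dim_Fac_p: "aff_dim (Fac p) \<ge> int DIM('a) - 1"
proof -
  obtain e where e: "e > 0" "\<And>x. dist x ((1/2) *\<^sub>R p) < e \<Longrightarrow> x \<bullet> p \<le> p \<bullet> p / 2 \<Longrightarrow> x \<in> V"
    using facet_ball by blast
  let ?H = "{x. p \<bullet> x = p \<bullet> p / 2}"
  have "aff_dim (?H \<inter> ball ((1/2) *\<^sub>R p) e) = aff_dim ?H"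
  proof (rule aff_dim_convex_Int_open)
    have "(1/2) *\<^sub>R p \<in> ?H \<inter> ball ((1/2) *\<^sub>R p) e" using e by simp
    then show "?H \<inter> ball ((1/2) *\<^sub>R p) e \<noteq> {}" by blast
  qed (rule convex_hyperplane open_ball)+
  moreover have "aff_dim ?H = int DIM('a) - 1" using p_nz by (rule aff_dim_hyperplane_int)
  moreover have "?H \<inter> ball ((1/2) *\<^sub>R p) e \<subseteq> Fac p" using e by (auto simp: Fac_def dist_commute inner_commute)
  ultimately show ?thesis using aff_dim_subset by metis
qed

text \<open>If no inequality were tight at \<open>x\<close>, then \<open>strict_near\<close> would
  put a whole ball into \<open>V\<close>.\<close>

lemma frontier_V: assumes "x \<in> frontier V" shows "\<exists>q\<in>L. q \<noteq> 0 \<and> x \<in> Fac q"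
proof (rule ccontr)
  assume n: "\<not> ?thesis"
  have x: "x \<in> V" "x \<notin> interior V" using assms closed_V by (auto simp: frontier_def)
  have st: "x \<bullet> q < q \<bullet> q / 2" if "q \<in> L" "q \<noteq> 0" for q
  proof -
    have "x \<bullet> q \<noteq> q \<bullet> q / 2"
    proof
      assume "x \<bullet> q = q \<bullet> q / 2"
      then have "x \<in> Fac q" using x(1) by (simp add: Fac_def inner_commute)
      then show False using n that by blast
    qed
    moreover have "x \<bullet> q \<le> q \<bullet> q / 2" using x(1) that(1) unfolding V_iff by blast
    ultimately show ?thesis by simp
  qed
  obtain e where e: "e > 0" "\<And>y q. dist y x < e \<Longrightarrow> q \<in> L \<Longrightarrow> x \<bullet> q < q \<bullet> q / 2 \<Longrightarrow> y \<bullet> q < q \<bullet> q / 2"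
    using strict_near[of x] by blast
  have "ball x e \<subseteq> V"
  proof
    fix y assume "y \<in> ball x e"
    then have "y \<bullet> q \<le> q \<bullet> q / 2" if "q \<in> L" for q
      using e(2)[of y q] st[of q] that by (cases "q = 0") (auto simp: less_imp_le dist_commute)
    then show "y \<in> V" by (simp add: V_iff)
  qed
  then have "x \<in> interior V" using e(1) by (meson centre_in_ball interior_maximal open_ball subsetD)
  then show False using x by simp
qed

text \<open>All multiples of \<open>d = b - a\<close> would lie in the bounded set \<open>V\<close>.
  This guarantees that cells with different centers are counted separately by efficiency.\<close>

lemma translate_V_inj: assumes "(+) a ` V = (+) b ` V" shows "a = b"
proof (rule ccontr)
  assume "a \<noteq> b"
  define d where "d = b - a"
  have "d + x \<in> V" if "x \<in> V" for x
  proof -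
    have "b + x \<in> (+) a ` V" using that assms by auto
    then show ?thesis by (auto simp: d_def algebra_simps)
  qed
  then have "real n *\<^sub>R d \<in> V" for n
    using V_zero by (induction n) (auto simp: scaleR_add_left)
  then have "norm (real n *\<^sub>R d) \<le> R0" for n by (rule R0(2))
  moreover obtain n where "R0 < real n * norm d"
    using reals_Archimedean3[of "norm d"] \<open>a \<noteq> b\<close> by (auto simp: d_def)
  ultimately show False by (metis norm_scaleR abs_of_nat not_le)
qed

lemma facet_of_translate: assumes "K facet_of S" shows "(+) a ` K facet_of (+) a ` S"
  using assms by (auto simp: facet_of_def face_of_translation_eq aff_dim_translation_eq)

text \<open>Sweeping along one direction raises the dimension by at most one, so the set lies in a
  proper affine subspace.\<close>

lemma negligible_thin_cylinder:
  assumes "aff_dim Q \<le> int DIM('a) - 2"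
  shows "negligible {x + t *\<^sub>R p |x t. x \<in> Q}"
proof (cases "Q = {}")
  case False
  then obtain a where a: "a \<in> Q" by blast
  let ?S = "insert p ((+) (- a) ` Q)"
  have "int (dim ((+) (- a) ` Q)) = aff_dim Q" using aff_dim_eq_dim[of a Q] a by (simp add: hull_inc)
  then have "int (dim ?S) \<le> int DIM('a) - 1" using assms by (simp add: dim_insert)
  then have "negligible (span ?S)" by (intro negligible_lowdim) simp
  then have "negligible ((+) a ` span ?S)" by (rule negligible_translation)
  moreover have "{x + t *\<^sub>R p |x t. x \<in> Q} \<subseteq> (+) a ` span ?S"
  proof safe
    fix x t assume "x \<in> Q"
    then have "(x - a) + t *\<^sub>R p \<in> span ?S" by (intro span_add span_scale span_base) auto
    moreover have "x + t *\<^sub>R p = a + ((x - a) + t *\<^sub>R p)" by simp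
    ultimately show "x + t *\<^sub>R p \<in> (+) a ` span ?S" by blast
  qed
  ultimately show ?thesis by (rule negligible_subset)
qed simp

end

lemma locally_finite_countable: assumes "locally_finite_set P" shows "countable P"
proof -
  have "P = (\<Union>n. P \<inter> cball 0 (real n))" using real_arch_simple by auto
  then show ?thesis using assms unfolding locally_finite_set_def
    by (metis countable_UN countable_finite countableI_type)
qed

lemma locally_finite_affine_image:
  fixes w :: "'a::euclidean_space"
  assumes P: "locally_finite_set P" and s: "0 < s"
  shows "locally_finite_set ((\<lambda>c. s *\<^sub>R c + w) ` P)"
  unfolding locally_finite_set_def
proof (intro allI)
  fix y R
  let ?\<phi> = "\<lambda>c. s *\<^sub>R c + w"
  have "?\<phi> ` P \<inter> cball y R \<subseteq> ?\<phi> ` (P \<inter> cball ((1 / s) *\<^sub>R (y - w)) (R / s))"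
  proof safe
    fix c' assume c': "c' \<in> P" "?\<phi> c' \<in> cball y R"
    have "(1 / s) *\<^sub>R (y - w) - c' = (1 / s) *\<^sub>R (y - ?\<phi> c')"
      using s by (simp add: algebra_simps)
    then have "dist ((1 / s) *\<^sub>R (y - w)) c' = dist y (?\<phi> c') / s" using s by (simp add: dist_norm)
    also have "\<dots> \<le> R / s" using c' s by (intro divide_right_mono) auto
    finally show "?\<phi> c' \<in> ?\<phi> ` (P \<inter> cball ((1 / s) *\<^sub>R (y - w)) (R / s))"
      using c'(1) by (intro image_eqI[OF refl]) simp
  qed
  then show "finite (?\<phi> ` P \<inter> cball y R)"
    using P finite_subset unfolding locally_finite_set_def by blast
qed

lemma finite_common_radius:
  assumes "finite Q" "\<And>c. c \<in> Q \<Longrightarrow> \<exists>e>0. pr c (e::real)" "\<And>c e e'. pr c e \<Longrightarrow> 0 < e' \<Longrightarrow> e' \<le> e \<Longrightarrow> pr c e'"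
  shows "\<exists>e>0. \<forall>c\<in>Q. pr c e"
  using assms(1,2)
proof (induction Q rule: finite_induct)
  case (insert c Q)
  obtain e1 where e1: "e1 > 0" "pr c e1" using insert.prems by blast
  obtain e2 where e2: "e2 > 0" "\<forall>c\<in>Q. pr c e2" using insert by blast
  have "pr x (min e1 e2)" if "x \<in> insert c Q" for x
    using that assms(3)[of x e1 "min e1 e2"] assms(3)[of x e2 "min e1 e2"] e1 e2 by auto
  then show ?case using e1 e2 by (intro exI[of _ "min e1 e2"]) auto
qed (auto intro: exI[of _ 1])

section \<open>Generic facet points in an efficient family\<close>

locale efficient_family = root_like_lattice L p r for L :: "'a::euclidean_space set" and p r +
  fixes v :: "nat \<Rightarrow> 'a" and J :: nat
  assumes eff: "efficient ((\<lambda>j. affine_tessellation 1 (v j) (voronoi_tessellation L)) ` {..J})"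
begin

definition centers :: "'a set" where "centers = (\<Union>j\<le>J. (\<lambda>z. z + v j) ` L)"

lemma cell_in_family: assumes "c \<in> centers"
  shows "(+) c ` V \<in> \<Union>((\<lambda>j. affine_tessellation 1 (v j) (voronoi_tessellation L)) ` {..J})"
proof -
  obtain j q where j: "j \<le> J" "q \<in> L" "c = q + v j" using assms by (auto simp: centers_def)
  have "(+) c ` V = (\<lambda>x. 1 *\<^sub>R x + v j) ` voronoi_cell L q"
    unfolding voronoi_cell_eq[OF j(2)] j(3) by (auto simp: image_image algebra_simps)
  then have "(+) c ` V \<in> affine_tessellation 1 (v j) (voronoi_tessellation L)"
    using j(2) unfolding affine_tessellation_def voronoi_tessellation_def by blast
  then show ?thesis using j(1) by blast
qed

lemma centers_shift: assumes "c \<in> centers" "q \<in> L" shows "c + q \<in> centers"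
proof -
  obtain j z where "j \<le> J" "z \<in> L" "c = z + v j" using assms by (auto simp: centers_def)
  then have "c + q = (z + q) + v j" "z + q \<in> L" using add assms(2) by auto
  then show ?thesis using \<open>j \<le> J\<close> unfolding centers_def by blast
qed

lemma locally_finite_centers: "locally_finite_set centers"
  unfolding locally_finite_set_def
proof (intro allI)
  fix x R
  have "centers \<inter> cball x R \<subseteq> (\<Union>j\<le>J. (\<lambda>z. z + v j) ` (L \<inter> cball (x - v j) R))"
    by (auto simp: centers_def dist_norm algebra_simps)
  moreover have "finite (\<Union>j\<le>J. (\<lambda>z. z + v j) ` (L \<inter> cball (x - v j) R))"
    using locally_finite_L by (auto simp: locally_finite_set_def)
  ultimately show "finite (centers \<inter> cball x R)" by (rule finite_subset)
qed

text \<open>The facet between \<open>c\<close> and \<open>c + p\<close> counts twice, once for each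
  of the two cells. A facet of a third cell brings the number to three, so efficiency bounds the
  dimension of the intersection; if \<open>Fac q\<close> is not a facet, it is thin by
  itself.\<close>

lemma facets_overlap_thin:
  assumes c: "c \<in> centers" and c': "c' \<in> centers" "c' \<noteq> c" "c' \<noteq> c + p" and q: "q \<in> L" "q \<noteq> 0"
  shows "aff_dim ((+) c ` Fac p \<inter> (+) c' ` Fac q) \<le> int DIM('a) - 2"
proof (cases "aff_dim (Fac q) \<ge> int DIM('a) - 1")
  case True
  let ?C1 = "(+) c ` V" and ?C2 = "(+) (c + p) ` V" and ?C3 = "(+) c' ` V"
  let ?G = "(+) c ` Fac p" and ?G' = "(+) c' ` Fac q"
  have pp: "Fac p facet_of V" using Fac_facet[OF p_L p_nz aff_dim_Fac_p] .
  have "aff_dim (Fac (- p)) = aff_dim (Fac p)"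
    using aff_dim_translation_eq[of "- p" "Fac p"] by (simp add: Fac_p_shift)
  then have mp: "Fac (- p) facet_of V"
    using Fac_facet[OF minus[OF p_L]] p_nz aff_dim_Fac_p by simp
  have "?G = (+) (c + p) ` Fac (- p)"
    unfolding Fac_p_shift by (auto simp: image_image algebra_simps)
  then have "?G facet_of ?C1" "?G facet_of ?C2" "?G' facet_of ?C3"
    using facet_of_translate pp mp Fac_facet[OF q True] by metis+
  then have S: "{(?C1, ?G), (?C2, ?G), (?C3, ?G')} \<subseteq> cell_facets (\<Union>((\<lambda>j. affine_tessellation 1 (v j) (voronoi_tessellation L)) ` {..J}))"
    using cell_in_family c c' centers_shift[OF c p_L] by (auto simp: cell_facets_def)
  have "?C1 \<noteq> ?C2" "?C1 \<noteq> ?C3" "?C2 \<noteq> ?C3"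
    using translate_V_inj[of c "c + p"] translate_V_inj[of c c'] translate_V_inj[of "c + p" c'] p_nz c' by auto
  then have "card {(?C1, ?G), (?C2, ?G), (?C3, ?G')} = 3" by simp
  then have "\<not> (finite {(?C1, ?G), (?C2, ?G), (?C3, ?G')} \<and> card {(?C1, ?G), (?C2, ?G), (?C3, ?G')} \<le> 2)"
    by linarith
  then have "int DIM('a) - aff_dim (\<Inter>(snd ` {(?C1, ?G), (?C2, ?G), (?C3, ?G')})) > 1"
    by (rule eff[unfolded efficient_def, rule_format, OF S])
  then show ?thesis by simp
next
  case False
  have "aff_dim ((+) c ` Fac p \<inter> (+) c' ` Fac q) \<le> aff_dim ((+) c' ` Fac q)" by (rule aff_dim_subset) simp
  also have "\<dots> = aff_dim (Fac q)" by (rule aff_dim_translation_eq)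
  finally show ?thesis using False by simp
qed

text \<open>Countably many thin overlaps cannot cover a neighbourhood on the facet. The argument
  runs in the full space: overlaps are swept along \<open>p\<close> to null sets, and a point of the
  open set \<open>W\<close> outside them is projected back by \<open>lift\<close>.\<close>

lemma generic_facet_point:
  assumes c: "c \<in> centers" and e: "0 < e"
  obtains x where "dist (x - c) ((1/2) *\<^sub>R p) < e" "(x - c) \<bullet> p = h"
    "\<And>c'. c' \<in> centers \<Longrightarrow> c' \<noteq> c \<Longrightarrow> c' \<noteq> c + p \<Longrightarrow> x - c' \<notin> frontier V"
proof -
  obtain e0 where e0: "e0 > 0" "\<And>x. dist x ((1/2) *\<^sub>R p) < e0 \<Longrightarrow> x \<bullet> p \<le> p \<bullet> p / 2 \<Longrightarrow> x \<in> V"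
    using facet_ball by blast
  let ?bad = "\<lambda>(c', q). {x + t *\<^sub>R p |x t. x \<in> (+) c ` Fac p \<inter> (+) c' ` Fac q}"
  define I where "I = (centers - {c, c + p}) \<times> (L - {0})"
  have "countable I" unfolding I_def
    using locally_finite_countable locally_finite_centers locally_finite_L by blast
  then have neg: "negligible (\<Union>(?bad ` I))"
  proof (intro negligible_countable_Union)
    fix K assume "K \<in> ?bad ` I"
    then obtain c' q where K: "K = ?bad (c', q)" "(c', q) \<in> I" by auto
    then have "aff_dim ((+) c ` Fac p \<inter> (+) c' ` Fac q) \<le> int DIM('a) - 2"
      by (intro facets_overlap_thin c) (auto simp: I_def)
    from negligible_thin_cylinder[OF this] show "negligible K" unfolding K(1) prod.case .
  qed simp
  define W where "W = (\<lambda>x. lift (x - c)) -` ball ((1/2) *\<^sub>R p) (min e e0)"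
  have "open W" unfolding W_def
    by (intro open_vimage open_ball continuous_on_compose2[OF continuous_lift] continuous_intros) auto
  moreover have "c + (1/2) *\<^sub>R p \<in> W"
  proof -
    have "lift ((1/2) *\<^sub>R p) = (1/2) *\<^sub>R p" by (rule lift_id) (simp add: h_def)
    then show ?thesis using e e0 by (simp add: W_def)
  qed
  ultimately have "\<not> W \<subseteq> \<Union>(?bad ` I)"
    using open_not_negligible[of W] negligible_subset[OF neg] by blast
  then obtain y where y: "y \<in> W" "y \<notin> \<Union>(?bad ` I)" by blast
  define x where "x = c + lift (y - c)"
  have xc: "x - c = lift (y - c)" by (simp add: x_def)
  have d: "dist (x - c) ((1/2) *\<^sub>R p) < e" "dist (x - c) ((1/2) *\<^sub>R p) < e0"
    using y(1) by (auto simp: W_def xc dist_commute)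
  have xp: "(x - c) \<bullet> p = h" by (simp add: xc)
  have "x - c \<in> V" using e0(2)[OF d(2)] xp by (simp add: h_def)
  then have xF: "x \<in> (+) c ` Fac p"
    using xp by (intro image_eqI[of _ _ "x - c"]) (auto simp: Fac_def h_def inner_commute)
  have "x - c' \<notin> frontier V" if c': "c' \<in> centers" "c' \<noteq> c" "c' \<noteq> c + p" for c'
  proof
    assume "x - c' \<in> frontier V"
    then obtain q where q: "q \<in> L" "q \<noteq> 0" "x - c' \<in> Fac q" using frontier_V by blast
    then have "x \<in> (+) c' ` Fac q" by (intro image_eqI[of _ _ "x - c'"]) auto
    moreover have "y = x + (- ((h - (y - c) \<bullet> p) / N)) *\<^sub>R p" by (simp add: x_def lift_def)
    ultimately have "y \<in> ?bad (c', q)" using xF by blast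
    then show False using y(2) c' q by (auto simp: I_def)
  qed
  then show thesis using that d xp by blast
qed

lemma facet_neighbourhood:
  "\<exists>e>0. \<forall>u. dist u ((1/2) *\<^sub>R p) < e \<longrightarrow>
    (u \<in> V \<longleftrightarrow> u \<bullet> p \<le> h) \<and> (u - p \<in> V \<longleftrightarrow> h \<le> u \<bullet> p)"
proof -
  obtain e where e: "e > 0" "\<And>x. dist x ((1/2) *\<^sub>R p) < e \<Longrightarrow> x \<bullet> p \<le> p \<bullet> p / 2 \<Longrightarrow> x \<in> V"
    using facet_ball by blast
  have 1: "u \<in> V \<longleftrightarrow> u \<bullet> p \<le> h" if "dist u ((1/2) *\<^sub>R p) < e" for u
    using e(2)[OF that] height[of u] by (auto simp: h_def)
  have 2: "u - p \<in> V \<longleftrightarrow> h \<le> u \<bullet> p" if "dist u ((1/2) *\<^sub>R p) < e" for u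
  proof -
    \<comment> \<open>The reflection of \<open>u\<close> to \<open>p - u\<close> fixes
      \<open>p / 2\<close> and exchanges the cells of 0 and \<open>p\<close>, which reduces the
      second claim to the first.\<close>
    define q where "q = (1/2) *\<^sub>R p"
    have "p = q + q" by (simp add: q_def flip: scaleR_left_distrib)
    then have "p - u - q = - (u - q)" by simp
    then have "norm (p - u - q) = norm (u - q)" by (metis norm_minus_cancel)
    then have "dist (p - u) ((1/2) *\<^sub>R p) < e" using that by (simp add: dist_norm q_def)
    from 1[OF this] have "p - u \<in> V \<longleftrightarrow> h \<le> u \<bullet> p" by (auto simp: inner_diff_left h_def)
    moreover have "p - u \<in> V \<longleftrightarrow> u - p \<in> V" using V_minus[of "p - u"] V_minus[of "u - p"] by auto
    ultimately show ?thesis by simp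
  qed
  show ?thesis using e(1) 1 2 by blast
qed

lemma generic_facet_ball:
  assumes c: "c \<in> centers"
  obtains x e where "0 < e" "(x - c) \<bullet> p = h"
    "\<And>u. dist u x < e \<Longrightarrow> (u - c \<in> V \<longleftrightarrow> (u - c) \<bullet> p \<le> h) \<and> (u - (c + p) \<in> V \<longleftrightarrow> h \<le> (u - c) \<bullet> p)"
    "\<And>c' u. c' \<in> centers \<Longrightarrow> c' \<noteq> c \<Longrightarrow> c' \<noteq> c + p \<Longrightarrow> dist u x < e \<Longrightarrow> u - c' \<in> V \<longleftrightarrow> x - c' \<in> V"
proof -
  obtain e1 where e1: "e1 > 0" "\<And>u. dist u ((1/2) *\<^sub>R p) < e1 \<Longrightarrow> (u \<in> V \<longleftrightarrow> u \<bullet> p \<le> h) \<and> (u - p \<in> V \<longleftrightarrow> h \<le> u \<bullet> p)"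
    using facet_neighbourhood by blast
  obtain x where x: "dist (x - c) ((1/2) *\<^sub>R p) < e1 / 2" "(x - c) \<bullet> p = h"
    "\<And>c'. c' \<in> centers \<Longrightarrow> c' \<noteq> c \<Longrightarrow> c' \<noteq> c + p \<Longrightarrow> x - c' \<notin> frontier V"
    using generic_facet_point[OF c, of "e1 / 2"] e1(1) by auto
  \<comment> \<open>Cells with centers farther away contain no point within distance 1 of
    \<open>x\<close>; the two cells sharing the facet are treated separately.\<close>
  define Q where "Q = (centers \<inter> cball x (R0 + 1)) - {c, c + p}"
  have fin: "finite Q" using locally_finite_centers by (auto simp: Q_def locally_finite_set_def)
  have "\<exists>e>0. \<forall>c'\<in>Q. \<forall>u. dist u x < e \<longrightarrow> (u - c' \<in> V \<longleftrightarrow> x - c' \<in> V)"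
  proof (rule finite_common_radius[OF fin])
    fix c' assume c': "c' \<in> Q"
    then have "x - c' \<notin> frontier V" using x(3) by (auto simp: Q_def)
    then have "x - c' \<in> interior V \<or> x - c' \<in> - V"
      using closed_V by (auto simp: frontier_def)
    moreover have "open (interior V)" "open (- V)" using closed_V by auto
    ultimately obtain e where "e > 0" "ball (x - c') e \<subseteq> interior V \<or> ball (x - c') e \<subseteq> - V"
      unfolding open_contains_ball by blast
    moreover have "u - c' \<in> ball (x - c') e" if "dist u x < e" for u e using that by (simp add: dist_norm norm_minus_commute)
    ultimately show "\<exists>e>0. \<forall>u. dist u x < e \<longrightarrow> (u - c' \<in> V \<longleftrightarrow> x - c' \<in> V)"
      using interior_subset[of V] by (metis ComplD centre_in_ball subsetD)
  next
    fix c' and e e' :: real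
    assume "\<forall>u. dist u x < e \<longrightarrow> (u - c' \<in> V \<longleftrightarrow> x - c' \<in> V)" "e' \<le> e"
    then show "\<forall>u. dist u x < e' \<longrightarrow> (u - c' \<in> V \<longleftrightarrow> x - c' \<in> V)" by (meson less_le_trans)
  qed
  then obtain e2 where e2: "e2 > 0" "\<And>c' u. c' \<in> Q \<Longrightarrow> dist u x < e2 \<Longrightarrow> u - c' \<in> V \<longleftrightarrow> x - c' \<in> V" by blast
  define e where "e = min 1 (min (e1 / 2) e2)"
  show thesis
  proof (rule that[of e x])
    show "0 < e" using e1 e2 by (simp add: e_def)
    show "(x - c) \<bullet> p = h" by (fact x)
  next
    fix u assume u: "dist u x < e"
    have "dist (u - c) ((1/2) *\<^sub>R p) \<le> dist (u - c) (x - c) + dist (x - c) ((1/2) *\<^sub>R p)" by (rule dist_triangle)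
    moreover have "dist (u - c) (x - c) = dist u x" by (simp add: dist_norm)
    ultimately have "dist (u - c) ((1/2) *\<^sub>R p) < e1" using x(1) u by (simp add: e_def)
    from e1(2)[OF this] show "(u - c \<in> V \<longleftrightarrow> (u - c) \<bullet> p \<le> h) \<and> (u - (c + p) \<in> V \<longleftrightarrow> h \<le> (u - c) \<bullet> p)"
      by (simp add: diff_diff_eq)
  next
    fix c' u assume c': "c' \<in> centers" "c' \<noteq> c" "c' \<noteq> c + p" and u: "dist u x < e"
    show "u - c' \<in> V \<longleftrightarrow> x - c' \<in> V"
    proof (cases "c' \<in> Q")
      case True
      then show ?thesis using e2(2) u by (simp add: e_def)
    next
      case False
      then have far: "R0 + 1 < dist x c'" using c' by (simp add: Q_def)
      have "u - c' \<notin> V"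
      proof
        assume "u - c' \<in> V"
        then have "norm (u - c') \<le> R0" by (rule R0(2))
        moreover have "dist x c' \<le> dist u x + norm (u - c')"
          using dist_triangle[of x c' u] by (simp add: dist_norm norm_minus_commute)
        ultimately show False using far u by (simp add: e_def)
      qed
      moreover have "x - c' \<notin> V"
      proof
        assume "x - c' \<in> V"
        then have "norm (x - c') \<le> R0" by (rule R0(2))
        then show False using far by (simp add: dist_norm)
      qed
      ultimately show ?thesis by simp
    qed
  qed
qed

text \<open>Close to a generic facet point the cells covering a point are a fixed set
  \<open>S\<close> together with \<open>c\<close> on one side and \<open>c + p\<close> on the other.
  The coefficients sum to zero on each side, so subtraction leaves the two that change.\<close>

lemma scaled_cells_jump:
  fixes s :: real and w :: 'a and a :: "'a \<Rightarrow> complex"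
  assumes s: "0 < s"
    and z: "\<And>\<theta>. bounded_supp \<theta> \<Longrightarrow> AE x in lborel. dsum ((\<lambda>c. s *\<^sub>R c + w) ` centers) a (cconv (indicator ((*\<^sub>R) s ` V)) \<theta>) x = 0"
    and c: "c \<in> centers"
  shows "a (s *\<^sub>R c + w) = a (s *\<^sub>R (c + p) + w)"
proof -
  define \<phi> where "\<phi> c = s *\<^sub>R c + w" for c
  let ?P = "\<phi> ` centers" and ?U = "(*\<^sub>R) s ` V"
  have inj: "inj \<phi>" using s by (auto simp: inj_def \<phi>_def)
  have U: "\<phi> u - \<phi> c' \<in> ?U \<longleftrightarrow> u - c' \<in> V" for u c'
    using s by (auto simp: \<phi>_def image_iff simp flip: scaleR_diff_right)
  have P: "locally_finite_set ?P"
    unfolding \<phi>_def by (rule locally_finite_affine_image[OF locally_finite_centers s])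
  have "compact ?U" using compact_V by (rule compact_scaling)
  then have Um: "?U \<in> sets borel" "bounded ?U" by (auto simp: compact_imp_closed compact_imp_bounded)
  show ?thesis
  proof (rule generic_facet_ball[OF c])
    fix x e
    assume e: "0 < e" and xp: "(x - c) \<bullet> p = h"
      and n: "\<And>u. dist u x < e \<Longrightarrow> (u - c \<in> V \<longleftrightarrow> (u - c) \<bullet> p \<le> h) \<and> (u - (c + p) \<in> V \<longleftrightarrow> h \<le> (u - c) \<bullet> p)"
      and o: "\<And>c' u. c' \<in> centers \<Longrightarrow> c' \<noteq> c \<Longrightarrow> c' \<noteq> c + p \<Longrightarrow> dist u x < e \<Longrightarrow> u - c' \<in> V \<longleftrightarrow> x - c' \<in> V"
    define S where "S = {c' \<in> centers - {c, c + p}. x - c' \<in> V}"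
    have "S \<subseteq> centers \<inter> cball x R0" using R0(2) by (auto simp: S_def dist_norm)
    then have finS: "finite S" using locally_finite_centers finite_subset unfolding locally_finite_set_def by blast
    have cp: "c + p \<in> centers" using centers_shift[OF c p_L] .
    \<comment> \<open>\<open>\<sigma>\<close> selects the side of the facet, with
      \<open>\<sigma> = 1\<close> for the side of \<open>c + p\<close>.\<close>
    have val: "(\<Sum>c'\<in>insert (if \<sigma> = 1 then c + p else c) S. a (\<phi> c')) = 0" if \<sigma>: "\<sigma> = 1 \<or> \<sigma> = - 1" for \<sigma> :: real
    proof -
      \<comment> \<open>A step of length \<open>e / 2\<close> away from the facet: the ball of that
        radius about \<open>y\<close> lies within \<open>e\<close> of \<open>x\<close> and strictly
        on one side.\<close>
      define \<theta> where "\<theta> = e / (2 * norm p)"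
      have \<theta>: "\<theta> * norm p = e / 2" "0 < \<theta>" using e p_nz by (auto simp: \<theta>_def)
      define y where "y = x + (\<sigma> * \<theta>) *\<^sub>R p"
      have near: "dist u x < e \<and> 0 < \<sigma> * ((u - c) \<bullet> p - h)" if u: "dist u y < e / 2" for u
      proof
        have "dist y x = e / 2" using \<sigma> \<theta> by (auto simp: y_def dist_norm)
        then show "dist u x < e" using dist_triangle[of u x y] u by simp
        have "\<bar>(u - y) \<bullet> p\<bar> \<le> norm (u - y) * norm p" by (rule Cauchy_Schwarz_ineq2)
        also have "\<dots> < e / 2 * norm p" using u p_nz by (intro mult_strict_right_mono) (auto simp: dist_norm)
        also have "\<dots> = \<theta> * (p \<bullet> p)" using \<theta>(1) by (simp add: power2_norm_eq_inner[symmetric] power2_eq_square)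
        finally have 1: "\<bar>(u - y) \<bullet> p\<bar> < \<theta> * (p \<bullet> p)" .
        have "(u - c) \<bullet> p = (u - y) \<bullet> p + h + \<sigma> * \<theta> * (p \<bullet> p)"
          using xp by (simp add: y_def inner_diff_left inner_add_left)
        then show "0 < \<sigma> * ((u - c) \<bullet> p - h)" using 1 \<sigma> by auto
      qed
      have mem: "u - c' \<in> V \<longleftrightarrow> c' \<in> insert (if \<sigma> = 1 then c + p else c) S" if u: "dist u y < e / 2" and c': "c' \<in> centers" for u c'
      proof (cases "c' = c \<or> c' = c + p")
        case True
        then show ?thesis using n[of u] near[OF u] \<sigma> p_nz by (auto simp: S_def)
      next
        case False
        then show ?thesis using o[OF c', of u] near[OF u] c' by (auto simp: S_def)
      qed
      have "(\<Sum>\<tau> | \<tau> \<in> ?P \<and> \<phi> y - \<tau> \<in> ?U. a \<tau>) = 0"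
      proof (rule dsum_locally_constant[OF P Um])
        show "0 < s * (e / 2)" using s e by simp
        show "AE x in lborel. dsum ?P a (cconv (indicator ?U) \<theta>) x = 0" if "bounded_supp \<theta>" for \<theta>
          using z[OF that] unfolding \<phi>_def .
        fix \<tau> assume "\<tau> \<in> ?P"
        then obtain c' where c': "c' \<in> centers" "\<tau> = \<phi> c'" by blast
        have "Y - \<tau> \<in> ?U \<longleftrightarrow> c' \<in> insert (if \<sigma> = 1 then c + p else c) S" if "Y \<in> ball (\<phi> y) (s * (e / 2))" for Y
        proof -
          define u where "u = (1 / s) *\<^sub>R (Y - w)"
          have Y: "Y = \<phi> u" using s by (simp add: u_def \<phi>_def)
          have "dist (\<phi> y) (\<phi> u) = s * dist y u" using s by (simp add: \<phi>_def dist_norm flip: scaleR_diff_right)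
          then have "dist u y < e / 2" using that s unfolding Y by (simp add: dist_commute)
          then show ?thesis using mem[OF _ c'(1)] U unfolding Y c'(2) by simp
        qed
        then show "(\<forall>Y\<in>ball (\<phi> y) (s * (e / 2)). Y - \<tau> \<in> ?U) \<or> (\<forall>Y\<in>ball (\<phi> y) (s * (e / 2)). Y - \<tau> \<notin> ?U)" by blast
      qed
      moreover have "{\<tau>. \<tau> \<in> ?P \<and> \<phi> y - \<tau> \<in> ?U} = \<phi> ` insert (if \<sigma> = 1 then c + p else c) S"
      proof -
        have "{c' \<in> centers. y - c' \<in> V} = insert (if \<sigma> = 1 then c + p else c) S"
          using mem[of y] e c cp by (auto simp: S_def)
        moreover have "{\<tau>. \<tau> \<in> ?P \<and> \<phi> y - \<tau> \<in> ?U} = \<phi> ` {c' \<in> centers. y - c' \<in> V}"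
          using U[of y] by blast
        ultimately show ?thesis by simp
      qed
      ultimately have "(\<Sum>\<tau>\<in>\<phi> ` insert (if \<sigma> = 1 then c + p else c) S. a \<tau>) = 0" by simp
      then show ?thesis unfolding sum.reindex[OF inj_on_subset[OF inj subset_UNIV]] comp_def .
    qed
    have "a (\<phi> (c + p)) + (\<Sum>c'\<in>S. a (\<phi> c')) = 0" using val[of 1] finS by (simp add: S_def)
    moreover have "a (\<phi> c) + (\<Sum>c'\<in>S. a (\<phi> c')) = 0" using val[of "- 1"] finS by (simp add: S_def)
    ultimately have "a (\<phi> c) = a (\<phi> (c + p))" by (metis add_right_imp_eq)
    then show "a (s *\<^sub>R c + w) = a (s *\<^sub>R (c + p) + w)" by (simp add: \<phi>_def)
  qed
qed

end

section \<open>Closure properties of kernels and the complex form of splines\<close>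

lemma bounded_supp_add: assumes "bounded_supp f" "bounded_supp g" shows "bounded_supp (\<lambda>x. f x + g x)"
proof -
  obtain M1 where M1: "\<And>x. norm (f x) \<le> M1" using assms bounded_meas_bound bounded_supp_imp_bounded_meas by metis
  obtain M2 where M2: "\<And>x. norm (g x) \<le> M2" using assms bounded_meas_bound bounded_supp_imp_bounded_meas by metis
  obtain R1 where R1: "\<And>x. f x \<noteq> 0 \<Longrightarrow> norm x \<le> R1" using assms(1) bounded_supp_support by metis
  obtain R2 where R2: "\<And>x. g x \<noteq> 0 \<Longrightarrow> norm x \<le> R2" using assms(2) bounded_supp_support by metis
  have [measurable]: "f \<in> borel_measurable borel" "g \<in> borel_measurable borel" using assms bounded_supp_measurable by auto
  show ?thesis
  proof (rule bounded_suppI[of _ "max R1 R2"], rule bounded_measI[of _ "M1 + M2"])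
    show "norm (f x + g x) \<le> M1 + M2" for x using norm_triangle_ineq[of "f x" "g x"] M1[of x] M2[of x] by linarith
    show "norm x \<le> max R1 R2" if "f x + g x \<noteq> 0" for x
    proof (cases "f x = 0")
      case True
      then show ?thesis using R2[of x] that by simp
    qed (use R1[of x] in simp)
  qed measurable
qed

lemma bounded_supp_cmult: assumes "bounded_supp f" shows "bounded_supp (\<lambda>x. c * f x)"
  using bounded_supp_mult[OF assms, of "\<lambda>_. c"] by (simp add: bounded_measI[of _ "norm c"] mult.commute)

lemma bounded_supp_zero: "bounded_supp (\<lambda>_. 0)"
  by (intro bounded_suppI[of _ 0] bounded_measI[of _ 0]) auto

lemma bounded_supp_indicator: assumes "S \<in> sets borel" "bounded S" shows "bounded_supp (indicator S)"
proof -
  obtain R where "\<And>x. x \<in> S \<Longrightarrow> norm x \<le> R" using assms by (auto simp: bounded_iff)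
  then show ?thesis using assms(1) by (intro bounded_suppI[of _ R] bounded_measI[of _ 1]) (auto simp: indicator_def)
qed

lemma cconv_commute: assumes "bounded_supp f" "bounded_supp g" shows "cconv f g = cconv g f"
proof
  fix x
  have [measurable]: "f \<in> borel_measurable borel" "g \<in> borel_measurable borel" using assms bounded_supp_measurable by auto
  have "(LINT y|lborel. f (x - y) * g (x - (x - y))) = (LINT y|lborel. f y * g (x - y))"
    by (rule integral_shift(3)[of "\<lambda>y. f y * g (x - y)"]) measurable
  then show "cconv f g x = cconv g f x" by (simp add: cconv_def mult.commute)
qed

lemma conv_power_complex:
  "complex_of_real (conv_power (indicat_real U) k x) = (cconv (indicator U) ^^ (k - 1)) (indicator U) x"
proof -
  have "complex_of_real ((convolution (indicat_real U) ^^ j) (indicat_real U) x) = (cconv (indicator U) ^^ j) (indicator U) x" for j x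
  proof (induction j arbitrary: x)
    case 0
    then show ?case by (simp add: indicator_def)
  next
    case (Suc j)
    have i: "complex_of_real (indicat_real U y) = indicator U y" for y by (simp add: indicator_def)
    have "complex_of_real ((convolution (indicat_real U) ^^ Suc j) (indicat_real U) x)
       = (LINT y|lborel. complex_of_real (indicat_real U y * (convolution (indicat_real U) ^^ j) (indicat_real U) (x - y)))"
      unfolding integral_complex_of_real by (simp add: convolution_def)
    also have "\<dots> = (LINT y|lborel. indicator U y * (cconv (indicator U) ^^ j) (indicator U) (x - y))"
      unfolding of_real_mult Suc i ..
    also have "\<dots> = (cconv (indicator U) ^^ Suc j) (indicator U) x" by (simp add: cconv_def)
    finally show ?case .
  qed
  then show ?thesis by (simp add: conv_power_def fun_eq_iff)
qed

section \<open>Splines and their coefficients\<close>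

text \<open>The integrals of a test function \<open>\<psi>\<close> against all translates of
  \<open>\<phi>\<close>, as a function of the center. The value 0 off \<open>P\<close> places it in
  the module of finitely supported functions on \<open>P\<close>.\<close>

definition row :: "'a::euclidean_space set \<Rightarrow> ('a \<Rightarrow> complex) \<Rightarrow> ('a \<Rightarrow> complex) \<Rightarrow> 'a \<Rightarrow> complex" where
  "row P \<phi> \<psi> \<tau> = (if \<tau> \<in> P then LINT x|lborel. \<psi> x * \<phi> (x - \<tau>) else 0)"

lemma row_eq_cconv:
  assumes "bounded_supp \<psi>" "bounded_supp \<phi>" "\<tau> \<in> P" shows "row P \<phi> \<psi> \<tau> = cconv (\<lambda>y. \<psi> (- y)) \<phi> (0 - \<tau>)"
proof -
  have [measurable]: "\<psi> \<in> borel_measurable borel" "\<phi> \<in> borel_measurable borel" using assms bounded_supp_measurable by auto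
  have "(LINT y|lborel. \<psi> (0 - y) * \<phi> (0 - y - \<tau>)) = (LINT y|lborel. \<psi> y * \<phi> (y - \<tau>))"
    by (rule integral_shift(3)[of "\<lambda>y. \<psi> y * \<phi> (y - \<tau>)"]) measurable
  moreover have "0 - y - \<tau> = 0 - \<tau> - y" for y by simp
  ultimately have "(LINT y|lborel. \<psi> (- y) * \<phi> (0 - \<tau> - y)) = (LINT y|lborel. \<psi> y * \<phi> (y - \<tau>))"
    by (simp only: diff_0)
  then show ?thesis using assms(3) by (simp add: row_def cconv_def)
qed

lemma row_support:
  assumes "\<And>x. \<psi> x \<noteq> 0 \<Longrightarrow> norm x \<le> R" "\<And>x. \<phi> x \<noteq> 0 \<Longrightarrow> norm x \<le> S" "row P \<phi> \<psi> \<tau> \<noteq> 0"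
  shows "\<tau> \<in> P \<and> norm \<tau> \<le> R + S"
proof -
  have "\<tau> \<in> P" using assms(3) unfolding row_def by presburger
  moreover have "\<not> (\<forall>x. \<psi> x * \<phi> (x - \<tau>) = 0)"
  proof
    assume *: "\<forall>x. \<psi> x * \<phi> (x - \<tau>) = 0"
    have "(LINT x|lborel. \<psi> x * \<phi> (x - \<tau>)) = 0" unfolding *[rule_format] by simp
    then show False using assms(3) by (simp add: row_def split: if_splits)
  qed
  then obtain x where "\<psi> x \<noteq> 0" "\<phi> (x - \<tau>) \<noteq> 0" by auto
  then have "norm x \<le> R" "norm (x - \<tau>) \<le> S" using assms by auto
  then have "norm \<tau> \<le> R + S" using norm_triangle_ineq4[of x "x - \<tau>"] by simp
  ultimately show ?thesis by simp
qed

text \<open>Summing coefficients against a row integrates the combination of translates against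
  \<open>\<psi>\<close>; the reflection of \<open>\<psi>\<close> merely writes this integral as a
  convolution at 0.\<close>

lemma row_pairing:
  assumes P: "locally_finite_set P" and b: "bounded_supp \<psi>" "bounded_supp \<phi>"
  shows "(\<Sum>\<tau> | row P \<phi> \<psi> \<tau> \<noteq> 0. row P \<phi> \<psi> \<tau> * g \<tau>) = cconv (\<lambda>y. \<psi> (- y)) (dsum P g \<phi>) 0"
proof -
  have b': "bounded_supp (\<lambda>y. \<psi> (- y))" using bounded_supp_shift(3)[OF b(1), of 0] by simp
  have "{\<tau>. row P \<phi> \<psi> \<tau> \<noteq> 0} = {\<tau>. \<tau> \<in> P \<and> cconv (\<lambda>y. \<psi> (- y)) \<phi> (0 - \<tau>) \<noteq> 0}"
    using row_eq_cconv[OF b] by (auto simp: row_def)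
  moreover have "(\<Sum>\<tau> | \<tau> \<in> P \<and> cconv (\<lambda>y. \<psi> (- y)) \<phi> (0 - \<tau>) \<noteq> 0. row P \<phi> \<psi> \<tau> * g \<tau>)
     = dsum P g (cconv (\<lambda>y. \<psi> (- y)) \<phi>) 0"
    unfolding dsum_def by (intro sum.cong) (auto simp: row_eq_cconv[OF b])
  ultimately show ?thesis using cconv_dsum[OF P b' b(2)] by metis
qed

section \<open>Differences and Laplace transforms\<close>

text \<open>The transpose of the module operator \<open>D\<close>: \<open>D\<close> shifts point
  masses forward by \<open>p\<close>, so coefficients are evaluated at \<open>x + p\<close>.\<close>

definition shift_diff :: "'a::ab_group_add \<Rightarrow> ('a \<Rightarrow> complex) \<Rightarrow> 'a \<Rightarrow> complex" where
  "shift_diff p g = (\<lambda>x. g (x + p) - g x)"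

lemma shift_diff_apply: "shift_diff p g x = g (x + p) - g x"
  by (simp add: shift_diff_def)

lemma shift_diff_Suc: "(shift_diff p ^^ Suc n) g x = (shift_diff p ^^ n) g (x + p) - (shift_diff p ^^ n) g x"
  by (simp add: shift_diff_def)

lemma dsum_shift_diff:
  assumes "\<And>\<tau>. \<tau> \<in> P \<longleftrightarrow> \<tau> + p \<in> P"
  shows "dsum P ((shift_diff p ^^ n) g) \<phi> = (shift_diff p ^^ n) (dsum P g \<phi>)"
proof (induction n)
  case (Suc n)
  have "dsum P (shift_diff p g) \<phi> = shift_diff p (dsum P g \<phi>)" for g
    by (rule ext) (simp add: shift_diff_def dsum_translate[OF assms] dsum_def[of P _ \<phi>] left_diff_distrib sum_subtractf)
  then show ?case using Suc by simp
qed simp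

lemma AE_shift_diff:
  assumes "AE x in lborel. u x = v x"
  shows "AE x in lborel. (shift_diff p ^^ n) u x = (shift_diff p ^^ n) v x"
proof (induction n)
  case (Suc n)
  have "AE x in lborel. (shift_diff p ^^ n) u (x + p) = (shift_diff p ^^ n) v (x + p)"
    using AE_lborel_affine_shift[OF Suc, of 1 p] by (simp add: add.commute)
  with Suc show ?case by eventually_elim (simp only: shift_diff_Suc)
qed (use assms in simp)

lemma bounded_supp_shift_diff: assumes "bounded_supp h" shows "bounded_supp ((shift_diff p ^^ n) h)"
proof (induction n)
  case (Suc n)
  then have "bounded_supp (\<lambda>x. (shift_diff p ^^ n) h (x + p) + (- 1) * (shift_diff p ^^ n) h x)"
    by (intro bounded_supp_add bounded_supp_cmult bounded_supp_shift)
  moreover have "(shift_diff p ^^ Suc n) h = (\<lambda>x. (shift_diff p ^^ n) h (x + p) + (- 1) * (shift_diff p ^^ n) h x)"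
    by (rule ext) (simp only: shift_diff_Suc, simp)
  ultimately show ?case by simp
qed (use assms in simp)

lemma laplace_shift_diff:
  assumes h: "bounded_supp h" and E: "linear E"
  shows "(LINT x|lborel. (shift_diff p ^^ n) h x * exp (E x)) = (exp (- E p) - 1) ^ n * (LINT x|lborel. h x * exp (E x))"
proof (induction n)
  case (Suc n)
  let ?u = "(shift_diff p ^^ n) h"
  have u: "bounded_supp ?u" using h by (rule bounded_supp_shift_diff)
  have int: "integrable lborel (\<lambda>x. ?u x * exp (E x))" by (intro bounded_supp_integrable bounded_supp_exp u E)
  have [measurable]: "(\<lambda>x. ?u x * exp (E x)) \<in> borel_measurable borel" by (intro bounded_supp_measurable bounded_supp_exp u E)
  have e: "?u (x + p) * exp (E x) = exp (- E p) * (?u (x + p) * exp (E (x + p)))" for x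
    using linear_add[OF E, of x p] by (simp add: exp_add exp_minus)
  have int2: "integrable lborel (\<lambda>x. ?u (x + p) * exp (E x))"
    unfolding e using bounded_supp_shift(2)[OF bounded_supp_exp[OF u E], of p] by (intro integrable_mult_right bounded_supp_integrable)
  have "(LINT x|lborel. (shift_diff p ^^ Suc n) h x * exp (E x))
      = (LINT x|lborel. ?u (x + p) * exp (E x) - ?u x * exp (E x))"
    by (simp only: shift_diff_Suc left_diff_distrib)
  also have "\<dots> = (LINT x|lborel. ?u (x + p) * exp (E x)) - (LINT x|lborel. ?u x * exp (E x))"
    by (rule Bochner_Integration.integral_diff[OF int2 int])
  also have "(LINT x|lborel. ?u (x + p) * exp (E x)) = exp (- E p) * (LINT x|lborel. ?u x * exp (E x))"
    unfolding e using integral_shift(1)[of "\<lambda>x. ?u x * exp (E x)" p] by simp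
  finally show ?case using Suc by (simp add: algebra_simps)
qed simp

text \<open>A twist by \<open>exp (E x)\<close> passes through convolution powers, and the total
  integral is multiplicative.\<close>

lemma laplace_cpow:
  assumes f: "bounded_supp f" and E: "linear E"
  shows "(LINT x|lborel. (cconv f ^^ j) f x * exp (E x)) = (LINT x|lborel. f x * exp (E x)) ^ Suc j"
proof -
  have f': "bounded_supp (\<lambda>x. f x * exp (E x))" by (rule bounded_supp_exp[OF f E])
  have "(LINT x|lborel. (cconv (\<lambda>x. f x * exp (E x)) ^^ j) (\<lambda>x. f x * exp (E x)) x) = (LINT x|lborel. f x * exp (E x)) ^ Suc j"
  proof (induction j)
    case (Suc j)
    then show ?case using integral_cconv[OF f' bounded_supp_cpow[OF f', of j]] by simp
  qed simp
  then show ?thesis unfolding cpow_exp[OF E] .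
qed

lemma laplace_finite_dsum:
  assumes P: "locally_finite_set P" and \<phi>: "bounded_supp \<phi>" and E: "linear E" and Z: "finite Z" "Z \<subseteq> P" "\<And>\<tau>. \<tau> \<in> P \<Longrightarrow> G \<tau> \<noteq> 0 \<Longrightarrow> \<tau> \<in> Z"
  shows "(LINT x|lborel. dsum P G \<phi> x * exp (E x)) = (\<Sum>z\<in>Z. G z * exp (E z)) * (LINT x|lborel. \<phi> x * exp (E x))"
proof -
  obtain S where S: "\<And>x. \<phi> x \<noteq> 0 \<Longrightarrow> norm x \<le> S" using \<phi> bounded_supp_support by metis
  have d: "dsum P G \<phi> x = (\<Sum>z\<in>Z. G z * \<phi> (x - z))" for x
  proof -
    let ?Q = "P \<inter> cball x S"
    have fin: "finite ?Q" using P by (simp add: locally_finite_set_def)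
    have "dsum P G \<phi> x = (\<Sum>z\<in>?Q. G z * \<phi> (x - z))" using fin S by (intro dsum_eq) (auto simp: dist_norm)
    also have "\<dots> = (\<Sum>z\<in>?Q \<union> Z. G z * \<phi> (x - z))" using fin Z S by (intro sum.mono_neutral_left) (auto simp: dist_norm)
    also have "\<dots> = (\<Sum>z\<in>Z. G z * \<phi> (x - z))" using fin Z by (intro sum.mono_neutral_right) auto
    finally show ?thesis .
  qed
  have [measurable]: "(\<lambda>x. \<phi> x * exp (E x)) \<in> borel_measurable borel" by (intro bounded_supp_measurable bounded_supp_exp \<phi> E)
  have e: "\<phi> (x - z) * exp (E x) = exp (E z) * (\<phi> (x - z) * exp (E (x - z)))" for x z
    using linear_diff[OF E, of x z] by (simp add: exp_diff)
  have "(LINT x|lborel. dsum P G \<phi> x * exp (E x)) = (LINT x|lborel. (\<Sum>z\<in>Z. (G z * exp (E z)) * (\<phi> (x - z) * exp (E (x - z)))))"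
    unfolding d sum_distrib_right mult.assoc e ..
  also have "\<dots> = (\<Sum>z\<in>Z. LINT x|lborel. (G z * exp (E z)) * (\<phi> (x - z) * exp (E (x - z))))"
    using bounded_supp_shift(1)[OF bounded_supp_exp[OF \<phi> E]] by (intro Bochner_Integration.integral_sum integrable_mult_right bounded_supp_integrable)
  also have "\<dots> = (\<Sum>z\<in>Z. (G z * exp (E z)) * (LINT x|lborel. \<phi> x * exp (E x)))"
    using integral_shift(2)[of "\<lambda>x. \<phi> x * exp (E x)"] by simp
  finally show ?thesis by (simp add: sum_distrib_right)
qed

context shift_module begin

text \<open>Summation by parts, with the supports of \<open>m\<close> and of its shift merged into
  one finite index set.\<close>

lemma pairing_D:
  fixes g :: "'a \<Rightarrow> complex"
  assumes "m \<in> W"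
  shows "(\<Sum>\<sigma> | D m \<sigma> \<noteq> 0. D m \<sigma> * g \<sigma>) = (\<Sum>\<sigma> | m \<sigma> \<noteq> 0. m \<sigma> * (g (\<sigma> + p) - g \<sigma>))"
proof -
  define Q where "Q = {\<sigma>. m \<sigma> \<noteq> 0}"
  have fin: "finite Q" using assms by (simp add: Q_def W_def)
  let ?Q' = "(\<lambda>\<sigma>. \<sigma> + p) ` Q"
  have nz: "\<sigma> \<in> ?Q'" if "m (\<sigma> - p) \<noteq> 0" for \<sigma> using that by (force simp: Q_def image_iff)
  have "(\<Sum>\<sigma> | D m \<sigma> \<noteq> 0. D m \<sigma> * g \<sigma>) = (\<Sum>\<sigma>\<in>?Q' \<union> Q. (m (\<sigma> - p) - m \<sigma>) * g \<sigma>)"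
    using fin nz by (intro sum.mono_neutral_cong_left) (auto simp: Y_def Q_def)
  also have "\<dots> = (\<Sum>\<sigma>\<in>?Q' \<union> Q. m (\<sigma> - p) * g \<sigma>) - (\<Sum>\<sigma>\<in>?Q' \<union> Q. m \<sigma> * g \<sigma>)"
    by (simp add: left_diff_distrib sum_subtractf)
  also have "(\<Sum>\<sigma>\<in>?Q' \<union> Q. m (\<sigma> - p) * g \<sigma>) = (\<Sum>\<sigma>\<in>?Q'. m (\<sigma> - p) * g \<sigma>)"
    using fin nz by (intro sum.mono_neutral_right) auto
  also have "\<dots> = (\<Sum>\<sigma>\<in>Q. m \<sigma> * g (\<sigma> + p))" by (subst sum.reindex) auto
  also have "(\<Sum>\<sigma>\<in>?Q' \<union> Q. m \<sigma> * g \<sigma>) = (\<Sum>\<sigma>\<in>Q. m \<sigma> * g \<sigma>)"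
    using fin by (intro sum.mono_neutral_right) (auto simp: Q_def)
  finally show ?thesis by (simp add: Q_def right_diff_distrib sum_subtractf)
qed

end

lemma (in shift_module) pairing_Dn:
  fixes g :: "'a \<Rightarrow> complex"
  assumes "m \<in> W"
  shows "(\<Sum>\<sigma> | (D ^^ n) m \<sigma> \<noteq> 0. (D ^^ n) m \<sigma> * g \<sigma>)
       = (\<Sum>\<sigma> | m \<sigma> \<noteq> 0. m \<sigma> * (shift_diff p ^^ n) g \<sigma>)"
proof (induction n arbitrary: g)
  case (Suc n g)
  have "(D ^^ n) m \<in> W" by (rule Dn_sub[OF submodule_W assms])
  then have "(\<Sum>\<sigma> | D ((D ^^ n) m) \<sigma> \<noteq> 0. D ((D ^^ n) m) \<sigma> * g \<sigma>)
      = (\<Sum>\<sigma> | (D ^^ n) m \<sigma> \<noteq> 0. (D ^^ n) m \<sigma> * shift_diff p g \<sigma>)"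
    unfolding shift_diff_apply by (rule pairing_D)
  also have "\<dots> = (\<Sum>\<sigma> | m \<sigma> \<noteq> 0. m \<sigma> * (shift_diff p ^^ n) (shift_diff p g) \<sigma>)" by (rule Suc.IH)
  also have "(shift_diff p ^^ n) (shift_diff p g) = (shift_diff p ^^ Suc n) g" by (simp add: funpow_swap1)
  finally show ?case by simp
qed simp

lemma cconv_at_0:
  assumes [measurable]: "f \<in> borel_measurable borel" "u \<in> borel_measurable borel"
  shows "cconv f u x = cconv (\<lambda>y. f (x + y)) u 0"
proof -
  have "(LINT y|lborel. f (y + x) * u (x - (y + x))) = (LINT y|lborel. f y * u (x - y))"
    by (rule integral_shift(1)[of "\<lambda>y. f y * u (x - y)"]) measurable
  then show ?thesis by (simp add: cconv_def add.commute)
qed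

text \<open>Repetitions in \<open>P\<close> are removed by choosing one representative per translate.\<close>

lemma linear_combination_translates:
  fixes \<phi> :: "'a::euclidean_space \<Rightarrow> real"
  assumes lc: "linear_combination_on X ((\<lambda>\<tau> x. \<phi> (x - \<tau>)) ` P) f"
    and P: "locally_finite_set P" and \<phi>: "\<And>x. \<phi> x \<noteq> 0 \<Longrightarrow> norm x \<le> R"
  obtains g where "\<And>x. x \<in> X \<Longrightarrow> complex_of_real (f x) = dsum P g (\<lambda>x. complex_of_real (\<phi> x)) x"
proof -
  let ?\<Phi> = "\<lambda>\<tau> x. \<phi> (x - \<tau>)"
  obtain c where c: "\<And>x. x \<in> X \<Longrightarrow> ((\<lambda>b. c b * b x) has_sum f x) (?\<Phi> ` P)"
    using lc unfolding linear_combination_on_def by blast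
  obtain P' where P': "P' \<subseteq> P" "inj_on ?\<Phi> P'" "?\<Phi> ` P = ?\<Phi> ` P'"
    using subset_image_inj[of "?\<Phi> ` P" ?\<Phi> P] by auto
  define g where "g \<tau> = (if \<tau> \<in> P' then complex_of_real (c (?\<Phi> \<tau>)) else 0)" for \<tau>
  have "complex_of_real (f x) = dsum P g (\<lambda>x. complex_of_real (\<phi> x)) x" if x: "x \<in> X" for x
  proof -
    let ?Q = "P' \<inter> cball x R"
    have fin: "finite ?Q" using P P'(1) unfolding locally_finite_set_def by (metis finite_subset Int_mono subset_refl)
    have "((\<lambda>\<tau>. c (?\<Phi> \<tau>) * \<phi> (x - \<tau>)) has_sum f x) P'"
      using c[OF x] unfolding P'(3) has_sum_reindex[OF P'(2)] by (simp add: o_def)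
    then have "((\<lambda>\<tau>. c (?\<Phi> \<tau>) * \<phi> (x - \<tau>)) has_sum f x) ?Q"
      by (subst (asm) has_sum_cong_neutral[where T="?Q" and g="\<lambda>\<tau>. c (?\<Phi> \<tau>) * \<phi> (x - \<tau>)"])
         (use \<phi> in \<open>auto simp: dist_norm\<close>)
    then have "f x = (\<Sum>\<tau>\<in>?Q. c (?\<Phi> \<tau>) * \<phi> (x - \<tau>))"
      using has_sum_finite[OF fin] has_sum_unique by blast
    then have "complex_of_real (f x) = (\<Sum>\<tau>\<in>?Q. g \<tau> * complex_of_real (\<phi> (x - \<tau>)))"
      by (simp add: g_def)
    also have "\<dots> = (\<Sum>\<tau>\<in>P \<inter> cball x R. g \<tau> * complex_of_real (\<phi> (x - \<tau>)))"
      using P P'(1) by (intro sum.mono_neutral_left) (auto simp: g_def locally_finite_set_def)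
    also have "\<dots> = dsum P g (\<lambda>x. complex_of_real (\<phi> x)) x"
      using P \<phi> by (intro dsum_eq[symmetric]) (auto simp: locally_finite_set_def dist_norm)
    finally show ?thesis .
  qed
  then show thesis using that by blast
qed

context root_like_lattice begin

text \<open>A maximal independent subset of \<open>L\<close> containing \<open>p\<close> serves as
  basis. It may generate a proper sublattice of \<open>L\<close>, but one of full rank and with
  \<open>s *\<^sub>R p\<close> among its vectors, which is what a lattice of periods has to
  provide.\<close>

lemma scaled_sublattice:
  assumes s: "0 < s"
  obtains B C :: "'a \<Rightarrow> 'a" where "lattice_torus B C" "s *\<^sub>R p \<in> lattice_torus.\<Gamma> C"
    "lattice_torus.\<Gamma> C \<subseteq> (*\<^sub>R) s ` L"
proof -
  have "independent {p}" using p_nz by simp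
  then obtain K where K: "{p} \<subseteq> K" "K \<subseteq> L" "independent K" "L \<subseteq> span K"
    using maximal_independent_subset_extend[of "{p}" L] p_L by auto
  have spK: "span K = UNIV" using K spanning span_mono[OF K(4)] by (simp add: span_span top_le)
  have fin: "finite K" using K(3) by (rule independent_imp_finite)
  have "card K = DIM('a)" using dim_eq_card[of K UNIV] K(3) spK by (simp add: dim_UNIV)
  then obtain b where b: "bij_betw b (Basis :: 'a set) K"
    using finite_same_card_bij[of "Basis :: 'a set" K] fin by auto
  define B where "B x = s *\<^sub>R (\<Sum>i\<in>Basis. (x \<bullet> i) *\<^sub>R b i)" for x
  have linB: "linear B" unfolding B_def
    by (intro linearI) (auto simp: inner_simps algebra_simps sum.distrib scaleR_sum_right)
  have Bi: "B i = s *\<^sub>R b i" if i: "i \<in> Basis" for i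
  proof -
    have "(\<Sum>j\<in>Basis. (i \<bullet> j) *\<^sub>R b j) = (\<Sum>j\<in>Basis. if j = i then b i else 0)"
      using i by (intro sum.cong) (auto simp: inner_Basis)
    then show ?thesis using i by (simp add: B_def)
  qed
  have "K \<subseteq> range B"
  proof
    fix k assume "k \<in> K"
    then obtain i where i: "i \<in> Basis" "k = b i" using b by (auto simp: bij_betw_def)
    have "B ((1 / s) *\<^sub>R i) = k" using Bi[OF i(1)] i s linear_scale[OF linB, of "1/s" i] by simp
    then show "k \<in> range B" by blast
  qed
  then have "span K \<subseteq> range B" using linear_subspace_image[OF linB subspace_UNIV] by (rule span_minimal)
  then have "surj B" using spK by auto
  then obtain C where C: "linear C" "\<And>x. C (B x) = x" "\<And>x. B (C x) = x"
    using linear_surjective_isomorphism[OF linB] by blast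
  interpret lattice_torus B C by (rule lattice_torus.intro[OF linB C(1,3,2)])
  show thesis
  proof (rule that)
    show "lattice_torus B C" by unfold_locales
    obtain i where i: "i \<in> Basis" "p = b i" using b K(1) by (auto simp: bij_betw_def)
    have "C (s *\<^sub>R p) = i" using Bi[OF i(1)] i(2) C(2)[of i] by simp
    then show "s *\<^sub>R p \<in> \<Gamma>" using i(1) by (simp add: \<Gamma>_def inner_Basis)
    show "\<Gamma> \<subseteq> (*\<^sub>R) s ` L"
    proof
      fix \<gamma> assume "\<gamma> \<in> \<Gamma>"
      then show "\<gamma> \<in> (*\<^sub>R) s ` L"
      proof (rule \<Gamma>_generated[rotated 3])
        show "B i \<in> (*\<^sub>R) s ` L" if "i \<in> Basis" for i
          using Bi[OF that] b K(2) that by (auto simp: bij_betw_def)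
        show "0 \<in> (*\<^sub>R) s ` L" using zero by force
        show "x - y \<in> (*\<^sub>R) s ` L" if x: "x \<in> (*\<^sub>R) s ` L" and y: "y \<in> (*\<^sub>R) s ` L" for x y
        proof -
          obtain x' where x': "x' \<in> L" "x = s *\<^sub>R x'" using x by blast
          obtain y' where y': "y' \<in> L" "y = s *\<^sub>R y'" using y by blast
          have "x - y = s *\<^sub>R (x' - y')" by (simp add: x' y' scaleR_diff_right)
          then show ?thesis using diff[OF x'(1) y'(1)] by blast
        qed
      qed
    qed
  qed
qed

end

section \<open>Coefficients of a refinement and the contradiction\<close>

context efficient_family begin

text \<open>\<open>n\<close> comes from the module of rows and is independent of \<open>g\<close>
  and \<open>u\<close>. A character orthogonal to all rows is excluded by
  \<open>scaled_cells_jump\<close>. In the other case the \<open>n\<close>-th difference of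
  \<open>g\<close> at a center is an integral of \<open>u\<close> against a test function that moves
  along with the center, and this vanishes far from the support of \<open>u\<close>.\<close>

lemma finite_difference_row:
  fixes s :: real and w :: 'a and j :: nat
  assumes s: "0 < s"
  defines "P \<equiv> (\<lambda>c. s *\<^sub>R c + w) ` centers"
    and "f \<equiv> indicator ((*\<^sub>R) s ` V) :: 'a \<Rightarrow> complex"
  defines "\<phi> \<equiv> (cconv f ^^ j) f"
  shows "\<exists>n. (\<forall>g u. u \<in> borel_measurable borel \<longrightarrow> bounded {x. u x \<noteq> 0} \<longrightarrow>
      (AE x in lborel. u x = dsum P g \<phi> x) \<longrightarrow> finite {\<tau> \<in> P. (shift_diff (s *\<^sub>R p) ^^ n) g \<tau> \<noteq> 0})"
proof -
  obtain B C where BC: "lattice_torus B C" and p\<Gamma>: "s *\<^sub>R p \<in> lattice_torus.\<Gamma> C"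
    and submodule\<Gamma>: "lattice_torus.\<Gamma> C \<subseteq> (*\<^sub>R) s ` L" using scaled_sublattice[OF s] by blast
  interpret LT: lattice_torus B C by fact
  have P: "locally_finite_set P" unfolding P_def by (rule locally_finite_affine_image[OF locally_finite_centers s])
  have shift: "\<tau> + \<gamma> \<in> P" if "\<tau> \<in> P" "\<gamma> \<in> LT.\<Gamma>" for \<tau> \<gamma>
  proof -
    obtain c q where "c \<in> centers" "\<tau> = s *\<^sub>R c + w" "q \<in> L" "\<gamma> = s *\<^sub>R q" using \<open>\<tau> \<in> P\<close> \<open>\<gamma> \<in> LT.\<Gamma>\<close> submodule\<Gamma> by (auto simp: P_def)
    then have "\<tau> + \<gamma> = s *\<^sub>R (c + q) + w" "c + q \<in> centers" using centers_shift by (auto simp: algebra_simps)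
    then show ?thesis unfolding P_def by blast
  qed
  have shift': "\<tau> \<in> P \<longleftrightarrow> \<tau> + \<gamma> \<in> P" if "\<gamma> \<in> LT.\<Gamma>" for \<tau> \<gamma>
    using shift[of \<tau> \<gamma>] shift[of "\<tau> + \<gamma>" "- \<gamma>"] LT.\<Gamma>_minus[OF that] that by auto
  \<comment> \<open>The centers in one fundamental cell represent all orbits under the
    periods.\<close>
  define R where "R = P \<inter> LT.Dom"
  have finR: "finite R"
  proof -
    obtain \<rho> where "\<And>x. x \<in> LT.Dom \<Longrightarrow> norm x \<le> \<rho>" using LT.bounded_Dom by (auto simp: bounded_iff)
    then have "R \<subseteq> P \<inter> cball 0 \<rho>" by (auto simp: R_def)
    then show ?thesis using P finite_subset unfolding locally_finite_set_def by blast
  qed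
  interpret SM: shift_module P LT.\<Gamma> R "s *\<^sub>R p"
  proof
    show "countable P" by (rule locally_finite_countable[OF P])
    show "finite R" "R \<subseteq> P" using finR by (auto simp: R_def)
    show "\<exists>\<rho>\<in>R. \<exists>\<gamma>\<in>LT.\<Gamma>. \<tau> = \<rho> + \<gamma>" if "\<tau> \<in> P" for \<tau>
    proof -
      have "\<tau> - LT.lattice_floor \<tau> \<in> P" using shift[OF that LT.\<Gamma>_minus[OF LT.lattice_floor_\<Gamma>[of \<tau>]]] by simp
      then have "\<tau> - LT.lattice_floor \<tau> \<in> R" using LT.diff_lattice_floor_Dom by (simp add: R_def)
      moreover have "\<tau> = (\<tau> - LT.lattice_floor \<tau>) + LT.lattice_floor \<tau>" by simp
      ultimately show ?thesis using LT.lattice_floor_\<Gamma> by blast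
    qed
  qed (use shift p\<Gamma> in auto)
  have cU: "compact ((*\<^sub>R) s ` V)" using compact_V by (rule compact_scaling)
  have f: "bounded_supp f" unfolding f_def using cU by (intro bounded_supp_indicator) (auto simp: compact_imp_closed compact_imp_bounded)
  have \<phi>: "bounded_supp \<phi>" unfolding \<phi>_def by (rule bounded_supp_cpow[OF f])
  obtain S0 where S0: "\<And>x. \<phi> x \<noteq> 0 \<Longrightarrow> norm x \<le> S0" using \<phi> bounded_supp_support by metis
  \<comment> \<open>Shifting a test function shifts its row, so the rows form a submodule.\<close>
  define N where "N = {row P \<phi> \<psi> |\<psi>. bounded_supp \<psi>}"
  have row_shift: "SM.sh \<gamma> (row P \<phi> \<psi>) = row P \<phi> (\<lambda>x. \<psi> (x - \<gamma>))" if "\<gamma> \<in> LT.\<Gamma>" "bounded_supp \<psi>" for \<gamma> \<psi>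
  proof
    fix \<tau>
    note [measurable] = bounded_supp_measurable[OF \<phi>] bounded_supp_measurable[OF that(2)]
    have "(LINT x|lborel. \<psi> (x - \<gamma>) * \<phi> (x - \<gamma> - (\<tau> - \<gamma>))) = (LINT x|lborel. \<psi> x * \<phi> (x - (\<tau> - \<gamma>)))"
      by (rule integral_shift(2)[of "\<lambda>x. \<psi> x * \<phi> (x - (\<tau> - \<gamma>))"]) measurable
    moreover have "\<tau> - \<gamma> \<in> P \<longleftrightarrow> \<tau> \<in> P" using shift'[OF that(1), of "\<tau> - \<gamma>"] by simp
    ultimately show "SM.sh \<gamma> (row P \<phi> \<psi>) \<tau> = row P \<phi> (\<lambda>x. \<psi> (x - \<gamma>)) \<tau>"
      by (simp add: SM.sh_def row_def)
  qed
  have subN: "SM.submodule N" unfolding SM.submodule_def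
  proof (intro conjI ballI allI)
    show "N \<subseteq> SM.W"
    proof
      fix m assume "m \<in> N"
      then obtain \<psi> where m: "m = row P \<phi> \<psi>" "bounded_supp \<psi>" by (auto simp: N_def)
      obtain S1 where S1: "\<And>x. \<psi> x \<noteq> 0 \<Longrightarrow> norm x \<le> S1" using m(2) bounded_supp_support by metis
      have "{\<tau>. m \<tau> \<noteq> 0} \<subseteq> P \<inter> cball 0 (S1 + S0)"
        using row_support[OF S1 S0] by (auto simp: m)
      moreover have "finite (P \<inter> cball 0 (S1 + S0))" using P by (simp add: locally_finite_set_def)
      ultimately have "finite {\<tau>. m \<tau> \<noteq> 0}" "{\<tau>. m \<tau> \<noteq> 0} \<subseteq> P" by (blast intro: finite_subset)+
      then show "m \<in> SM.W" by (simp add: SM.W_def)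
    qed
    have "row P \<phi> (\<lambda>_. 0) = (\<lambda>_. 0)" by (auto simp: row_def)
    then show "(\<lambda>_. 0) \<in> N" using bounded_supp_zero unfolding N_def by force
  next
    fix m m' c assume "m \<in> N" "m' \<in> N"
    then obtain \<psi> \<psi>' where m: "m = row P \<phi> \<psi>" "bounded_supp \<psi>" "m' = row P \<phi> \<psi>'" "bounded_supp \<psi>'" by (auto simp: N_def)
    have int: "integrable lborel (\<lambda>x. \<psi> x * \<phi> (x - \<tau>))" "integrable lborel (\<lambda>x. c * (\<psi>' x * \<phi> (x - \<tau>)))" for \<tau>
      by (intro integrable_mult_right bounded_supp_integrable bounded_supp_mult m bounded_meas_shift bounded_supp_imp_bounded_meas \<phi>)+
    have "row P \<phi> (\<lambda>x. \<psi> x + c * \<psi>' x) = (\<lambda>\<tau>. m \<tau> + c * m' \<tau>)"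
    proof
      fix \<tau>
      have "(LINT x|lborel. (\<psi> x + c * \<psi>' x) * \<phi> (x - \<tau>)) = (LINT x|lborel. \<psi> x * \<phi> (x - \<tau>) + c * (\<psi>' x * \<phi> (x - \<tau>)))"
        by (simp add: algebra_simps)
      also have "\<dots> = (LINT x|lborel. \<psi> x * \<phi> (x - \<tau>)) + (LINT x|lborel. c * (\<psi>' x * \<phi> (x - \<tau>)))"
        by (rule Bochner_Integration.integral_add[OF int])
      finally show "row P \<phi> (\<lambda>x. \<psi> x + c * \<psi>' x) \<tau> = m \<tau> + c * m' \<tau>" by (simp add: row_def m)
    qed
    moreover have "bounded_supp (\<lambda>x. \<psi> x + c * \<psi>' x)" by (intro bounded_supp_add bounded_supp_cmult m)
    ultimately show "(\<lambda>\<tau>. m \<tau> + c * m' \<tau>) \<in> N" unfolding N_def by (metis (mono_tags, lifting) mem_Collect_eq)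
  next
    fix m \<gamma> assume "m \<in> N" "\<gamma> \<in> LT.\<Gamma>"
    then obtain \<psi> where m: "m = row P \<phi> \<psi>" "bounded_supp \<psi>" by (auto simp: N_def)
    show "SM.sh \<gamma> m \<in> N" using row_shift[OF \<open>\<gamma> \<in> LT.\<Gamma>\<close> m(2)] bounded_supp_shift(1)[OF m(2)] m(1) unfolding N_def by blast
  qed
  show ?thesis
  proof (rule SM.shift_module_alternative[OF subN])
    fix a \<eta> \<tau>\<^sub>0
    assume \<tau>\<^sub>0: "\<tau>\<^sub>0 \<in> P" "a \<tau>\<^sub>0 \<noteq> 0" and a: "\<And>\<tau> \<gamma>. \<tau> \<in> P \<Longrightarrow> \<gamma> \<in> LT.\<Gamma> \<Longrightarrow> a (\<tau> + \<gamma>) = \<eta> \<gamma> * a \<tau>"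
      and ne: "\<eta> (s *\<^sub>R p) \<noteq> 1" and kill: "\<And>m. m \<in> N \<Longrightarrow> (\<Sum>\<tau> | m \<tau> \<noteq> 0. m \<tau> * a \<tau>) = 0"
    \<comment> \<open>Orthogonality to the row of a reflected and shifted \<open>\<theta>\<close> is
      the vanishing of the smoothed combination at the point \<open>x\<close>.\<close>
    have z: "dsum P a (cconv \<phi> \<theta>) x = 0" if \<theta>: "bounded_supp \<theta>" for \<theta> x
    proof -
      let ?\<psi> = "\<lambda>y. \<theta> (x - y)"
      have \<psi>: "bounded_supp ?\<psi>" by (rule bounded_supp_shift(3)[OF \<theta>])
      have "dsum P a (cconv \<phi> \<theta>) x = cconv \<theta> (dsum P a \<phi>) x"
        using cconv_dsum[OF P \<theta> \<phi>] cconv_commute[OF \<theta> \<phi>] by metis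
      also have "\<dots> = cconv (\<lambda>y. \<theta> (x + y)) (dsum P a \<phi>) 0"
        by (rule cconv_at_0) (intro bounded_supp_measurable[OF \<theta>] dsum_measurable[OF P \<phi>])+
      also have "\<dots> = (\<Sum>\<tau> | row P \<phi> ?\<psi> \<tau> \<noteq> 0. row P \<phi> ?\<psi> \<tau> * a \<tau>)"
        unfolding row_pairing[OF P \<psi> \<phi>] by simp
      also have "\<dots> = 0" using \<psi> by (intro kill) (auto simp: N_def)
      finally show ?thesis .
    qed
    have "AE x in lborel. dsum P a (cconv f \<theta>) x = 0" if "bounded_supp \<theta>" for \<theta>
      by (rule LT.character_kernel_power[OF P shift a \<tau>\<^sub>0 f _ that]) (use z in \<open>auto simp: \<phi>_def\<close>)
    then have jump: "a (s *\<^sub>R c + w) = a (s *\<^sub>R (c + p) + w)" if "c \<in> centers" for c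
      using scaled_cells_jump[OF s, of w a c] that unfolding P_def f_def by blast
    obtain c where c: "c \<in> centers" "\<tau>\<^sub>0 = s *\<^sub>R c + w" using \<tau>\<^sub>0 by (auto simp: P_def)
    have "a (\<tau>\<^sub>0 + s *\<^sub>R p) = a \<tau>\<^sub>0" using jump[OF c(1)] c(2) by (simp add: algebra_simps)
    then show ?thesis using a[OF \<tau>\<^sub>0(1) p\<Gamma>] ne \<tau>\<^sub>0(2) by simp
  next
    fix n assume n: "\<And>\<rho>. \<rho> \<in> R \<Longrightarrow> (SM.D ^^ n) (SM.\<delta> \<rho>) \<in> N"
    then have "\<forall>\<rho>\<in>R. \<exists>\<psi>. bounded_supp \<psi> \<and> (SM.D ^^ n) (SM.\<delta> \<rho>) = row P \<phi> \<psi>" by (auto simp: N_def)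
    then obtain \<psi> where \<psi>: "\<And>\<rho>. \<rho> \<in> R \<Longrightarrow> bounded_supp (\<psi> \<rho>)" "\<And>\<rho>. \<rho> \<in> R \<Longrightarrow> (SM.D ^^ n) (SM.\<delta> \<rho>) = row P \<phi> (\<psi> \<rho>)"
      by metis
    have "finite {\<tau> \<in> P. (shift_diff (s *\<^sub>R p) ^^ n) g \<tau> \<noteq> 0}"
      if u: "u \<in> borel_measurable borel" "bounded {x. u x \<noteq> 0}" "AE x in lborel. u x = dsum P g \<phi> x" for g u
    proof -
      note [measurable] = u(1) dsum_measurable[OF P \<phi>, of g]
      \<comment> \<open>The test function found at \<open>\<rho>\<close> is transported to
        \<open>\<rho> + \<gamma>\<close> by a shift; under the integral the combination may be
        replaced by \<open>u\<close>, as they agree almost everywhere.\<close>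
      have val: "(shift_diff (s *\<^sub>R p) ^^ n) g (\<rho> + \<gamma>) = (LINT x|lborel. \<psi> \<rho> (- x - \<gamma>) * u (- x))"
        if \<rho>: "\<rho> \<in> R" and \<gamma>: "\<gamma> \<in> LT.\<Gamma>" for \<rho> \<gamma>
      proof -
        have \<tau>: "\<rho> + \<gamma> \<in> P" using shift \<rho> \<gamma> by (auto simp: R_def)
        have \<psi>': "bounded_supp (\<lambda>x. \<psi> \<rho> (x - \<gamma>))" using bounded_supp_shift(1)[OF \<psi>(1)[OF \<rho>]] .
        have [measurable]: "\<psi> \<rho> \<in> borel_measurable borel" by (rule bounded_supp_measurable[OF \<psi>(1)[OF \<rho>]])
        have D: "(SM.D ^^ n) (SM.\<delta> (\<rho> + \<gamma>)) = row P \<phi> (\<lambda>x. \<psi> \<rho> (x - \<gamma>))"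
          unfolding SM.\<delta>_shift SM.Dn_sh \<psi>(2)[OF \<rho>] by (rule row_shift[OF \<gamma> \<psi>(1)[OF \<rho>]])
        have "(shift_diff (s *\<^sub>R p) ^^ n) g (\<rho> + \<gamma>)
            = (\<Sum>\<sigma> | SM.\<delta> (\<rho> + \<gamma>) \<sigma> \<noteq> 0. SM.\<delta> (\<rho> + \<gamma>) \<sigma> * (shift_diff (s *\<^sub>R p) ^^ n) g \<sigma>)"
        proof -
          have "{\<sigma>. SM.\<delta> (\<rho> + \<gamma>) \<sigma> \<noteq> 0} = {\<rho> + \<gamma>}" by (auto simp: SM.\<delta>_def)
          then show ?thesis by (simp add: SM.\<delta>_def)
        qed
        also have "\<dots> = (\<Sum>\<sigma> | row P \<phi> (\<lambda>x. \<psi> \<rho> (x - \<gamma>)) \<sigma> \<noteq> 0. row P \<phi> (\<lambda>x. \<psi> \<rho> (x - \<gamma>)) \<sigma> * g \<sigma>)"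
          unfolding D[symmetric] using SM.pairing_Dn[OF SM.\<delta>_W[OF \<tau>], of n g] by simp
        also have "\<dots> = cconv (\<lambda>y. \<psi> \<rho> (- y - \<gamma>)) (dsum P g \<phi>) 0"
          using row_pairing[OF P \<psi>' \<phi>] by simp
        also have "\<dots> = (LINT x|lborel. \<psi> \<rho> (- x - \<gamma>) * dsum P g \<phi> (- x))"
          by (simp add: cconv_def)
        also have "\<dots> = (LINT x|lborel. \<psi> \<rho> (- x - \<gamma>) * u (- x))"
        proof (rule integral_cong_AE)
          have "AE x in lborel. u (0 + (- 1) *\<^sub>R x) = dsum P g \<phi> (0 + (- 1) *\<^sub>R x)"
            by (rule AE_lborel_affine_shift[OF u(3)]) simp
          then show "AE x in lborel. \<psi> \<rho> (- x - \<gamma>) * dsum P g \<phi> (- x) = \<psi> \<rho> (- x - \<gamma>) * u (- x)"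
            by eventually_elim simp
        qed measurable
        finally show ?thesis .
      qed
      obtain Ru where Ru: "\<And>x. u x \<noteq> 0 \<Longrightarrow> norm x \<le> Ru" using u(2) by (auto simp: bounded_iff)
      have "\<forall>\<rho>\<in>R. \<exists>S. \<forall>x. \<psi> \<rho> x \<noteq> 0 \<longrightarrow> norm x \<le> S" using \<psi>(1) bounded_supp_support by metis
      then obtain S1 where S1: "\<And>\<rho> x. \<rho> \<in> R \<Longrightarrow> \<psi> \<rho> x \<noteq> 0 \<Longrightarrow> norm x \<le> S1 \<rho>" by metis
      have "{\<tau> \<in> P. (shift_diff (s *\<^sub>R p) ^^ n) g \<tau> \<noteq> 0} \<subseteq> (\<Union>\<rho>\<in>R. P \<inter> cball \<rho> (Ru + S1 \<rho>))"
      proof safe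
        fix \<tau> assume \<tau>: "\<tau> \<in> P" "(shift_diff (s *\<^sub>R p) ^^ n) g \<tau> \<noteq> 0"
        obtain \<rho> \<gamma> where r: "\<rho> \<in> R" "\<gamma> \<in> LT.\<Gamma>" "\<tau> = \<rho> + \<gamma>" using SM.P_R[OF \<tau>(1)] by blast
        have "\<not> (\<forall>x. \<psi> \<rho> (- x - \<gamma>) * u (- x) = 0)"
        proof
          assume *: "\<forall>x. \<psi> \<rho> (- x - \<gamma>) * u (- x) = 0"
          show False using \<tau>(2) val[OF r(1,2)] unfolding r(3) *[rule_format] by simp
        qed
        then obtain x where "\<psi> \<rho> (- x - \<gamma>) \<noteq> 0" "u (- x) \<noteq> 0" by auto
        then have "norm (- x - \<gamma>) \<le> S1 \<rho>" "norm (- x) \<le> Ru" using S1[OF r(1)] Ru by blast+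
        then have "norm \<gamma> \<le> Ru + S1 \<rho>" using norm_triangle_ineq4[of "- x" "- x - \<gamma>"] by simp
        then show "\<tau> \<in> (\<Union>\<rho>\<in>R. P \<inter> cball \<rho> (Ru + S1 \<rho>))"
          using \<tau>(1) by (intro UN_I[OF r(1)]) (simp add: dist_norm r(3))
      qed
      moreover have "finite (\<Union>\<rho>\<in>R. P \<inter> cball \<rho> (Ru + S1 \<rho>))" 
        by (rule finite_UN_I[OF finR]) (use P in \<open>simp add: locally_finite_set_def\<close>)
      ultimately show ?thesis by (rule finite_subset)
    qed
    then show ?thesis by (intro exI[of _ n]) auto
  qed
qed

lemma laplace_indicator_V: "(LINT x|lborel. indicator V x * exp (complex_of_real (t * (x \<bullet> p)))) = complex_of_real (F t)"
proof -
  have "indicator V x * exp (complex_of_real (t * (x \<bullet> p))) = complex_of_real (indicator V x * exp (t * (x \<bullet> p)))" for x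
    unfolding exp_of_real by (simp add: indicator_def)
  then show ?thesis unfolding F_def by (simp only: integral_complex_of_real)
qed

lemma laplace_indicator_scaled:
  assumes s: "0 < s"
  shows "(LINT x|lborel. indicator ((*\<^sub>R) s ` V) x * exp (complex_of_real (t * (x \<bullet> p))))
    = complex_of_real (s ^ DIM('a) * F (s * t))"
proof -
  let ?h = "\<lambda>x. indicator ((*\<^sub>R) s ` V) x * exp (complex_of_real (t * (x \<bullet> p)))"
  have [measurable]: "(*\<^sub>R) s ` V \<in> sets borel"
    using compact_scaling[OF compact_V, of s] by (simp add: compact_imp_closed)
  have e: "?h (0 + s *\<^sub>R x) = indicator V x * exp (complex_of_real (s * t * (x \<bullet> p)))" for x
  proof -
    have "s *\<^sub>R x \<in> (*\<^sub>R) s ` V \<longleftrightarrow> x \<in> V" using s by (auto simp: image_iff)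
    then show ?thesis by (simp add: indicator_def mult_ac)
  qed
  have "(LINT x|lborel. ?h x) = \<bar>s\<bar> ^ DIM('a) *\<^sub>R (LINT x|lborel. ?h (0 + s *\<^sub>R x))"
    by (rule integral_affine) (use s in auto)
  also have "\<dots> = \<bar>s\<bar> ^ DIM('a) *\<^sub>R complex_of_real (F (s * t))"
    unfolding e laplace_indicator_V ..
  finally show ?thesis using s by (simp add: scaleR_conv_of_real)
qed

lemma linear_exponent: "linear (\<lambda>x. complex_of_real (t * (x \<bullet> p)))"
  by (intro linearI) (auto simp: inner_simps algebra_simps scaleR_conv_of_real)

text \<open>Cells are convex and countable in number, and frontiers of convex sets are negligible.
  For order 1 this turns the equation off the boundaries into one that holds almost everywhere, the
  form in which all orders are treated.\<close>

lemma AE_off_boundaries: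
  "AE x in lborel. x \<notin> (\<Union>C \<in> (\<Union>j\<le>J. affine_tessellation 1 (v j) (voronoi_tessellation L)
      \<union> affine_tessellation s w (affine_tessellation 1 (v j) (voronoi_tessellation L))). frontier C)"
proof -
  let ?T = "\<lambda>j. affine_tessellation 1 (v j) (voronoi_tessellation L)"
  have conv: "convex ((\<lambda>x. s' *\<^sub>R x + w') ` C)" if "convex C" for s' w' and C :: "'a set"
  proof -
    have "(\<lambda>x. s' *\<^sub>R x + w') ` C = (+) w' ` ((*\<^sub>R) s' ` C)" by (auto simp: image_image add.commute)
    then show ?thesis using that by (simp add: convex_scaling convex_translation)
  qed
  have V: "convex C" if "C \<in> voronoi_tessellation L" for C
    using that convex_V by (auto simp: voronoi_tessellation_def voronoi_cell_eq convex_translation)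
  have T: "convex C" if "C \<in> affine_tessellation s' w' \<T>" "\<And>C. C \<in> \<T> \<Longrightarrow> convex C" for C s' w' and \<T> :: "'a set set"
    using that conv by (auto simp: affine_tessellation_def)
  have cL: "countable L" by (rule locally_finite_countable[OF locally_finite_L])
  let ?C = "\<Union>j\<le>J. ?T j \<union> affine_tessellation s w (?T j)"
  have "countable ?C"
    using cL by (auto simp: affine_tessellation_def voronoi_tessellation_def intro!: countable_UN)
  moreover have "convex C" if "C \<in> ?C" for C
    using that T[where \<T>="voronoi_tessellation L"] T[where \<T>="?T _"] V by blast
  ultimately have "negligible (\<Union>(frontier ` ?C))"
    by (intro negligible_countable_Union) (auto intro: negligible_convex_frontier)
  then have "\<Union>(frontier ` ?C) \<in> null_sets lebesgue" by (simp add: negligible_iff_null_sets)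
  then have "AE x in lebesgue. x \<notin> \<Union>(frontier ` ?C)" by (rule AE_not_in)
  then show ?thesis by (simp add: AE_completion_iff)
qed

text \<open>Coefficients \<open>g\<close> of the spline centered at \<open>v 0\<close> become
  finitely supported after \<open>n\<close> differences. Both sides then have Laplace transforms in
  direction \<open>p\<close>, and comparing them gives a relation excluded by
  \<open>no_scaling_relation\<close>.\<close>

theorem not_refined:
  assumes s: "0 < s" "s < 1" and k: "1 \<le> k"
  shows "\<not> refined_by L J v k s w"
proof
  assume ref: "refined_by L J v k s w"
  let ?T = "\<lambda>j. affine_tessellation 1 (v j) (voronoi_tessellation L)"
  let ?U = "(*\<^sub>R) s ` V"
  define bd where "bd = (\<Union>C \<in> (\<Union>j\<le>J. ?T j \<union> affine_tessellation s w (?T j)). frontier C)"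
  define X where "X = (if k = 1 then - bd else UNIV)"
  define P where "P = (\<lambda>c. s *\<^sub>R c + w) ` centers"
  define \<phi>r where "\<phi>r = conv_power (indicat_real ?U) k"
  define fr where "fr = conv_power (indicat_real V) k"
  have P: "locally_finite_set P" unfolding P_def by (rule locally_finite_affine_image[OF locally_finite_centers s(1)])
  have ref': "\<forall>j\<le>J. \<forall>f\<in>shifted_splines k V ((\<lambda>p. p + v j) ` L).
      linear_combination_on X (\<Union>i\<le>J. shifted_splines k ?U ((\<lambda>p. s *\<^sub>R (p + v i) + w) ` L)) f"
    using ref unfolding refined_by_def Let_def V_def[symmetric] X_def bd_def .
  have B: "(\<Union>i\<le>J. shifted_splines k ?U ((\<lambda>p. s *\<^sub>R (p + v i) + w) ` L)) = (\<lambda>\<tau> x. \<phi>r (x - \<tau>)) ` P"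
    unfolding shifted_splines_def P_def centers_def \<phi>r_def by (auto simp: image_image image_UN)
  have f0: "(\<lambda>x. fr (x - v 0)) \<in> shifted_splines k V ((\<lambda>p. p + v 0) ` L)"
    unfolding shifted_splines_def fr_def using zero by (force simp: image_iff)
  have lc: "linear_combination_on X ((\<lambda>\<tau> x. \<phi>r (x - \<tau>)) ` P) (\<lambda>x. fr (x - v 0))"
    using ref'[rule_format, OF le0 f0] unfolding B .
  define j where "j = k - 1"
  have jk: "Suc j = k" using k by (simp add: j_def)
  define fU where "fU = (indicator ?U :: 'a \<Rightarrow> complex)"
  define fV where "fV = (indicator V :: 'a \<Rightarrow> complex)"
  define \<phi> where "\<phi> = (cconv fU ^^ j) fU"
  have \<phi>r: "complex_of_real (\<phi>r x) = \<phi> x" for x unfolding \<phi>r_def \<phi>_def fU_def j_def by (rule conv_power_complex)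
  have cU: "compact ?U" using compact_V by (rule compact_scaling)
  have fU: "bounded_supp fU" unfolding fU_def using cU by (intro bounded_supp_indicator) (auto simp: compact_imp_closed compact_imp_bounded)
  have fV: "bounded_supp fV" unfolding fV_def using compact_V by (intro bounded_supp_indicator) (auto simp: compact_imp_closed compact_imp_bounded)
  have \<phi>: "bounded_supp \<phi>" unfolding \<phi>_def by (rule bounded_supp_cpow[OF fU])
  define u where "u x = (cconv fV ^^ j) fV (x - v 0)" for x
  have u: "bounded_supp u" unfolding u_def by (rule bounded_supp_shift(1)[OF bounded_supp_cpow[OF fV]])
  have fr: "complex_of_real (fr (x - v 0)) = u x" for x unfolding fr_def u_def fV_def j_def by (rule conv_power_complex)
  obtain Rp where Rp: "\<And>x. \<phi> x \<noteq> 0 \<Longrightarrow> norm x \<le> Rp" using \<phi> bounded_supp_support by metis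
  have Rr: "norm x \<le> Rp" if "\<phi>r x \<noteq> 0" for x using Rp[of x] that by (simp flip: \<phi>r)
  obtain g where g: "\<And>x. x \<in> X \<Longrightarrow> u x = dsum P g \<phi> x"
    using linear_combination_translates[OF lc P Rr] unfolding fr \<phi>r by blast
  have "AE x in lborel. x \<in> X"
    using AE_off_boundaries[of s w] unfolding X_def bd_def by (auto elim!: eventually_mono)
  then have AEu: "AE x in lborel. u x = dsum P g \<phi> x" by eventually_elim (rule g)
  obtain n where n: "finite {\<tau> \<in> P. (shift_diff (s *\<^sub>R p) ^^ n) g \<tau> \<noteq> 0}"
  proof -
    have "bounded {x. u x \<noteq> 0}" using u by (simp add: bounded_supp_def)
    then show thesis
      using finite_difference_row[OF s(1), of w j, folded P_def fU_def, folded \<phi>_def] bounded_supp_measurable[OF u] AEu that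
      by blast
  qed
  define G where "G = (shift_diff (s *\<^sub>R p) ^^ n) g"
  define Z where "Z = {\<tau> \<in> P. G \<tau> \<noteq> 0}"
  have Z: "finite Z" "Z \<subseteq> P" using n by (auto simp: Z_def G_def)
  have ZG: "\<tau> \<in> Z" if "\<tau> \<in> P" "G \<tau> \<noteq> 0" for \<tau> using that by (simp add: Z_def)
  have Pp: "\<tau> \<in> P \<longleftrightarrow> \<tau> + s *\<^sub>R p \<in> P" for \<tau>
  proof -
    have 1: "\<tau> + s *\<^sub>R q \<in> P" if "\<tau> \<in> P" "q \<in> L" for \<tau> q
    proof -
      obtain c where "c \<in> centers" "\<tau> = s *\<^sub>R c + w" using \<open>\<tau> \<in> P\<close> by (auto simp: P_def)
      then have "\<tau> + s *\<^sub>R q = s *\<^sub>R (c + q) + w" "c + q \<in> centers" using centers_shift \<open>q \<in> L\<close> by (auto simp: algebra_simps)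
      then show ?thesis unfolding P_def by blast
    qed
    show ?thesis using 1[of \<tau> p] 1[of "\<tau> + s *\<^sub>R p" "- p"] p_L minus by auto
  qed
  have AEG: "AE x in lborel. (shift_diff (s *\<^sub>R p) ^^ n) u x = dsum P G \<phi> x"
    using AE_shift_diff[OF AEu, where p="s *\<^sub>R p" and n=n] unfolding G_def dsum_shift_diff[OF Pp] .
  have rel: "(exp (- (s * (p \<bullet> p) * t)) - 1) ^ n * F t ^ k
      = (s ^ DIM('a)) ^ k * F (s * t) ^ k * (\<Sum>z\<in>Z. Re (G z) * exp (t * ((z - v 0) \<bullet> p)))" for t
  proof -
    define E where "E x = complex_of_real (t * (x \<bullet> p))" for x :: 'a
    have E: "linear E" unfolding E_def by (rule linear_exponent)
    have E0: "exp (E x) = complex_of_real (exp (t * (x \<bullet> p)))" for x unfolding E_def exp_of_real ..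
    have Lu: "(LINT x|lborel. u x * exp (E x)) = exp (E (v 0)) * complex_of_real (F t ^ k)"
    proof -
      have [measurable]: "(\<lambda>x. (cconv fV ^^ j) fV x * exp (E x)) \<in> borel_measurable borel"
        by (intro bounded_supp_measurable bounded_supp_exp bounded_supp_cpow fV E)
      have "u x * exp (E x) = exp (E (v 0)) * ((cconv fV ^^ j) fV (x - v 0) * exp (E (x - v 0)))" for x
        using linear_diff[OF E, of x "v 0"] by (simp add: u_def exp_diff)
      then have "(LINT x|lborel. u x * exp (E x)) = exp (E (v 0)) * (LINT x|lborel. (cconv fV ^^ j) fV x * exp (E x))"
        using integral_shift(2)[of "\<lambda>x. (cconv fV ^^ j) fV x * exp (E x)" "v 0"] by simp
      also have "(LINT x|lborel. (cconv fV ^^ j) fV x * exp (E x)) = complex_of_real (F t ^ k)"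
        unfolding laplace_cpow[OF fV E] jk unfolding fV_def E_def laplace_indicator_V by simp
      finally show ?thesis .
    qed
    have L\<phi>: "(LINT x|lborel. \<phi> x * exp (E x)) = complex_of_real ((s ^ DIM('a) * F (s * t)) ^ k)"
      unfolding \<phi>_def laplace_cpow[OF fU E] jk unfolding fU_def E_def laplace_indicator_scaled[OF s(1)] by simp
    have LG: "(LINT x|lborel. dsum P G \<phi> x * exp (E x)) = (\<Sum>z\<in>Z. G z * exp (E z)) * (LINT x|lborel. \<phi> x * exp (E x))"
      by (rule laplace_finite_dsum[OF P \<phi> E Z]) (rule ZG)
    have "(LINT x|lborel. (shift_diff (s *\<^sub>R p) ^^ n) u x * exp (E x)) = (LINT x|lborel. dsum P G \<phi> x * exp (E x))"
    proof (rule integral_cong_AE)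
      have mE: "(\<lambda>x. exp (E x)) \<in> borel_measurable borel"
        unfolding E_def by (intro borel_measurable_continuous_onI continuous_intros)
      show "(\<lambda>x. (shift_diff (s *\<^sub>R p) ^^ n) u x * exp (E x)) \<in> borel_measurable lborel"
        using bounded_supp_measurable[OF bounded_supp_shift_diff[OF u]] mE by simp
      show "(\<lambda>x. dsum P G \<phi> x * exp (E x)) \<in> borel_measurable lborel"
        using dsum_measurable[OF P \<phi>] mE by simp
      show "AE x in lborel. (shift_diff (s *\<^sub>R p) ^^ n) u x * exp (E x) = dsum P G \<phi> x * exp (E x)"
        using AEG by eventually_elim simp
    qed
    then have 1: "(exp (- E (s *\<^sub>R p)) - 1) ^ n * (exp (E (v 0)) * complex_of_real (F t ^ k))
        = (\<Sum>z\<in>Z. G z * exp (E z)) * complex_of_real ((s ^ DIM('a) * F (s * t)) ^ k)"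
      unfolding laplace_shift_diff[OF u E] Lu LG L\<phi> .
    \<comment> \<open>The factor caused by the position \<open>v 0\<close> of the spline is moved
      into the exponents of the sum.\<close>
    have "(exp (- E (s *\<^sub>R p)) - 1) ^ n * complex_of_real (F t ^ k)
        = exp (- E (v 0)) * ((exp (- E (s *\<^sub>R p)) - 1) ^ n * (exp (E (v 0)) * complex_of_real (F t ^ k)))"
      by (simp add: exp_minus)
    also have "\<dots> = (\<Sum>z\<in>Z. G z * exp (E (z - v 0))) * complex_of_real ((s ^ DIM('a) * F (s * t)) ^ k)"
      unfolding 1 by (simp add: linear_diff[OF E] exp_diff exp_minus sum_distrib_left sum_distrib_right field_simps)
    finally have 2: "(exp (- E (s *\<^sub>R p)) - 1) ^ n * complex_of_real (F t ^ k)
        = (\<Sum>z\<in>Z. G z * exp (E (z - v 0))) * complex_of_real ((s ^ DIM('a) * F (s * t)) ^ k)" .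
    have 3: "exp (- E (s *\<^sub>R p)) = complex_of_real (exp (- (s * (p \<bullet> p) * t)))"
      using E0[of "- (s *\<^sub>R p)"] linear_neg[OF E, of "s *\<^sub>R p"] by (simp add: mult_ac)
    have "complex_of_real ((exp (- (s * (p \<bullet> p) * t)) - 1) ^ n * F t ^ k)
        = (\<Sum>z\<in>Z. G z * complex_of_real (exp (t * ((z - v 0) \<bullet> p)))) * complex_of_real ((s ^ DIM('a) * F (s * t)) ^ k)"
      using 2 unfolding 3 E0 by simp
    \<comment> \<open>Only the coefficients \<open>G z\<close> may fail to be real, so taking real
      parts gives a relation between real functions.\<close>
    then have "Re (complex_of_real ((exp (- (s * (p \<bullet> p) * t)) - 1) ^ n * F t ^ k))
        = Re ((\<Sum>z\<in>Z. G z * complex_of_real (exp (t * ((z - v 0) \<bullet> p)))) * complex_of_real ((s ^ DIM('a) * F (s * t)) ^ k))"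
      by (rule arg_cong)
    then have "(exp (- (s * (p \<bullet> p) * t)) - 1) ^ n * F t ^ k
        = (\<Sum>z\<in>Z. Re (G z) * exp (t * ((z - v 0) \<bullet> p))) * (s ^ DIM('a) * F (s * t)) ^ k"
      by (simp only: Re_complex_of_real times_complex.sel Im_complex_of_real mult_zero_right diff_zero Re_sum)
    then show ?thesis by (simp add: power_mult_distrib mult_ac)
  qed
  show False
    by (rule no_scaling_relation[OF s k _ Z(1), of "s * (p \<bullet> p)" n "(s ^ DIM('a)) ^ k" "\<lambda>z. Re (G z)" "\<lambda>z. (z - v 0) \<bullet> p"])
       (use s p_nz rel in auto)
qed

end

section \<open>Root lattices\<close>

text \<open>The conditions of \<open>root_like_lattice\<close> apart from spanning, since the
  standard models may live in a proper subspace of their coordinate space.\<close>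

definition skew_pair :: "'a::euclidean_space set \<Rightarrow> 'a \<Rightarrow> 'a \<Rightarrow> bool" where
  "skew_pair M p r \<longleftrightarrow> 0 \<in> M \<and> (\<forall>x\<in>M. \<forall>y\<in>M. x - y \<in> M) \<and> (\<exists>m>0. \<forall>x\<in>M. x \<noteq> 0 \<longrightarrow> m \<le> norm x)
    \<and> p \<in> M \<and> p \<noteq> 0 \<and> r \<in> M \<and> (\<forall>q\<in>M. q \<noteq> 0 \<longrightarrow> q \<noteq> p \<longrightarrow> q \<bullet> p < q \<bullet> q)
    \<and> (\<forall>q\<in>M. q \<bullet> r \<le> q \<bullet> q) \<and> 0 < r \<bullet> p \<and> r \<bullet> p < p \<bullet> p"

text \<open>A similarity multiplies all inner products by the same positive factor, and every
  condition is homogeneous. Spanning is gained because \<open>f\<close> is injective and its range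
  is exactly the span of \<open>M\<close>.\<close>

lemma similar_skew_pair:
  fixes L :: "'a::euclidean_space set" and M :: "'b::euclidean_space set"
  assumes sim: "similar_lattice L M" and ex: "\<exists>P R. skew_pair M P R"
  shows "\<exists>p r. root_like_lattice L p r"
proof -
  obtain P R where M: "skew_pair M P R" using ex by blast
  obtain f c where f: "linear f" "c > 0" "\<And>x. norm (f x) = c * norm x" "range f = span M" "f ` L = M"
    using sim unfolding similar_lattice_def by blast
  \<comment> \<open>Polarization: only norms are known to scale.\<close>
  have inner: "f x \<bullet> f y = c\<^sup>2 * (x \<bullet> y)" for x y
  proof -
    have sq: "f z \<bullet> f z = c\<^sup>2 * (z \<bullet> z)" for z
      using f(3)[of z] by (metis power2_norm_eq_inner power_mult_distrib)
    have "(f x + f y) \<bullet> (f x + f y) = c\<^sup>2 * ((x + y) \<bullet> (x + y))" using sq[of "x + y"] linear_add[OF f(1)] by simp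
    then show ?thesis using sq[of x] sq[of y] by (simp add: inner_add_left inner_add_right inner_commute algebra_simps)
  qed
  have inj: "x = y" if "f x = f y" for x y
  proof -
    have "norm (f (x - y)) = 0" using that linear_diff[OF f(1)] by simp
    then show ?thesis using f(2,3) by simp
  qed
  have mem: "f x \<in> M \<longleftrightarrow> x \<in> L" for x using f(5) inj by (metis imageE imageI)
  have f0: "f 0 = 0" by (rule linear_0[OF f(1)])
  have c2: "0 < c\<^sup>2" using f(2) by simp
  obtain p r where pr: "p \<in> L" "f p = P" "r \<in> L" "f r = R" using M f(5) unfolding skew_pair_def by blast
  have "root_like_lattice L p r"
  proof
    show "0 \<in> L" using mem[of 0] M f0 by (simp add: skew_pair_def)
    show "x - y \<in> L" if "x \<in> L" "y \<in> L" for x y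
      using M that mem linear_diff[OF f(1), of x y] unfolding skew_pair_def by metis
    obtain m where m: "m > 0" "\<And>x. x \<in> M \<Longrightarrow> x \<noteq> 0 \<Longrightarrow> m \<le> norm x" using M unfolding skew_pair_def by blast
    have "m / c \<le> norm x" if "x \<in> L" "x \<noteq> 0" for x
      using m(2)[of "f x"] mem[of x] that inj[of x 0] f0 f(2,3) by (auto simp: field_simps)
    then show "\<exists>m>0. \<forall>x\<in>L. x \<noteq> 0 \<longrightarrow> m \<le> norm x" using m(1) f(2) by (intro exI[of _ "m / c"]) auto
    show "span L = UNIV"
    proof -
      have "f ` span L = range f" using linear_span_image[OF f(1), of L] f(4,5) by simp
      then have "x \<in> span L" for x using inj by (metis imageE rangeI)
      then show ?thesis by blast
    qed
    show "p \<in> L" "r \<in> L" by fact+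
    show "p \<noteq> 0" using M pr f0 by (auto simp: skew_pair_def)
    show "q \<bullet> p < q \<bullet> q" if "q \<in> L" "q \<noteq> 0" "q \<noteq> p" for q
    proof -
      have "f q \<bullet> P < f q \<bullet> f q" using M that mem[of q] inj[of q 0] inj[of q p] f0 pr(2) unfolding skew_pair_def by metis
      then show ?thesis using c2 unfolding pr(2)[symmetric] inner by simp
    qed
    show "q \<bullet> r \<le> q \<bullet> q" if "q \<in> L" for q
    proof -
      have "f q \<bullet> R \<le> f q \<bullet> f q" using M that mem[of q] unfolding skew_pair_def by blast
      then show ?thesis using c2 unfolding pr(4)[symmetric] inner by simp
    qed
    have "0 < R \<bullet> P" "R \<bullet> P < P \<bullet> P" using M by (auto simp: skew_pair_def)
    then show "0 < r \<bullet> p" "r \<bullet> p < p \<bullet> p"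
      using c2 unfolding pr(2)[symmetric] pr(4)[symmetric] inner by (simp_all add: zero_less_mult_iff)
  qed
  then show ?thesis by blast
qed

section \<open>Even lattices and their roots\<close>

text \<open>Nonzero vectors of an even lattice have squared norm at least 2. Applied to
  \<open>q - u\<close> for a root \<open>u\<close>, this gives
  \<open>2 * (q \<bullet> u) \<le> q \<bullet> q\<close>, so every root is a facet vector and has
  its half in the cell. Two roots at an angle of 60 degrees then form a skew pair.\<close>

lemma even_lattice_skew_pair:
  assumes "0 \<in> M" "\<And>x y. x \<in> M \<Longrightarrow> y \<in> M \<Longrightarrow> x - y \<in> M"
    and even: "\<And>x. x \<in> M \<Longrightarrow> (x \<bullet> x) / 2 \<in> \<int>"
    and p: "p \<in> M" "p \<bullet> p = 2" and r: "r \<in> M" "r \<bullet> r = 2" "r \<bullet> p = 1"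
  shows "skew_pair M p r"
proof -
  have two: "2 \<le> x \<bullet> x" if "x \<in> M" "x \<noteq> 0" for x
  proof -
    have "(x \<bullet> x) / 2 > 0" using that by simp
    then have "1 \<le> \<bar>(x \<bullet> x) / 2\<bar>" using even[OF that(1)] Ints_nonzero_abs_ge1 by (metis less_numeral_extra(3))
    then show ?thesis by simp
  qed
  have strict: "q \<bullet> u < q \<bullet> q" if "q \<in> M" "q \<noteq> 0" "q \<noteq> u" "u \<in> M" "u \<bullet> u = 2" for q u
  proof -
    have "2 \<le> (q - u) \<bullet> (q - u)" using two[of "q - u"] assms(2) that by simp
    then have "2 * (q \<bullet> u) \<le> q \<bullet> q" using that(5) by (simp add: inner_diff_left inner_diff_right inner_commute)
    then show ?thesis using two[OF that(1,2)] by linarith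
  qed
  have "1 \<le> norm x" if "x \<in> M" "x \<noteq> 0" for x
    using two[OF that] by (simp add: norm_eq_sqrt_inner)
  then have "\<exists>m>0. \<forall>x\<in>M. x \<noteq> 0 \<longrightarrow> m \<le> norm x" by (intro exI[of _ 1]) auto
  moreover have "q \<bullet> r \<le> q \<bullet> q" if "q \<in> M" for q
    using strict[OF that _ _ r(1,2)] r(2) by (cases "q = 0 \<or> q = r") (auto simp: less_imp_le)
  ultimately show ?thesis
    unfolding skew_pair_def using assms strict[OF _ _ _ p] by auto
qed

lemma Ints_square_plus: fixes x :: real assumes "x \<in> \<int>" shows "0 \<le> x\<^sup>2 + x" "x \<noteq> 0 \<Longrightarrow> x \<noteq> - 1 \<Longrightarrow> 0 < x\<^sup>2 + x"
proof -
  obtain k where k: "x = of_int k" using assms by (auto elim: Ints_cases)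
  have e: "x\<^sup>2 + x = of_int (k * (k + 1))" by (simp add: k power2_eq_square algebra_simps)
  have "0 \<le> k * (k + 1)" by (cases "0 \<le> k") (auto simp: zero_le_mult_iff)
  then show "0 \<le> x\<^sup>2 + x" unfolding e by (simp only: of_int_0_le_iff)
  assume "x \<noteq> 0" "x \<noteq> - 1"
  then have "k \<noteq> 0" "k + 1 \<noteq> 0" using k by auto
  then have "0 < k * (k + 1)" by (auto simp: zero_less_mult_iff)
  then show "0 < x\<^sup>2 + x" unfolding e by (simp only: of_int_0_less_iff)
qed

lemma Ints_square_plus_half: fixes x :: real assumes "x \<in> \<int>" shows "(x\<^sup>2 + x) / 2 \<in> \<int>"
proof -
  obtain k where k: "x = of_int k" using assms by (auto elim: Ints_cases)
  have "even (k * (k + 1))" by simp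
  then obtain l where "k * (k + 1) = 2 * l" by (elim evenE)
  then have "x\<^sup>2 + x = 2 * of_int l" by (simp add: k power2_eq_square algebra_simps flip: of_int_mult of_int_add)
  then show ?thesis by simp
qed

lemma inner_vec_power2: "x \<bullet> x = (\<Sum>i\<in>UNIV. (x $ i)\<^sup>2)" for x :: "real ^ 'm"
  by (simp add: inner_vec_def power2_eq_square)

text \<open>An integer and its square have the same parity, so the squared norm is congruent to the
  coordinate sum modulo 2.\<close>

lemma even_norm_integral:
  fixes x :: "real ^ 'm"
  assumes "\<And>i. x $ i \<in> \<int>" "(\<Sum>i\<in>UNIV. x $ i) / 2 \<in> \<int>"
  shows "(x \<bullet> x) / 2 \<in> \<int>"
proof -
  have e: "(x \<bullet> x) / 2 = (\<Sum>i\<in>UNIV. ((x $ i)\<^sup>2 + x $ i) / 2) - (\<Sum>i\<in>UNIV. x $ i) / 2"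
    by (simp add: inner_vec_power2 sum.distrib add_divide_distrib sum_divide_distrib)
  show ?thesis unfolding e using assms by (intro Ints_diff Ints_sum Ints_square_plus_half)
qed

lemma sum_axis: "(\<Sum>i\<in>UNIV. axis a c $ i) = c" for c :: real
  by (simp add: axis_def)

lemma three_distinct:
  assumes "3 \<le> card S"
  obtains a b c where "a \<in> S" "b \<in> S" "c \<in> S" "a \<noteq> b" "a \<noteq> c" "b \<noteq> c"
proof -
  obtain T where "T \<subseteq> S" "card T = 3" using obtain_subset_with_card_n[OF assms] by blast
  then show thesis using that by (auto simp: card_3_iff)
qed

lemma axis_root_inner:
  fixes a b c :: "'m::finite"
  assumes "a \<noteq> b" "a \<noteq> c" "b \<noteq> c"
  defines "p \<equiv> axis a 1 - axis b 1 :: real ^ 'm" and "r \<equiv> axis a 1 - axis c 1"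
  shows "p \<bullet> p = 2" "r \<bullet> r = 2" "r \<bullet> p = 1"
  using assms by (auto simp: p_def r_def inner_diff_left inner_diff_right inner_axis_axis)

text \<open>The index type has at least three elements, enough for two roots that share one
  index.\<close>

lemma lattice_A_skew_pair:
  assumes "2 \<le> CARD('n::finite)"
  shows "\<exists>p r. skew_pair (lattice_A :: (real ^ 'n option) set) p r"
proof -
  have "3 \<le> card (UNIV :: 'n option set)" using assms by simp
  then obtain a b c :: "'n option" where d: "a \<noteq> b" "a \<noteq> c" "b \<noteq> c" by (rule three_distinct)
  have "skew_pair (lattice_A :: (real ^ 'n option) set) (axis a 1 - axis b 1) (axis a 1 - axis c 1)"
  proof (rule even_lattice_skew_pair)
    show "(x \<bullet> x) / 2 \<in> \<int>" if "x \<in> lattice_A" for x :: "real ^ 'n option"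
      using that by (intro even_norm_integral) (auto simp: lattice_A_def)
    show "axis a 1 - axis b 1 \<in> (lattice_A :: (real ^ 'n option) set)" "axis a 1 - axis c 1 \<in> (lattice_A :: (real ^ 'n option) set)"
      by (auto simp: lattice_A_def sum_subtractf sum_axis) (auto simp: axis_def)
  qed (use axis_root_inner[OF d] in \<open>auto simp: lattice_A_def sum_subtractf\<close>)
  then show ?thesis by blast
qed

lemma lattice_D_skew_pair:
  assumes "3 \<le> CARD('n::finite)"
  shows "\<exists>p r. skew_pair (lattice_D :: (real ^ 'n) set) p r"
proof -
  obtain a b c :: "'n" where d: "a \<noteq> b" "a \<noteq> c" "b \<noteq> c" using assms by (rule three_distinct)
  have "skew_pair (lattice_D :: (real ^ 'n) set) (axis a 1 - axis b 1) (axis a 1 - axis c 1)"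
  proof (rule even_lattice_skew_pair)
    show "(x \<bullet> x) / 2 \<in> \<int>" if "x \<in> lattice_D" for x :: "real ^ 'n"
      using that by (intro even_norm_integral) (auto simp: lattice_D_def)
    show "axis a 1 - axis b 1 \<in> (lattice_D :: (real ^ 'n) set)" "axis a 1 - axis c 1 \<in> (lattice_D :: (real ^ 'n) set)"
      by (auto simp: lattice_D_def sum_subtractf sum_axis) (auto simp: axis_def)
  qed (use axis_root_inner[OF d] in \<open>auto simp: lattice_D_def sum_subtractf diff_divide_distrib\<close>)
  then show ?thesis by blast
qed

text \<open>The full \<open>E\<^sub>8\<close> lattice; the lattices generated by \<open>roots_E6\<close>, \<open>roots_E7\<close> and \<open>roots_E8\<close> lie in it.\<close>

definition E8_lattice :: "(real ^ 8) set" where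
  "E8_lattice = {x. (\<forall>i j. x $ i - x $ j \<in> \<int>) \<and> (\<forall>i. 2 * x $ i \<in> \<int>) \<and> (\<Sum>i\<in>UNIV. x $ i) / 2 \<in> \<int>}"

text \<open>When the coordinates are not integers they are integers plus 1/2; shifting them by 1/2
  leaves an error of 1/8 each, and the eight errors add up to the integer 1.\<close>

lemma E8_lattice_even: assumes "x \<in> E8_lattice" shows "(x \<bullet> x) / 2 \<in> \<int>"
proof (cases "\<forall>i. x $ i \<in> \<int>")
  case True
  then show ?thesis using assms by (intro even_norm_integral) (auto simp: E8_lattice_def)
next
  case False
  have half: "x $ i - 1 / 2 \<in> \<int>" for i
  proof -
    obtain i0 where i0: "x $ i0 \<notin> \<int>" using False by blast
    have "2 * x $ i0 \<in> \<int>" using assms by (simp add: E8_lattice_def)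
    then obtain k where k: "2 * x $ i0 = of_int k" by (elim Ints_cases)
    have "odd k"
    proof
      assume "even k"
      then obtain l where "k = 2 * l" by (elim evenE)
      then have "x $ i0 = of_int l" using k by simp
      then show False using i0 by simp
    qed
    then obtain l where "k = 2 * l + 1" by (elim oddE)
    then have "x $ i0 - 1 / 2 = of_int l" using k by simp
    then have "x $ i0 - 1 / 2 \<in> \<int>" by simp
    moreover have "x $ i - x $ i0 \<in> \<int>" using assms by (simp add: E8_lattice_def)
    ultimately have "(x $ i0 - 1 / 2) + (x $ i - x $ i0) \<in> \<int>" by (rule Ints_add)
    then show ?thesis by simp
  qed
  have e: "(x \<bullet> x) / 2 = (\<Sum>i\<in>UNIV. ((x $ i - 1 / 2)\<^sup>2 + (x $ i - 1 / 2)) / 2) + 1"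
  proof -
    have "(x $ i)\<^sup>2 / 2 = ((x $ i - 1 / 2)\<^sup>2 + (x $ i - 1 / 2)) / 2 + 1 / 8" for i
      by (simp add: power2_eq_square field_simps)
    then have "(x \<bullet> x) / 2 = (\<Sum>i\<in>(UNIV :: 8 set). ((x $ i - 1 / 2)\<^sup>2 + (x $ i - 1 / 2)) / 2 + 1 / 8)"
      unfolding inner_vec_power2 sum_divide_distrib by (rule sum.cong[OF refl])
    then show ?thesis by (simp add: sum.distrib)
  qed
  show ?thesis unfolding e using half by (intro Ints_add Ints_sum Ints_square_plus_half Ints_1)
qed

lemma roots_E8_subset: "roots_E8 \<subseteq> E8_lattice"
proof
  fix x :: "real ^ 8" assume "x \<in> roots_E8"
  then consider a b i j where "a \<in> {-1, 1}" "b \<in> {-1, 1}" "i \<noteq> j" "x = a *\<^sub>R axis i 1 + b *\<^sub>R axis j 1"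
    | "\<forall>i. x $ i \<in> {-1/2, 1/2}" "even (card {i. x $ i = -1/2})"
    unfolding roots_E8_def by blast
  then show "x \<in> E8_lattice"
  proof cases
    case 1
    have ab: "a \<in> \<int>" "b \<in> \<int>" "(a + b) / 2 \<in> \<int>" using 1 by auto
    have "x $ k \<in> \<int>" for k using ab by (auto simp: 1 axis_def)
    moreover have "(\<Sum>k\<in>UNIV. x $ k) = a + b"
      by (simp add: 1(4) sum.distrib sum_axis flip: sum_distrib_left)
    ultimately show ?thesis using ab by (auto simp: E8_lattice_def intro!: Ints_diff Ints_mult)
  next
    case 2
    let ?S = "{i. x $ i = -1/2}"
    have c: "x $ i = -1/2 \<or> x $ i = 1/2" for i using 2(1) by auto
    have "x $ i - x $ j = -1 \<or> x $ i - x $ j = 0 \<or> x $ i - x $ j = 1" "2 * x $ i = -1 \<or> 2 * x $ i = 1" for i j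
      using c[of i] c[of j] by linarith+
    then have "x $ i - x $ j \<in> \<int>" "2 * x $ i \<in> \<int>" for i j
      by (metis Ints_0 Ints_1 Ints_minus)+
    moreover have "(\<Sum>i\<in>UNIV. x $ i) / 2 \<in> \<int>"
    proof -
      \<comment> \<open>Starting from the sum 4, every coordinate \<open>-1/2\<close> takes away 1,
        and there is an even number of them.\<close>
      have "x $ i = 1 / 2 - (if x $ i = -1/2 then 1 else 0)" for i using c[of i] by auto
      then have "(\<Sum>i\<in>UNIV. x $ i) = (\<Sum>i\<in>(UNIV :: 8 set). 1 / 2 - (if x $ i = -1/2 then 1 else 0))" by (metis (no_types, lifting) sum.cong)
      also have "\<dots> = 4 - real (card ?S)" by (simp add: sum_subtractf sum.If_cases)
      finally have "(\<Sum>i\<in>UNIV. x $ i) / 2 = 2 - real (card ?S) / 2" by simp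
      moreover obtain l where "card ?S = 2 * l" using 2(2) by (elim evenE)
      ultimately have "(\<Sum>i\<in>UNIV. x $ i) / 2 = 2 - of_nat l" by simp
      then show ?thesis by (metis Ints_diff Ints_numeral Ints_of_nat)
    qed
    ultimately show ?thesis by (simp add: E8_lattice_def)
  qed
qed

lemma generated_lattice_closed:
  "0 \<in> generated_lattice R" "x \<in> generated_lattice R \<Longrightarrow> y \<in> generated_lattice R \<Longrightarrow> x - y \<in> generated_lattice R"
proof -
  let ?P = "\<lambda>S. 0 \<in> S \<and> (\<forall>x\<in>S. \<forall>y\<in>S. x - y \<in> S)"
  have "?P (?P hull R)" by (rule hull_in) blast
  then show "0 \<in> generated_lattice R" "x \<in> generated_lattice R \<Longrightarrow> y \<in> generated_lattice R \<Longrightarrow> x - y \<in> generated_lattice R"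
    unfolding generated_lattice_def by blast+
qed

text \<open>The six coordinates other than 1 and 8 carry a root system \<open>A\<^sub>5\<close>
  inside \<open>roots_E6\<close>, which serves all three exceptional lattices at once. Evenness is
  inherited from \<open>E8_lattice\<close>.\<close>

lemma generated_E_skew_pair:
  assumes R: "R \<subseteq> roots_E8" and E6: "roots_E6 \<subseteq> R"
  shows "\<exists>p r. skew_pair (generated_lattice R) p r"
proof -
  have "card (UNIV - {1, 8} :: 8 set) \<ge> 3"
  proof -
    have "card {1, 8 :: 8} \<le> 2" by (simp add: card_insert_if)
    then show ?thesis by (simp add: card_Diff_subset)
  qed
  then obtain a b c :: 8 where d: "a \<noteq> b" "a \<noteq> c" "b \<noteq> c" and n: "a \<notin> {1, 8}" "b \<notin> {1, 8}" "c \<notin> {1, 8}"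
    by (rule three_distinct) blast
  have root: "axis i 1 - axis j 1 \<in> roots_E6" if "i \<noteq> j" "i \<notin> {1, 8}" "j \<notin> {1, 8}" for i j :: 8
  proof -
    have "axis i 1 - axis j 1 = (1::real) *\<^sub>R axis i 1 + (- 1) *\<^sub>R axis j (1::real)" by simp
    then have "axis i 1 - axis j 1 \<in> roots_E8" unfolding roots_E8_def using that(1) by blast
    moreover have "(\<Sum>k\<in>UNIV - {1, 8}. (axis i 1 - axis j 1 :: real ^ 8) $ k) = 0"
      using that by (simp add: axis_def sum_subtractf)
    ultimately show ?thesis using that by (simp add: roots_E6_def axis_def)
  qed
  have submodule: "generated_lattice R \<subseteq> E8_lattice"
    unfolding generated_lattice_def
  proof (rule hull_minimal)
    show "R \<subseteq> E8_lattice" using R roots_E8_subset by blast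
    have "x - y \<in> E8_lattice" if "x \<in> E8_lattice" "y \<in> E8_lattice" for x y
    proof -
      have "(x - y) $ i - (x - y) $ j = (x $ i - x $ j) - (y $ i - y $ j)" "2 * (x - y) $ i = 2 * x $ i - 2 * y $ i" for i j
        by simp_all
      moreover have "(\<Sum>i\<in>UNIV. (x - y) $ i) / 2 = (\<Sum>i\<in>UNIV. x $ i) / 2 - (\<Sum>i\<in>UNIV. y $ i) / 2"
        by (simp add: sum_subtractf diff_divide_distrib)
      ultimately show ?thesis using that unfolding E8_lattice_def by (simp only: mem_Collect_eq) (blast intro: Ints_diff)
    qed
    then show "0 \<in> E8_lattice \<and> (\<forall>x\<in>E8_lattice. \<forall>y\<in>E8_lattice. x - y \<in> E8_lattice)"
      by (simp add: E8_lattice_def)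
  qed
  have gen: "R \<subseteq> generated_lattice R" unfolding generated_lattice_def by (rule hull_subset)
  have "skew_pair (generated_lattice R) (axis a 1 - axis b 1) (axis a 1 - axis c 1)"
  proof (rule even_lattice_skew_pair)
    show "(x \<bullet> x) / 2 \<in> \<int>" if "x \<in> generated_lattice R" for x using that submodule E8_lattice_even by blast
    show "axis a 1 - axis b 1 \<in> generated_lattice R" "axis a 1 - axis c 1 \<in> generated_lattice R"
      using root d n E6 gen by blast+
  qed (use generated_lattice_closed axis_root_inner[OF d] in auto)
  then show ?thesis by blast
qed

section \<open>Dual lattices\<close>

lemma dual_lattice_closed:
  "0 \<in> dual_lattice L" "x \<in> dual_lattice L \<Longrightarrow> y \<in> dual_lattice L \<Longrightarrow> x - y \<in> dual_lattice L"
  by (auto simp: dual_lattice_def span_0 span_diff inner_diff_right)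

lemma half_integer_norm: assumes "2 * (x::real) \<in> \<int>" "x \<noteq> 0" shows "1 / 2 \<le> \<bar>x\<bar>"
  using Ints_nonzero_abs_ge1[OF assms(1)] assms(2) by simp

text \<open>\<open>p\<close> is a unit vector and \<open>r\<close> has all coordinates 1/2. The
  coordinates of a dual vector are either all integers or all half of odd integers. In the second
  case at least two coordinates besides \<open>a\<close> contribute 1/2 together, more than the 1/4
  by which the square of \<open>q $ a\<close> can fall short of \<open>q $ a\<close>.\<close>

lemma dual_D_skew_pair:
  assumes n: "3 \<le> CARD('n::finite)"
  shows "\<exists>p r. skew_pair (dual_lattice (lattice_D :: (real ^ 'n) set)) p r"
proof -
  let ?D = "lattice_D :: (real ^ 'n) set"
  define a where "a = (undefined :: 'n)"
  define p where "p = (axis a 1 :: real ^ 'n)"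
  define r where "r = (\<chi> i. 1 / 2 :: real ^ 'n)"
  have sp: "x \<in> span ?D" for x
  proof -
    have "axis i 1 \<in> span ?D" for i
    proof -
      have "axis i 2 \<in> ?D" by (simp add: lattice_D_def sum_axis) (simp add: axis_def)
      then have "(1/2) *\<^sub>R axis i 2 \<in> span ?D" by (intro span_scale span_base)
      moreover have "(1/2) *\<^sub>R axis i 2 = (axis i 1 :: real ^ 'n)" by (simp add: vec_eq_iff axis_def)
      ultimately show ?thesis by simp
    qed
    then have "(\<Sum>i\<in>UNIV. (x $ i) *\<^sub>R axis i 1) \<in> span ?D" by (intro span_sum span_scale)
    moreover have "(\<Sum>i\<in>UNIV. (x $ i) *\<^sub>R axis i 1) = x"
      by (simp add: vec_eq_iff axis_def if_distrib sum.If_cases cong: if_cong)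
    ultimately show ?thesis by simp
  qed
  have dual: "x \<in> dual_lattice ?D \<longleftrightarrow> (\<forall>y\<in>?D. y \<bullet> x \<in> \<int>)" for x using sp by (simp add: dual_lattice_def)
  have coord: "2 * x $ i \<in> \<int>" "x $ i - x $ j \<in> \<int>" if x: "x \<in> dual_lattice ?D" for x i j
  proof -
    have "axis i 2 \<in> ?D" by (simp add: lattice_D_def sum_axis) (simp add: axis_def)
    then have "axis i 2 \<bullet> x \<in> \<int>" using x unfolding dual by blast
    then show "2 * x $ i \<in> \<int>" by (simp add: inner_axis')
    have "axis i 1 - axis j 1 \<in> ?D" by (simp add: lattice_D_def sum_subtractf sum_axis) (simp add: axis_def)
    then have "(axis i 1 - axis j 1) \<bullet> x \<in> \<int>" using x unfolding dual by blast
    then show "x $ i - x $ j \<in> \<int>" by (simp add: inner_axis' inner_diff_left)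
  qed
  have inner_p: "x \<bullet> p = x $ a" and inner_r: "x \<bullet> r = (\<Sum>i\<in>UNIV. x $ i / 2)" for x
    unfolding p_def r_def by (simp add: inner_axis) (simp add: inner_vec_def)
  have "skew_pair (dual_lattice ?D) p r"
    unfolding skew_pair_def
  proof (intro conjI ballI impI)
    show "0 \<in> dual_lattice ?D" by (rule dual_lattice_closed)
    show "x - y \<in> dual_lattice ?D" if "x \<in> dual_lattice ?D" "y \<in> dual_lattice ?D" for x y
      using dual_lattice_closed that by blast
    have "1 / 2 \<le> norm x" if x: "x \<in> dual_lattice ?D" "x \<noteq> 0" for x
    proof -
      obtain i where "x $ i \<noteq> 0" using x(2) by (auto simp: vec_eq_iff)
      then have "1 / 2 \<le> \<bar>x $ i\<bar>" using coord(1)[OF x(1)] half_integer_norm by blast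
      also have "\<dots> \<le> norm x" by (rule component_le_norm_cart)
      finally show ?thesis .
    qed
    then show "\<exists>m>0. \<forall>x\<in>dual_lattice ?D. x \<noteq> 0 \<longrightarrow> m \<le> norm x" by (intro exI[of _ "1/2"]) auto
    show "p \<in> dual_lattice ?D" unfolding dual inner_p by (simp add: lattice_D_def)
    show "p \<noteq> 0" by (simp add: p_def)
    show "r \<in> dual_lattice ?D" unfolding dual inner_r by (simp add: lattice_D_def sum_divide_distrib)
    show "0 < r \<bullet> p" "r \<bullet> p < p \<bullet> p" unfolding inner_p by (simp_all add: r_def p_def)
    show "q \<bullet> r \<le> q \<bullet> q" if q: "q \<in> dual_lattice ?D" for q
      unfolding inner_r inner_vec_power2
    proof (rule sum_mono)
      fix i
      have "- (2 * q $ i) \<in> \<int>" using coord(1)[OF q, of i] by (rule Ints_minus)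
      then have "0 \<le> (- (2 * q $ i))\<^sup>2 + (- (2 * q $ i))" by (rule Ints_square_plus)
      then show "q $ i / 2 \<le> (q $ i)\<^sup>2" by (simp add: power2_eq_square)
    qed
    show "q \<bullet> p < q \<bullet> q" if q: "q \<in> dual_lattice ?D" "q \<noteq> 0" "q \<noteq> p" for q
    proof -
      have split: "q \<bullet> q = (q $ a)\<^sup>2 + (\<Sum>i\<in>UNIV - {a}. (q $ i)\<^sup>2)"
        unfolding inner_vec_power2 by (subst sum.remove[of UNIV a]) auto
      show ?thesis
      proof (cases "q $ a \<in> \<int>")
        case True
        have qa: "0 \<le> (- q $ a)\<^sup>2 + (- q $ a)" by (rule Ints_square_plus) (use True in simp)
        show ?thesis
        proof (cases "\<exists>i\<in>UNIV - {a}. q $ i \<noteq> 0")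
          case True
          then obtain i where i: "i \<in> UNIV - {a}" "q $ i \<noteq> 0" by blast
          have "0 < (q $ i)\<^sup>2" using i by simp
          also have "(q $ i)\<^sup>2 \<le> (\<Sum>i\<in>UNIV - {a}. (q $ i)\<^sup>2)" by (rule member_le_sum[OF i(1)]) auto
          finally show ?thesis using qa unfolding split inner_p by simp
        next
          case False
          have "q = axis a (q $ a)" using False by (auto simp: vec_eq_iff axis_def)
          then have "q $ a \<noteq> 0" "q $ a \<noteq> 1" using q(2,3) unfolding p_def by (metis axis_eq_0_iff, metis)
          then have "0 < (- q $ a)\<^sup>2 + (- q $ a)" using True by (intro Ints_square_plus) auto
          then show ?thesis using False unfolding split inner_p by simp
        qed
      next
        case False
        have "1 / 4 \<le> (q $ i)\<^sup>2" for i
        proof -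
          have "q $ i \<noteq> 0" using Ints_add[OF coord(2)[OF q(1), of a i], of "q $ i"] False by auto
          then have "1 / 2 \<le> \<bar>q $ i\<bar>" using coord(1)[OF q(1)] half_integer_norm by blast
          then have "(1 / 2)\<^sup>2 \<le> \<bar>q $ i\<bar>\<^sup>2" by (intro power_mono) auto
          then show ?thesis by (simp add: power2_eq_square)
        qed
        then have "(\<Sum>i\<in>UNIV - {a}. 1 / 4) \<le> (\<Sum>i\<in>UNIV - {a}. (q $ i)\<^sup>2)" by (intro sum_mono)
        moreover have "(1/2 :: real) \<le> (\<Sum>i\<in>UNIV - {a}. 1 / 4)" using n by (simp add: card_Diff_singleton)
        moreover have "0 \<le> (q $ a - 1 / 2)\<^sup>2" by simp
        ultimately show ?thesis unfolding split inner_p by (simp add: power2_eq_square algebra_simps)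
      qed
    qed
  qed
  then show ?thesis by blast
qed

text \<open>\<open>u c\<close> is the projection of a unit vector to the hyperplane of coordinate
  sum zero. Distinct ones have inner product \<open>- 1 / N\<close>, so \<open>- u b\<close> has the
  inner product \<open>1 / N\<close> with \<open>u a\<close>, less than \<open>1 - 1 / N\<close>
  because \<open>N\<close> is at least 3.\<close>

lemma dual_A_skew_pair:
  assumes n: "2 \<le> CARD('n::finite)"
  shows "\<exists>p r. skew_pair (dual_lattice (lattice_A :: (real ^ 'n option) set)) p r"
proof -
  let ?A = "lattice_A :: (real ^ 'n option) set"
  define N where "N = real (CARD('n option))"
  have N: "3 \<le> N" using n by (simp add: N_def)
  define a b where "a = (None :: 'n option)" and "b = Some (undefined :: 'n)"
  have ab: "a \<noteq> b" by (simp add: a_def b_def)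
  define u where "u a = (\<chi> i. (if i = a then 1 else 0) - 1 / N :: real ^ 'n option)" for a
  have card: "(\<Sum>i\<in>(UNIV :: 'n option set). c) = N * c" for c :: real by (simp add: N_def)
  have root: "axis i 1 - axis j 1 \<in> ?A" for i j
    by (simp add: lattice_A_def sum_subtractf sum_axis) (simp add: axis_def)
  have sum0: "(\<Sum>i\<in>UNIV. x $ i) = 0" if "x \<in> span ?A" for x
  proof -
    have "subspace {x :: real ^ 'n option. (\<Sum>i\<in>UNIV. x $ i) = 0}"
      by (auto simp: subspace_def sum.distrib simp flip: sum_distrib_left)
    then have "span ?A \<subseteq> {x. (\<Sum>i\<in>UNIV. x $ i) = 0}" by (intro span_minimal) (auto simp: lattice_A_def)
    then show ?thesis using that by blast
  qed
  have spanI: "x \<in> span ?A" if "(\<Sum>i\<in>UNIV. x $ i) = 0" for x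
  proof -
    have "(\<Sum>i\<in>UNIV. (x $ i) *\<^sub>R (axis i 1 - axis a 1)) \<in> span ?A" by (intro span_sum span_scale span_base root)
    moreover have "(\<Sum>i\<in>UNIV. (x $ i) *\<^sub>R (axis i 1 - axis a 1)) = x"
    proof -
      have "(\<Sum>i\<in>UNIV. (x $ i) *\<^sub>R (axis i 1 - axis a 1)) = (\<Sum>i\<in>UNIV. (x $ i) *\<^sub>R axis i 1) - (\<Sum>i\<in>UNIV. x $ i) *\<^sub>R axis a 1"
        by (simp add: scaleR_diff_right sum_subtractf scaleR_left.sum)
      also have "(\<Sum>i\<in>UNIV. (x $ i) *\<^sub>R axis i 1) = x"
        by (simp add: vec_eq_iff axis_def if_distrib sum.If_cases cong: if_cong)
      finally show ?thesis using that by simp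
    qed
    ultimately show ?thesis by simp
  qed
  have dual: "(\<Sum>i\<in>UNIV. x $ i) = 0" "x $ i - x $ j \<in> \<int>" if x: "x \<in> dual_lattice ?A" for x i j
  proof -
    show "(\<Sum>i\<in>UNIV. x $ i) = 0" using x sum0 by (auto simp: dual_lattice_def)
    have "(axis i 1 - axis j 1) \<bullet> x \<in> \<int>" using x root by (auto simp: dual_lattice_def)
    then show "x $ i - x $ j \<in> \<int>" by (simp add: inner_axis' inner_diff_left)
  qed
  have inner_u: "x \<bullet> u c = x $ c" if "(\<Sum>i\<in>UNIV. x $ i) = 0" for x c
  proof -
    have "x \<bullet> u c = (\<Sum>i\<in>UNIV. x $ i * (if i = c then 1 else 0) - x $ i * (1 / N))"
      by (simp add: inner_vec_def u_def right_diff_distrib)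
    also have "\<dots> = (\<Sum>i\<in>UNIV. x $ i * (if i = c then 1 else 0)) - (\<Sum>i\<in>UNIV. x $ i) * (1 / N)"
      by (simp only: sum_subtractf sum_distrib_right)
    finally show ?thesis using that by (simp add: if_distrib cong: if_cong)
  qed
  have sum_u: "(\<Sum>i\<in>UNIV. u c $ i) = 0" for c
    unfolding u_def vec_lambda_beta sum_subtractf card using N by simp
  have u_dual: "u c \<in> dual_lattice ?A" for c
  proof -
    have "x \<bullet> u c \<in> \<int>" if "x \<in> ?A" for x using that inner_u[of x c] by (auto simp: lattice_A_def)
    then show ?thesis using spanI[OF sum_u] by (simp add: dual_lattice_def)
  qed
  have strict: "q $ c < q \<bullet> q" if q: "q \<in> dual_lattice ?A" "q \<noteq> 0" "q \<noteq> u c" for q c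
  proof -
    \<comment> \<open>Differences of coordinates are integers and, as the coordinates sum to zero,
      they determine \<open>q\<close>. In terms of them the claim reads
      \<open>K\<^sup>2 - K < N * S\<close>.\<close>
    define k where "k i = q $ i - q $ c" for i
    define S where "S = (\<Sum>i\<in>UNIV - {c}. (k i)\<^sup>2)"
    define K where "K = (\<Sum>i\<in>UNIV - {c}. k i)"
    have kc: "k c = 0" by (simp add: k_def)
    have kZ: "k i \<in> \<int>" for i using dual(2)[OF q(1)] by (simp add: k_def)
    have full: "(\<Sum>i\<in>UNIV. k i) = K" "(\<Sum>i\<in>UNIV. (k i)\<^sup>2) = S"
      using kc by (auto simp: K_def S_def sum.remove[of UNIV c])
    have "K = - (N * q $ c)" using dual(1)[OF q(1)] unfolding full(1)[symmetric] k_def sum_subtractf card by simp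
    then have qc: "q $ c = - K / N" using N by (simp add: field_simps)
    have "q \<bullet> q = (\<Sum>i\<in>UNIV. (k i)\<^sup>2 + 2 * q $ c * k i + (q $ c)\<^sup>2)"
      unfolding inner_vec_power2 by (intro sum.cong) (auto simp: k_def power2_eq_square algebra_simps)
    also have "\<dots> = S + 2 * q $ c * K + N * (q $ c)\<^sup>2"
      unfolding sum.distrib card sum_distrib_left[symmetric] full by simp
    also have "\<dots> = S - K\<^sup>2 / N" using N by (simp add: qc power2_eq_square field_simps)
    finally have qq: "q \<bullet> q = S - K\<^sup>2 / N" .
    \<comment> \<open>Cauchy-Schwarz over the \<open>N - 1\<close> indices other than
      \<open>c\<close>. It leaves \<open>0 < S + K\<close> to be shown, a sum of the nonnegative
      integers \<open>(k i)\<^sup>2 + k i\<close>, which can vanish only if each \<open>k i\<close>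
      is 0 or -1.\<close>
    have CS: "K\<^sup>2 \<le> (N - 1) * S"
      using sum_squared_le_sum_of_squares[of k "UNIV - {c}"] N by (simp add: K_def S_def N_def mult.commute)
    have SK: "S + K = (\<Sum>i\<in>UNIV - {c}. (k i)\<^sup>2 + k i)" by (simp add: S_def K_def sum.distrib)
    have "K\<^sup>2 - K < N * S"
    proof (cases "\<forall>i\<in>UNIV - {c}. k i = 0 \<or> k i = - 1")
      case False
      then obtain i where i: "i \<in> UNIV - {c}" "k i \<noteq> 0" "k i \<noteq> - 1" by blast
      have "0 < (k i)\<^sup>2 + k i" using Ints_square_plus(2)[OF kZ i(2,3)] .
      also have "\<dots> \<le> (\<Sum>i\<in>UNIV - {c}. (k i)\<^sup>2 + k i)"
        by (rule member_le_sum[OF i(1)]) (use Ints_square_plus(1)[OF kZ] in auto)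
      finally have "0 < S + K" using SK by simp
      then show ?thesis using CS by (simp add: algebra_simps)
    next
      case True
      \<comment> \<open>The remaining vectors are given by the set \<open>T\<close> of indices with
        difference -1; its two extremes are \<open>q = 0\<close> and \<open>q = u c\<close>, both
        excluded.\<close>
      define T where "T = {i \<in> UNIV - {c}. k i = - 1}"
      have val: "k i = (if i \<in> T then - 1 else 0)" for i using True kc by (cases "i = c") (auto simp: T_def)
      have T: "T \<subseteq> UNIV - {c}" by (auto simp: T_def)
      have KS: "K = - real (card T)" "S = real (card T)"
      proof -
        have "(k i)\<^sup>2 = (if i \<in> T then 1 else 0)" for i by (simp add: val)
        then show "K = - real (card T)" "S = real (card T)"
          unfolding K_def S_def using T by (simp_all add: val sum.If_cases Int_absorb1)
      qed
      have "T \<noteq> {}"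
      proof
        assume "T = {}"
        then have "K = 0" "\<And>i. k i = 0" using KS val by auto
        then have "q $ i = 0" for i using qc by (simp add: k_def)
        then show False using q(2) by (simp add: vec_eq_iff)
      qed
      have "T \<noteq> UNIV - {c}"
      proof
        assume T: "T = UNIV - {c}"
        then have "real (card T) = N - 1" by (simp add: N_def)
        then have "q $ c = 1 - 1 / N" using qc KS N by (simp add: field_simps)
        moreover have "q $ i = q $ c - 1" if "i \<noteq> c" for i using val[of i] T that by (simp add: k_def)
        ultimately have "q = u c" by (auto simp: vec_eq_iff u_def)
        then show False using q(3) by simp
      qed
      then have "card T < card (UNIV - {c})" using T by (intro psubset_card_mono) auto
      then have "real (card T) + 1 < N" by (simp add: N_def)
      moreover have "0 < real (card T)" using \<open>T \<noteq> {}\<close> by (simp add: card_gt_0_iff)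
      ultimately have "real (card T) * (real (card T) + 1) < real (card T) * N" by simp
      then show ?thesis unfolding KS by (simp add: power2_eq_square algebra_simps)
    qed
    then have "(K\<^sup>2 - K) / N < S" using N by (simp add: field_simps)
    then show ?thesis unfolding qq qc by (simp add: diff_divide_distrib)
  qed
  have uu: "u c \<bullet> u c = 1 - 1 / N" "u b \<bullet> u a = - 1 / N" for c
    using inner_u[OF sum_u] ab by (auto simp: u_def)
  have le: "q $ c \<le> q \<bullet> q" if "q \<in> dual_lattice ?A" for q c
    using strict[OF that, of c] inner_u[OF sum_u[of c], of c]
    by (cases "q = 0 \<or> q = u c") auto
  have "skew_pair (dual_lattice ?A) (u a) (- u b)"
    unfolding skew_pair_def
  proof (intro conjI ballI impI)
    show "0 \<in> dual_lattice ?A" by (rule dual_lattice_closed)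
    show "x - y \<in> dual_lattice ?A" if "x \<in> dual_lattice ?A" "y \<in> dual_lattice ?A" for x y
      using dual_lattice_closed that by blast
    have "1 / 2 \<le> norm x" if x: "x \<in> dual_lattice ?A" "x \<noteq> 0" for x
    proof -
      have "\<exists>i. x $ i \<noteq> x $ a"
      proof (rule ccontr)
        assume "\<not> ?thesis"
        then have c: "x $ i = x $ a" for i by blast
        have "(\<Sum>i\<in>UNIV. x $ i) = N * x $ a" by (subst c) (rule card)
        then have "x $ a = 0" using N dual(1)[OF x(1)] by simp
        then show False using c x(2) by (auto simp: vec_eq_iff)
      qed
      then obtain i where "x $ i - x $ a \<noteq> 0" by auto
      then have "1 \<le> \<bar>x $ i - x $ a\<bar>" using Ints_nonzero_abs_ge1 dual(2)[OF x(1)] by blast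
      then show ?thesis using component_le_norm_cart[of x i] component_le_norm_cart[of x a] by linarith
    qed
    then show "\<exists>m>0. \<forall>x\<in>dual_lattice ?A. x \<noteq> 0 \<longrightarrow> m \<le> norm x" by (intro exI[of _ "1/2"]) auto
    show "u a \<in> dual_lattice ?A" by (rule u_dual)
    show "u a \<noteq> 0" using uu(1)[of a] N by auto
    show "- u b \<in> dual_lattice ?A" using dual_lattice_closed(2)[OF dual_lattice_closed(1) u_dual[of b]] by simp
    show "q \<bullet> u a < q \<bullet> q" if "q \<in> dual_lattice ?A" "q \<noteq> 0" "q \<noteq> u a" for q
      using strict[OF that] inner_u[OF dual(1)[OF that(1)]] by simp
    show "q \<bullet> (- u b) \<le> q \<bullet> q" if q: "q \<in> dual_lattice ?A" for q
    proof -
      have "- q \<in> dual_lattice ?A" using dual_lattice_closed(2)[OF dual_lattice_closed(1) q] by simp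
      from le[OF this, of b] show ?thesis using inner_u[OF dual(1)[OF q], of b] by simp
    qed
    show "0 < (- u b) \<bullet> u a" "(- u b) \<bullet> u a < u a \<bullet> u a"
      unfolding inner_minus_left uu using N by (simp_all add: field_simps)
  qed
  then show ?thesis by blast
qed

section \<open>The complete list of lattices and the conclusion\<close>

lemma non_cartesian_root_like:
  fixes L :: "(real ^ 'n) set"
  assumes "non_cartesian_root_lattice L"
  shows "\<exists>p r. root_like_lattice L p r"
proof -
  have E: "roots_E6 \<subseteq> roots_E8" "roots_E7 \<subseteq> roots_E8" by (auto simp: roots_E6_def roots_E7_def)
  have E67: "roots_E6 \<subseteq> roots_E7"
  proof
    fix x assume x: "x \<in> roots_E6"
    have "(\<Sum>i\<in>UNIV. x $ i) = (\<Sum>i\<in>{1, 8}. x $ i) + (\<Sum>i\<in>UNIV - {1, 8}. x $ i)"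
      using sum.subset_diff[of "{1, 8}" UNIV "\<lambda>i. x $ i"] by simp
    then show "x \<in> roots_E7" using x by (simp add: roots_E6_def roots_E7_def)
  qed
  show ?thesis
    using assms similar_skew_pair[of L, OF _ lattice_A_skew_pair[where 'n='n]]
      similar_skew_pair[of L, OF _ dual_A_skew_pair[where 'n='n]]
      similar_skew_pair[of L, OF _ lattice_D_skew_pair[where 'n='n]]
      similar_skew_pair[of L, OF _ dual_D_skew_pair[where 'n='n]]
      similar_skew_pair[of L, OF _ generated_E_skew_pair[OF E(1) subset_refl]]
      similar_skew_pair[of L, OF _ generated_E_skew_pair[OF E(2) E67]]
      similar_skew_pair[of L, OF _ generated_E_skew_pair[OF subset_refl E(1)]]
    unfolding non_cartesian_root_lattice_def by blast
qed

theorem corollary3: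
  fixes L :: "(real ^ 'n) set" and J :: nat and v :: "nat \<Rightarrow> real ^ 'n"
    and T :: "nat \<Rightarrow> (real ^ 'n) set set"
  assumes "non_cartesian_root_lattice L"
    and "J \<ge> 1"
    and "v 0 = 0"
    and "\<And>j. T j = affine_tessellation 1 (v j) (voronoi_tessellation L)"
    and "inj_on T {..J}"
    and "efficient (T ` {..J})"
  shows "\<forall>k\<ge>1. \<not> (\<exists>s w. 0 < s \<and> s < 1 \<and> refined_by L J v k s w)"
proof -
  obtain p r where "root_like_lattice L p r" using non_cartesian_root_like[OF assms(1)] by blast
  then interpret root_like_lattice L p r .
  have "efficient ((\<lambda>j. affine_tessellation 1 (v j) (voronoi_tessellation L)) ` {..J})"
    using assms(6) unfolding assms(4)[abs_def] .
  then interpret efficient_family L p r v J by unfold_locales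
  show ?thesis using not_refined by blast
qed

end
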